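(* Let $\pi$ be an $l_+$-reduced index on the diagrams of an oriented virtual knot $\mathcal K$ with coefficients in an abelian group $A$. Then the formula $$\delta^\pi_D=\sum_{v\in\mathcal V(D)}\mathrm{sgn}(v)\,\pi_D(v)\cdot D^-_v$$ defines an invariant 1-cycle $\delta^\pi_D$ on the diagrams of $\mathcal K$, and the formula $$p^\pi_D(v)=\sum_{v'\in\mathcal V(D)}\mathrm{sgn}(v')\,\pi_D(v')\cdot(D^l_v\cdot D^-_{v'})$$ defines an oriented parity $p^\pi$ on the diagrams of $\mathcal K$ with coefficients in the group $\bar A=A/\langle\sigma(\pi)\rangle$, where $\sigma(\pi)=-\sum_{v\in\mathcal V(D)}\pi_D(v)\cdot ip_D(v)\in A$ is the signature of $\pi$ (which does not depend on the diagram $D$ of $\mathcal K$).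
   Context: Diagrams. A virtual knot diagram $D$ is a generic oriented closed curve in the plane whose double points are marked classical (with over/under information) or virtual. A virtual knot $\mathcal K$ is a class of diagrams modulo isotopy, classical Reidemeister moves R1, R2, R3 and detour moves (replacing a path containing only virtual crossings by another path with the same ends containing only virtual crossings). $\mathcal V(D)$ is the set of classical crossings and $\mathrm{sgn}(v)=\pm1$ the usual sign (local writhe) of $v$; $\mathcal A(D)$ is the set of arcs, i.e. pieces of $D$ between consecutive classical crossings (one closed arc if there are no classical crossings). A move $f\colon D\to D'$ induces a partial bijection $f_*\colon\mathcal V(D)\to\mathcal V(D')$ between surviving crossings. Arcs $a\in\mathcal A(D)$, $a'\in\mathcal A(D')$ are correspondent under a Reidemeister move if they share a point outside the region of the move; isotopies and detour moves induce a bijection of arcs. Local picture. Draw a classical crossing $v$ with both strands directed upward: the incoming arcs are SW, SE, the outgoing ones NW, NE, and the strands run SW$\to$NE and SE$\to$NW. The oriented smoothing at $v$ splits $D$ into the left half $D^l_v$ (leaving $v$ along NW, returning along SW) and the right half $D^r_v$ (leaving along NE, returning along SE). Signed halves: $D^-_v=D^r_v$ if $\mathrm{sgn}(v)=+1$ and $D^-_v=D^l_v$ if $\mathrm{sgn}(v)=-1$. Chains. $C_1(D,A)$ is the group of $A$-linear combinations of arcs, i.e. 1-chains of the graph $\tilde D$ with vertices $\mathcal V(D)$ and edges $\mathcal A(D)$ oriented along $D$; $H_1(D,A)$ is its subgroup of 1-cycles. $\tilde D$ is embedded in the closed oriented surface $AD(D)$ obtained by gluing discs to the boundary of the ribbon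 surface that is the (immersed) neighbourhood of $D$ (virtual crossings not being vertices). $C_1\cdot C_2$ denotes the intersection number in $AD(D)$, a transverse intersection counting $+1$ when (tangent of $C_1$, tangent of $C_2$) is positively oriented. The index parity is $ip_D(v)=-(D^l_v\cdot D)\in\mathbb Z$. A family $\gamma_D\in C_1(D,A)$ is invariant if $\gamma_D(a)=\gamma_{D'}(a')$ for every move $D\to D'$ and all correspondent arcs $a,a'$. Index. A family of maps $\pi_D\colon\mathcal V(D)\to A$ for all diagrams of $\mathcal K$ such that: (I0) $\pi_D(v)=\pi_{D'}(f_*(v))$ for any Reidemeister move $f\colon D\to D'$ and any $v$ for which $f_*(v)$ exists; (I2) $\pi_D(v_1)=\pi_D(v_2)$ for any $v_1,v_2$ to which a decreasing R2 can be applied. A crossing $v$ removable by a decreasing R1 is of type $l_\pm$ if the removed loop is the left half $D^l_v$ and of type $r_\pm$ if it is the right half, the subscript being the sign of $v$. The index $\pi$ is $l_+$-reduced if its value on all loop crossings of types $l_+$ and $r_-$ is $0$. Oriented parity with coefficients in an abelian group $B$. A family of maps $p_D\colon\mathcal V(D)\to B$ such that: (P0) $p_D(v)=p_{D'}(f_*(v))$ for every move $f\colon D\to D'$ and every $v$ for which $f_*(v)$ exists; (P1) $p_D(v)=0$ if $v$ disappears in a decreasing R1; (P2) $p_D(v_1)+p_D(v_2)=0$ if $v_1,v_2$ disappear in a decreasing R2; (P3+) $\sum_{i=1}^3\epsilon_\Delta(v_i)p_D(v_i)=0$ if $v_1,v_2,v_3$ are the vertices of the disappearing triangle $\Delta$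 of an R3, where $\epsilon_\Delta(v)=+1$ if $\Delta$ lies to the left or right of $v$ in the local picture (between SW and NW, or between SE and NE) and $-1$ if it lies above or below $v$. *)

theory Defs
  imports "HOL-Analysis.Analysis" "HOL-Algebra.Generated_Groups" "HOL-Algebra.FiniteProduct"
begin

section \<open>Virtual knot diagrams\<close>

text \<open>A diagram is a regular closed plane curve, given as a 1-periodic map on the reals, together
  with the set \<open>over\<close> of those parameters at which it passes over a classical crossing. The
  classical crossings are the points of the curve at \<open>over\<close>; every other double point is virtual.
  Two parameters denote the same point of the parameter circle iff their difference is an integer.\<close>

record vdiagram =
  curve :: "real \<Rightarrow> complex"
  over :: "real set"

definition vel :: "vdiagram \<Rightarrow> real \<Rightarrow> complex" where
  "vel D t = vector_derivative (curve D) (at t)"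

definition det2 :: "complex \<Rightarrow> complex \<Rightarrow> real" where
  "det2 u w = Re u * Im w - Im u * Re w"

definition double_points :: "vdiagram \<Rightarrow> complex set" where
  "double_points D = {z. \<exists>s t. s - t \<notin> \<int> \<and> curve D s = z \<and> curve D t = z}"

definition classical :: "vdiagram \<Rightarrow> complex set" where
  "classical D = curve D ` over D"

definition virtual_diagram :: "vdiagram \<Rightarrow> bool" where
  "virtual_diagram D \<longleftrightarrow>
     (\<forall>t. curve D (t + 1) = curve D t) \<and>
     (\<forall>t. curve D differentiable at t) \<and> continuous_on UNIV (vel D) \<and> (\<forall>t. vel D t \<noteq> 0) \<and>
     finite (double_points D) \<and>
     (\<forall>s t u. curve D s = curve D t \<and> curve D t = curve D u \<longrightarrow>
        s - t \<in> \<int> \<or> t - u \<in> \<int> \<or> s - u \<in> \<int>) \<and>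
     (\<forall>s t. curve D s = curve D t \<and> s - t \<notin> \<int> \<longrightarrow> det2 (vel D s) (vel D t) \<noteq> 0) \<and>
     (\<forall>t. t + 1 \<in> over D \<longleftrightarrow> t \<in> over D) \<and>
     (\<forall>s\<in>over D. \<exists>t. t \<notin> over D \<and> s - t \<notin> \<int> \<and> curve D t = curve D s)"

text \<open>At a positive crossing the overcrossing strand is the one running from SW to NE.\<close>

definition writhe :: "vdiagram \<Rightarrow> complex \<Rightarrow> int" where
  "writhe D v =
     (if \<exists>s t. s \<in> over D \<and> t \<notin> over D \<and> curve D s = v \<and> curve D t = v \<and>
               det2 (vel D s) (vel D t) > 0
      then 1 else -1)"

text \<open>With both strands directed upward, the strand SW--NE is the one whose tangent vector followed
  by the tangent vector of the other strand is a positive basis.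
  \<open>ne_param\<close> is the parameter of the strand SW--NE, \<open>nw_param\<close> that of the strand SE--NW.\<close>

definition ne_strand :: "vdiagram \<Rightarrow> complex \<Rightarrow> real \<Rightarrow> bool" where
  "ne_strand D v r \<longleftrightarrow> curve D r = v \<and> (\<exists>l. curve D l = v \<and> det2 (vel D r) (vel D l) > 0)"

definition nw_strand :: "vdiagram \<Rightarrow> complex \<Rightarrow> real \<Rightarrow> bool" where
  "nw_strand D v l \<longleftrightarrow> curve D l = v \<and> (\<exists>r. curve D r = v \<and> det2 (vel D r) (vel D l) > 0)"

definition ne_param :: "vdiagram \<Rightarrow> complex \<Rightarrow> real" where
  "ne_param D v = (THE r. 0 \<le> r \<and> r < 1 \<and> ne_strand D v r)"

definition nw_param :: "vdiagram \<Rightarrow> complex \<Rightarrow> real" where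
  "nw_param D v = (THE l. 0 \<le> l \<and> l < 1 \<and> nw_strand D v l)"


section \<open>Arcs, chains and halves\<close>

text \<open>An arc is represented by the 1-periodic set of its parameters, without the end points; it may
  run through virtual crossings. Without classical crossings, \<open>UNIV\<close> is the only arc.\<close>

definition arc_of :: "vdiagram \<Rightarrow> real \<Rightarrow> real set" where
  "arc_of D t =
     {s. \<exists>k::int. \<forall>u\<in>closed_segment s (t + of_int k). curve D u \<notin> classical D}"

definition arcs :: "vdiagram \<Rightarrow> real set set" where
  "arcs D = arc_of D ` {t. curve D t \<notin> classical D}"

definition in_arc :: "vdiagram \<Rightarrow> real \<Rightarrow> real set" where
  "in_arc D t = (THE a. a \<in> arcs D \<and> (\<forall>\<^sub>F s in at_left t. s \<in> a))"

definition out_arc :: "vdiagram \<Rightarrow> real \<Rightarrow> real set" where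
  "out_arc D t = (THE a. a \<in> arcs D \<and> (\<forall>\<^sub>F s in at_right t. s \<in> a))"

definition SW :: "vdiagram \<Rightarrow> complex \<Rightarrow> real set" where "SW D v = in_arc D (ne_param D v)"
definition NE :: "vdiagram \<Rightarrow> complex \<Rightarrow> real set" where "NE D v = out_arc D (ne_param D v)"
definition SE :: "vdiagram \<Rightarrow> complex \<Rightarrow> real set" where "SE D v = in_arc D (nw_param D v)"
definition NW :: "vdiagram \<Rightarrow> complex \<Rightarrow> real set" where "NW D v = out_arc D (nw_param D v)"

text \<open>Coefficient groups are commutative groups of HOL-Algebra, hence written multiplicatively;
  \<open>x [^] n\<close> with an integer \<open>n\<close> is the multiple \<open>n x\<close>.\<close>

definition C1 :: "vdiagram \<Rightarrow> ('a, 'm) monoid_scheme \<Rightarrow> (real set \<Rightarrow> 'a) set" where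
  "C1 D A = arcs D \<rightarrow> carrier A"

definition H1 :: "vdiagram \<Rightarrow> ('a, 'm) monoid_scheme \<Rightarrow> (real set \<Rightarrow> 'a) set" where
  "H1 D A = {x \<in> C1 D A. \<forall>v\<in>classical D.
     x (SW D v) \<otimes>\<^bsub>A\<^esub> x (SE D v) = x (NW D v) \<otimes>\<^bsub>A\<^esub> x (NE D v)}"

text \<open>The left half starts on the strand SE--NW and ends at the next passage through the crossing,
  which is on the strand SW--NE; the right half is the rest.\<close>

definition left_half_params :: "vdiagram \<Rightarrow> complex \<Rightarrow> real set" where
  "left_half_params D v =
     {t. \<exists>l r. nw_strand D v l \<and> ne_strand D v r \<and> l < t \<and> t < r \<and> r < l + 1}"

definition right_half_params :: "vdiagram \<Rightarrow> complex \<Rightarrow> real set" where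
  "right_half_params D v =
     {t. \<exists>l r. nw_strand D v l \<and> ne_strand D v r \<and> r < t \<and> t < l \<and> l < r + 1}"

definition left_half :: "vdiagram \<Rightarrow> complex \<Rightarrow> real set \<Rightarrow> int" where
  "left_half D v a = (if a \<subseteq> left_half_params D v then 1 else 0)"

definition right_half :: "vdiagram \<Rightarrow> complex \<Rightarrow> real set \<Rightarrow> int" where
  "right_half D v a = (if a \<subseteq> right_half_params D v then 1 else 0)"

definition minus_half :: "vdiagram \<Rightarrow> complex \<Rightarrow> real set \<Rightarrow> int" where
  "minus_half D v = (if writhe D v = 1 then right_half D v else left_half D v)"

definition whole :: "vdiagram \<Rightarrow> real set \<Rightarrow> int" where
  "whole D a = 1"

text \<open>The intersection number of two integral 1-cycles in the surface \<open>AD(D)\<close>, in which the ribbon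
  neighbourhood of the diagram is embedded preserving orientation. It is found by making the cycles
  transverse inside the ribbon surface, as follows. The cycle \<open>x\<close> runs along the right-hand side of
  every arc and \<open>y\<close> along the left-hand side. At a classical crossing the two incoming bands are
  merged and then split again, \<open>x\<close> staying to the right of \<open>y\<close> in between. While merging, the part
  of \<open>x\<close> from SW crosses the part of \<open>y\<close> from SE, and (tangent of \<open>x\<close>, tangent of \<open>y\<close>) is positively
  oriented there; while splitting, the part of \<open>x\<close> to NW crosses the part of \<open>y\<close> to NE, negatively.
  There are no other intersections: at virtual crossings the bands of the ribbon surface are
  disjoint. For example, if \<open>x\<close> runs from SW to NE and \<open>y\<close> from SE to NW, the crossing
  contributes \<open>+1\<close>.\<close>

definition intersection_number ::
    "vdiagram \<Rightarrow> (real set \<Rightarrow> int) \<Rightarrow> (real set \<Rightarrow> int) \<Rightarrow> int" where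
  "intersection_number D x y =
     (\<Sum>v\<in>classical D. x (SW D v) * y (SE D v) - x (NW D v) * y (NE D v))"

definition ip :: "vdiagram \<Rightarrow> complex \<Rightarrow> int" where
  "ip D v = - intersection_number D (left_half D v) (whole D)"


section \<open>Moves\<close>

text \<open>End maps of isotopies of the plane through \<open>C\<^sup>1\<close> diffeomorphisms, starting at the identity.\<close>

definition plane_isotopic :: "(complex \<Rightarrow> complex) \<Rightarrow> bool" where
  "plane_isotopic h \<longleftrightarrow>
     (\<exists>H H'. H 0 = id \<and> H 1 = h \<and>
        (\<forall>t\<in>{0..1::real}. bij (H t) \<and> (\<forall>z. (H t has_derivative H' t z) (at z) \<and> bij (H' t z))) \<and>
        continuous_on ({0..1} \<times> UNIV) (\<lambda>(t, z). H t z) \<and>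
        (\<forall>w. continuous_on ({0..1} \<times> UNIV) (\<lambda>(t, z). H' t z w)))"

definition reparametrization :: "(real \<Rightarrow> real) \<Rightarrow> bool" where
  "reparametrization \<phi> \<longleftrightarrow>
     (\<forall>t. \<phi> (t + 1) = \<phi> t + 1) \<and>
     (\<exists>\<phi>'. continuous_on UNIV \<phi>' \<and> (\<forall>t. (\<phi> has_real_derivative \<phi>' t) (at t) \<and> \<phi>' t > 0))"

text \<open>A move from \<open>D\<close> to \<open>D'\<close> comes with the partial bijection \<open>f\<close> between classical crossings and
  the relation \<open>c\<close> of correspondence between arcs. A reparametrization does not change the oriented
  curve and is subsumed under isotopy.\<close>

definition isotopy_move ::
    "vdiagram \<Rightarrow> (complex \<times> complex) set \<Rightarrow> (real set \<times> real set) set \<Rightarrow> vdiagram \<Rightarrow> bool" where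
  "isotopy_move D f c D' \<longleftrightarrow>
     (\<exists>h \<phi>. plane_isotopic h \<and> reparametrization \<phi> \<and>
        curve D' = h \<circ> curve D \<circ> \<phi> \<and> over D' = \<phi> -` over D \<and>
        f = {(v, h v) | v. v \<in> classical D} \<and> c = {(a, \<phi> -` a) | a. a \<in> arcs D})"

definition detour_move ::
    "vdiagram \<Rightarrow> (complex \<times> complex) set \<Rightarrow> (real set \<times> real set) set \<Rightarrow> vdiagram \<Rightarrow> bool" where
  "detour_move D f c D' \<longleftrightarrow>
     (\<exists>\<alpha> \<beta>. \<alpha> < \<beta> \<and> \<beta> < \<alpha> + 1 \<and> over D' = over D \<and>
        (\<forall>t. (\<forall>k::int. t + of_int k \<notin> {\<alpha>..\<beta>}) \<longrightarrow> curve D' t = curve D t) \<and>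
        (\<forall>t\<in>{\<alpha>..\<beta>}. curve D t \<notin> classical D \<and> curve D' t \<notin> classical D')) \<and>
     f = Id_on (classical D) \<and> c = Id_on (arcs D)"

text \<open>A Reidemeister move takes place in a closed disc \<open>R\<close>, the preimage of the unit disc under
  \<open>h\<close>; the part of the curve in \<open>R\<close> consists of the strands \<open>T 0, \<dots>, T (n - 1)\<close>, which are
  1-periodic sets of parameters.\<close>

definition region :: "(complex \<Rightarrow> complex) \<Rightarrow> complex set" where
  "region h = h -` cball 0 1"

definition agree_off :: "complex set \<Rightarrow> vdiagram \<Rightarrow> vdiagram \<Rightarrow> bool" where
  "agree_off R D D' \<longleftrightarrow>
     (\<forall>t. (curve D' t \<in> R \<longleftrightarrow> curve D t \<in> R) \<and>
          (curve D t \<notin> R \<longrightarrow> curve D' t = curve D t \<and> (t \<in> over D' \<longleftrightarrow> t \<in> over D)))"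

definition strands :: "complex set \<Rightarrow> vdiagram \<Rightarrow> nat \<Rightarrow> (nat \<Rightarrow> real set) \<Rightarrow> bool" where
  "strands R D n T \<longleftrightarrow>
     (\<forall>i<n. \<exists>\<alpha> \<beta>. \<alpha> < \<beta> \<and> \<beta> < \<alpha> + 1 \<and> T i = {t. \<exists>k::int. t + of_int k \<in> {\<alpha>..\<beta>}}) \<and>
     disjoint_family_on T {..<n} \<and>
     {t. curve D t \<in> R} = (\<Union>i<n. T i)"

text \<open>The decreasing first move: a strand with one self-crossing is replaced by an embedded one.\<close>

definition reid1 :: "complex set \<Rightarrow> vdiagram \<Rightarrow> vdiagram \<Rightarrow> bool" where
  "reid1 R D D' \<longleftrightarrow>
     (\<exists>h T v. plane_isotopic h \<and> R = region h \<and> agree_off R D D' \<and> strands R D 1 T \<and>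
        v \<in> classical D \<and> double_points D \<inter> R = {v} \<and> double_points D' \<inter> R = {})"

text \<open>The decreasing second move. Up to isotopy, the strands before the move lie on a straight line
  and on a parabola meeting it twice, one strand passing over the other at both crossings; after the
  move there are no crossings in the disc.\<close>

definition reid2 :: "complex set \<Rightarrow> vdiagram \<Rightarrow> vdiagram \<Rightarrow> bool" where
  "reid2 R D D' \<longleftrightarrow>
     (\<exists>h T v1 v2. plane_isotopic h \<and> R = region h \<and> agree_off R D D' \<and> strands R D 2 T \<and>
        (\<forall>t\<in>T 0. Im (h (curve D t)) = 0) \<and>
        (\<forall>t\<in>T 1. Im (h (curve D t)) = 2 * (Re (h (curve D t)))\<^sup>2 - 1 / 2) \<and>
        v1 \<noteq> v2 \<and> {v1, v2} \<subseteq> classical D \<and> double_points D \<inter> R = {v1, v2} \<and>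
        ((\<forall>t\<in>T 0. curve D t \<in> {v1, v2} \<longrightarrow> t \<in> over D) \<or>
         (\<forall>t\<in>T 0. curve D t \<in> {v1, v2} \<longrightarrow> t \<notin> over D)) \<and>
        double_points D' \<inter> R = {})"

text \<open>The third move. Up to isotopy, two strands lie on the lines through the origin with slopes
  \<open>1\<close> and \<open>-1\<close>, and the third one passes from below to above the origin. The three strands lie at
  different heights \<open>ht\<close>, any of them may be the moving one, and their directions are arbitrary.\<close>

definition heights :: "(nat \<Rightarrow> real set) \<Rightarrow> (nat \<Rightarrow> nat) \<Rightarrow> vdiagram \<Rightarrow> bool" where
  "heights T ht D \<longleftrightarrow>
     (\<forall>i<3. \<forall>j<3. ht i < ht j \<longrightarrow>
        (\<forall>s\<in>T i. \<forall>t\<in>T j. curve D s = curve D t \<longrightarrow> s \<notin> over D \<and> t \<in> over D))"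

definition reid3 :: "complex set \<Rightarrow> vdiagram \<Rightarrow> vdiagram \<Rightarrow> bool" where
  "reid3 R D D' \<longleftrightarrow>
     (\<exists>h T ht. plane_isotopic h \<and> R = region h \<and> agree_off R D D' \<and> strands R D 3 T \<and>
        (\<forall>t\<in>T 0. Im (h (curve D t)) = Re (h (curve D t)) \<and> curve D' t = curve D t) \<and>
        (\<forall>t\<in>T 1. Im (h (curve D t)) = - Re (h (curve D t)) \<and> curve D' t = curve D t) \<and>
        (\<forall>t\<in>T 2. Im (h (curve D t)) = - (1 - (Re (h (curve D t)))\<^sup>2)\<^sup>2 / 2 \<and>
                  Im (h (curve D' t)) = (1 - (Re (h (curve D' t)))\<^sup>2)\<^sup>2 / 2) \<and>
        inj_on ht {..<3} \<and> heights T ht D \<and> heights T ht D')"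

text \<open>Crossings outside the region survive as the same points of the plane; crossings in the region
  of a third move correspond if they are crossings of the same two strands.\<close>

definition crossing_corr :: "complex set \<Rightarrow> vdiagram \<Rightarrow> vdiagram \<Rightarrow> (complex \<times> complex) set" where
  "crossing_corr R D D' =
     Id_on (classical D - R) \<union>
     {(v, v'). v \<in> classical D \<inter> R \<and> v' \<in> classical D' \<inter> R \<and>
        (\<exists>s t s' t'. s - t \<notin> \<int> \<and> curve D s = v \<and> curve D t = v \<and>
           curve D' s' = v' \<and> curve D' t' = v' \<and> s' - t' \<notin> \<int> \<and>
           curve D ` closed_segment s s' \<subseteq> R \<and> curve D ` closed_segment t t' \<subseteq> R)}"

definition arc_corr :: "complex set \<Rightarrow> vdiagram \<Rightarrow> vdiagram \<Rightarrow> (real set \<times> real set) set" where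
  "arc_corr R D D' = {(a, a'). a \<in> arcs D \<and> a' \<in> arcs D' \<and> (\<exists>t\<in>a \<inter> a'. curve D t \<notin> R)}"

text \<open>The first and second moves are only taken in the decreasing direction. The conditions imposed
  on families below are symmetric in \<open>D\<close> and \<open>D'\<close>, so the increasing moves would add nothing.\<close>

definition move ::
    "vdiagram \<Rightarrow> (complex \<times> complex) set \<Rightarrow> (real set \<times> real set) set \<Rightarrow> vdiagram \<Rightarrow> bool" where
  "move D f c D' \<longleftrightarrow>
     virtual_diagram D \<and> virtual_diagram D' \<and>
     (isotopy_move D f c D' \<or> detour_move D f c D' \<or>
      (\<exists>R. (reid1 R D D' \<or> reid2 R D D' \<or> reid3 R D D') \<and>
           f = crossing_corr R D D' \<and> c = arc_corr R D D'))"

definition move_rel :: "(vdiagram \<times> vdiagram) set" where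
  "move_rel = {(D, D'). \<exists>f c. move D f c D'}"

definition virtual_knots :: "vdiagram set set" where
  "virtual_knots =
     {D. virtual_diagram D} //
     {(D, D'). virtual_diagram D \<and> (D, D') \<in> (move_rel \<union> move_rel\<inverse>)\<^sup>*}"


section \<open>Invariant cycles, indices and oriented parities\<close>

definition invariant_chain ::
    "vdiagram set \<Rightarrow> ('a, 'm) monoid_scheme \<Rightarrow> (vdiagram \<Rightarrow> real set \<Rightarrow> 'a) \<Rightarrow> bool" where
  "invariant_chain K A \<gamma> \<longleftrightarrow>
     (\<forall>D\<in>K. \<gamma> D \<in> C1 D A) \<and>
     (\<forall>D\<in>K. \<forall>D'\<in>K. \<forall>f c. move D f c D' \<longrightarrow> (\<forall>(a, a')\<in>c. \<gamma> D a = \<gamma> D' a'))"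

definition invariant_cycle ::
    "vdiagram set \<Rightarrow> ('a, 'm) monoid_scheme \<Rightarrow> (vdiagram \<Rightarrow> real set \<Rightarrow> 'a) \<Rightarrow> bool" where
  "invariant_cycle K A \<gamma> \<longleftrightarrow> invariant_chain K A \<gamma> \<and> (\<forall>D\<in>K. \<gamma> D \<in> H1 D A)"

definition crossing_index ::
    "vdiagram set \<Rightarrow> ('a, 'm) monoid_scheme \<Rightarrow> (vdiagram \<Rightarrow> complex \<Rightarrow> 'a) \<Rightarrow> bool" where
  "crossing_index K A \<pi> \<longleftrightarrow>
     (\<forall>D\<in>K. \<pi> D \<in> classical D \<rightarrow> carrier A) \<and>
     (\<forall>D\<in>K. \<forall>D'\<in>K. \<forall>f c. move D f c D' \<longrightarrow> (\<forall>(v, v')\<in>f. \<pi> D v = \<pi> D' v')) \<and>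
     (\<forall>D\<in>K. \<forall>D'\<in>K. \<forall>R. reid2 R D D' \<longrightarrow>
        (\<forall>v1\<in>classical D \<inter> R. \<forall>v2\<in>classical D \<inter> R. \<pi> D v1 = \<pi> D v2))"

text \<open>The loop removed by a first move in \<open>R\<close> is the half of the crossing lying in \<open>R\<close>.\<close>

definition l_plus_reduced ::
    "vdiagram set \<Rightarrow> ('a, 'm) monoid_scheme \<Rightarrow> (vdiagram \<Rightarrow> complex \<Rightarrow> 'a) \<Rightarrow> bool" where
  "l_plus_reduced K A \<pi> \<longleftrightarrow>
     (\<forall>D\<in>K. \<forall>D'\<in>K. \<forall>R. reid1 R D D' \<longrightarrow>
        (\<forall>v\<in>classical D \<inter> R.
           (curve D ` left_half_params D v \<subseteq> R \<and> writhe D v = 1 \<or>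
            curve D ` right_half_params D v \<subseteq> R \<and> writhe D v = -1) \<longrightarrow> \<pi> D v = \<one>\<^bsub>A\<^esub>))"

text \<open>The triangle of a third move in \<open>R\<close> has the three crossings in \<open>R\<close> as its vertices. At a
  vertex, the strand with parameter \<open>s\<close> contains one side of the triangle, which is outgoing iff
  another vertex is reached on that strand later than \<open>s\<close> within \<open>R\<close>. The triangle lies above or
  below the vertex iff both sides are outgoing or both are incoming.\<close>

definition outgoing_side :: "complex set \<Rightarrow> vdiagram \<Rightarrow> real \<Rightarrow> bool" where
  "outgoing_side R D s \<longleftrightarrow> (\<exists>t>s. curve D ` {s..t} \<subseteq> R \<and> curve D t \<in> classical D)"

definition eps_triangle :: "complex set \<Rightarrow> vdiagram \<Rightarrow> complex \<Rightarrow> int" where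
  "eps_triangle R D v =
     (if outgoing_side R D (ne_param D v) \<noteq> outgoing_side R D (nw_param D v) then 1 else -1)"

definition oriented_parity ::
    "vdiagram set \<Rightarrow> ('b, 'm) monoid_scheme \<Rightarrow> (vdiagram \<Rightarrow> complex \<Rightarrow> 'b) \<Rightarrow> bool" where
  "oriented_parity K B p \<longleftrightarrow>
     comm_group B \<and>
     (\<forall>D\<in>K. p D \<in> classical D \<rightarrow> carrier B) \<and>
     (\<forall>D\<in>K. \<forall>D'\<in>K. \<forall>f c. move D f c D' \<longrightarrow> (\<forall>(v, v')\<in>f. p D v = p D' v')) \<and>
     (\<forall>D\<in>K. \<forall>D'\<in>K. \<forall>R. reid1 R D D' \<longrightarrow> (\<forall>v\<in>classical D \<inter> R. p D v = \<one>\<^bsub>B\<^esub>)) \<and>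
     (\<forall>D\<in>K. \<forall>D'\<in>K. \<forall>R. reid2 R D D' \<longrightarrow>
        (\<forall>v1\<in>classical D \<inter> R. \<forall>v2\<in>classical D \<inter> R. v1 \<noteq> v2 \<longrightarrow>
           p D v1 \<otimes>\<^bsub>B\<^esub> p D v2 = \<one>\<^bsub>B\<^esub>)) \<and>
     (\<forall>D\<in>K. \<forall>D'\<in>K. \<forall>R. reid3 R D D' \<longrightarrow>
        (\<Otimes>\<^bsub>B\<^esub>v\<in>classical D \<inter> R. p D v [^]\<^bsub>B\<^esub> eps_triangle R D v) = \<one>\<^bsub>B\<^esub>)"

definition index_cycle ::
    "('a, 'm) monoid_scheme \<Rightarrow> (vdiagram \<Rightarrow> complex \<Rightarrow> 'a) \<Rightarrow> vdiagram \<Rightarrow> real set \<Rightarrow> 'a" where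
  "index_cycle A \<pi> D a =
     (\<Otimes>\<^bsub>A\<^esub>v\<in>classical D. \<pi> D v [^]\<^bsub>A\<^esub> (writhe D v * minus_half D v a))"

definition signature ::
    "('a, 'm) monoid_scheme \<Rightarrow> (vdiagram \<Rightarrow> complex \<Rightarrow> 'a) \<Rightarrow> vdiagram \<Rightarrow> 'a" where
  "signature A \<pi> D = inv\<^bsub>A\<^esub> (\<Otimes>\<^bsub>A\<^esub>v\<in>classical D. \<pi> D v [^]\<^bsub>A\<^esub> ip D v)"

text \<open>The element of \<open>A\<close> representing the value of the parity; its class modulo the signature is a
  coset.\<close>

definition parity_rep ::
    "('a, 'm) monoid_scheme \<Rightarrow> (vdiagram \<Rightarrow> complex \<Rightarrow> 'a) \<Rightarrow> vdiagram \<Rightarrow> complex \<Rightarrow> 'a" where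
  "parity_rep A \<pi> D v =
     (\<Otimes>\<^bsub>A\<^esub>v'\<in>classical D. \<pi> D v' [^]\<^bsub>A\<^esub>
        (writhe D v' * intersection_number D (left_half D v) (minus_half D v')))"

end

theory Submission
  imports Defs
begin

text \<open>The parameters of the classical crossings on the circle \<open>\<real>/\<int>\<close>, paired by the crossings and
  marked with the signs, form a chord diagram, and the cycle \<open>\<delta>\<close>, the parity \<open>p\<close> and the signature
  \<open>\<sigma>\<close> are determined by this diagram and the indices. Let \<open>r v\<close> and \<open>l v\<close> be the parameters of the
  strands SW--NE and SE--NW at \<open>v\<close>.

  Whatever the sign of \<open>v\<close>, the half \<open>D\<^sup>-\<close> of \<open>v\<close> runs from the overcrossing to the undercrossing, so that
  \<open>sgn v \<cdot> D\<^sup>-\<close> jumps by \<open>1\<close> at \<open>r v\<close> and by \<open>-1\<close> at \<open>l v\<close>. Hence \<open>\<delta>\<close> jumps by \<open>\<pi> v\<close> and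
  \<open>- \<pi> v\<close> there, which makes it a cycle. Outside the disc of a move \<open>\<delta>\<close> does not change: in a first
  move the lost half is the removed loop, or else it is the complement of the loop and then its
  coefficient vanishes because the index is reduced; in a second move the two lost halves agree
  outside the disc and come with the same index and opposite signs; in a third move the ends of the chords only slide
  inside the disc.

  For the parity, push the path \<open>D\<^sup>l\<close> of \<open>v\<close> off the diagram. Then \<open>D\<^sup>l \<cdot> \<delta>\<close> becomes the sum, over the
  crossing parameters in the closed cyclic interval from \<open>l v\<close> to \<open>r v\<close>, of the values of \<open>\<delta>\<close>
  on the strands that are crossed: at \<open>r w\<close> the value of \<open>\<delta>\<close> just before \<open>l w\<close>, and at \<open>l w\<close> minus the
  value just after \<open>r w\<close>. The sum over the whole circle is \<open>D \<cdot> \<delta> = \<sigma>\<close>, so modulo \<open>\<sigma>\<close> the parity is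
  a difference of potentials. The crossing of a loop gets zero or the whole sum; for the
  two crossings of a bigon, and with signs for the three crossings of a triangle, the intervals
  together cover the circle a constant number of times, up to terms at the vertices which cancel.
  That \<open>p\<close> and \<open>\<sigma>\<close> are invariant is a similar count: the terms of a loop or of a bigon cancel, and those
  of a triangle taken together do not change when the order of the vertices is reversed on all
  three sides.

  All this is linear in the indices. So the combinatorial part is about the integers
  \<open>linking u v = sgn v (D\<^sup>l \<cdot> D\<^sup>-)\<close>, with the left half of \<open>u\<close> and the signed half of \<open>v\<close>, and
  \<open>total_linking v = - ip v\<close>; the locales \<open>first_move\<close>, \<open>second_move\<close> and \<open>third_move\<close> say how they
  change. The geometric part reads the chord diagrams off the curves. Its main point is that a
  strand lying on the graph of a function is traversed monotonically (\<open>graph_strand\<close>): its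
  direction and the slopes of the graphs then give the roles of the strands at the crossings,
  and since its ends are on the boundary of the disc (\<open>frontier_limit\<close>), it meets all the crossings
  of the picture. The results are \<open>isotopy_move_keeps\<close>, \<open>detour_move_keeps\<close>,
  \<open>reid1_loop_removal\<close>, \<open>reid2_bigon_removal\<close> and \<open>reid3_result\<close>.\<close>

section \<open>Chord diagrams on the circle of parameters\<close>

text \<open>The indicator of the closed cyclic interval from \<open>l\<close> to \<open>r\<close>. Functions on the circle are written with
  floors and ceilings of differences throughout: such expressions do not depend on the chosen
  lifts of the arguments, and the position of points relative to each other becomes arithmetic,
  without a base point and without case distinctions on the cyclic order.\<close>

definition path_ind :: "real \<Rightarrow> real \<Rightarrow> real \<Rightarrow> int" where
  "path_ind l r t = \<lfloor>t - l\<rfloor> + 1 - \<lceil>t - r\<rceil> - \<lfloor>r - l\<rfloor>"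

text \<open>With \<open>s\<close> for a positive sign, the next two functions are the left and the right limit at \<open>t\<close> of the
  indicator of the interval from \<open>r\<close> to \<open>l\<close> if \<open>s\<close> holds, and of minus the indicator of the interval
  from \<open>l\<close> to \<open>r\<close> otherwise. These two differ by the constant \<open>1\<close>.\<close>

definition half_const :: "real \<Rightarrow> real \<Rightarrow> bool \<Rightarrow> int" where
  "half_const l r s = - \<lfloor>l - r\<rfloor> - (if s then 0 else 1)"

definition half_before :: "real \<Rightarrow> real \<Rightarrow> bool \<Rightarrow> real \<Rightarrow> int" where
  "half_before l r s t = \<lceil>t - r\<rceil> - \<lceil>t - l\<rceil> + half_const l r s"

definition half_after :: "real \<Rightarrow> real \<Rightarrow> bool \<Rightarrow> real \<Rightarrow> int" where
  "half_after l r s t = \<lfloor>t - r\<rfloor> - \<lfloor>t - l\<rfloor> + half_const l r s"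

record 'v chord_diagram =
  chords :: "'v set"
  lpar :: "'v \<Rightarrow> real"
  rpar :: "'v \<Rightarrow> real"
  pos :: "'v \<Rightarrow> bool"

abbreviation lpath :: "('v, 'm) chord_diagram_scheme \<Rightarrow> 'v \<Rightarrow> real \<Rightarrow> int" where
  "lpath G v \<equiv> path_ind (lpar G v) (rpar G v)"
abbreviation before :: "('v, 'm) chord_diagram_scheme \<Rightarrow> 'v \<Rightarrow> real \<Rightarrow> int" where
  "before G v \<equiv> half_before (lpar G v) (rpar G v) (pos G v)"
abbreviation after :: "('v, 'm) chord_diagram_scheme \<Rightarrow> 'v \<Rightarrow> real \<Rightarrow> int" where
  "after G v \<equiv> half_after (lpar G v) (rpar G v) (pos G v)"

text \<open>The intersection number of two cycles as it appears in the definition of \<open>intersection_number\<close>. The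
  function \<open>S\<close> describes the first cycle at the parameters of the crossings, while \<open>F\<close> and \<open>H\<close> are the
  values of the second cycle before and after them.\<close>

definition pairing ::
    "('v, 'm) chord_diagram_scheme \<Rightarrow> (real \<Rightarrow> int) \<Rightarrow> (real \<Rightarrow> int) \<Rightarrow> (real \<Rightarrow> int) \<Rightarrow> int" where
  "pairing G S F H =
     (\<Sum>w\<in>chords G. S (rpar G w) * F (lpar G w) - S (lpar G w) * H (rpar G w))"

definition linking :: "('v, 'm) chord_diagram_scheme \<Rightarrow> 'v \<Rightarrow> 'v \<Rightarrow> int" where
  "linking G v w = pairing G (lpath G v) (before G w) (after G w)"

definition total_linking :: "('v, 'm) chord_diagram_scheme \<Rightarrow> 'v \<Rightarrow> int" where
  "total_linking G w = pairing G (\<lambda>_. 1) (before G w) (after G w)"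

lemma floor_shift:
  fixes x y x' y' :: real
  assumes "x' = x + of_int m" "y' = y + of_int n"
  shows "\<lfloor>x' - y'\<rfloor> = \<lfloor>x - y\<rfloor> + m - n" "\<lceil>x' - y'\<rceil> = \<lceil>x - y\<rceil> + m - n"
proof -
  have eq: "x' - y' = (x - y) + of_int (m - n)" using assms by simp
  show "\<lfloor>x' - y'\<rfloor> = \<lfloor>x - y\<rfloor> + m - n"
    unfolding eq floor_add_int[symmetric] by (rule add_diff_eq)
  show "\<lceil>x' - y'\<rceil> = \<lceil>x - y\<rceil> + m - n"
    unfolding eq ceiling_add_of_int by (rule add_diff_eq)
qed

lemma shift_invariant:
  assumes "l' = l + of_int i" "r' = r + of_int j" "t' = t + of_int k"
  shows path_ind_shift: "path_ind l' r' t' = path_ind l r t"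
    and half_before_shift: "half_before l' r' s t' = half_before l r s t"
    and half_after_shift: "half_after l' r' s t' = half_after l r s t"
  unfolding path_ind_def half_before_def half_after_def half_const_def
    floor_shift[OF assms(3) assms(1)] floor_shift[OF assms(3) assms(2)]
    floor_shift[OF assms(2) assms(1)] floor_shift[OF assms(1) assms(2)]
  by simp_all

definition same_mod_1 :: "real \<Rightarrow> real \<Rightarrow> bool" where
  "same_mod_1 s t \<longleftrightarrow> (\<exists>k::int. s = t + of_int k)"

text \<open>Chords may be represented by arbitrary lifts of their end points. This allows comparing positions
  in intervals of the real line.\<close>

lemma pairing_shift:
  assumes "chords G' = chords G"
    and "\<And>w. w \<in> chords G \<Longrightarrow> same_mod_1 (lpar G' w) (lpar G w)"
    and "\<And>w. w \<in> chords G \<Longrightarrow> same_mod_1 (rpar G' w) (rpar G w)"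
    and "\<And>w. w \<in> chords G \<Longrightarrow> pos G' w \<longleftrightarrow> pos G w"
    and v: "v \<in> chords G"
  shows "u \<in> chords G \<Longrightarrow> linking G' u v = linking G u v" "total_linking G' v = total_linking G v"
proof -
  have b: "before G' v t' = before G v t" "after G' v t' = after G v t" if t: "same_mod_1 t' t" for t t'
  proof -
    obtain i j k :: int where "lpar G' v = lpar G v + i" "rpar G' v = rpar G v + j" "t' = t + k"
      using assms(2,3)[OF v] t unfolding same_mod_1_def by blast
    then show "before G' v t' = before G v t" "after G' v t' = after G v t"
      unfolding assms(4)[OF v] by (rule half_before_shift, rule half_after_shift)
  qed
  have p: "lpath G' u t' = lpath G u t" if u: "u \<in> chords G" and t: "same_mod_1 t' t" for t t' u
  proof -
    obtain i j k :: int where "lpar G' u = lpar G u + i" "rpar G' u = rpar G u + j" "t' = t + k"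
      using assms(2,3)[OF u] t unfolding same_mod_1_def by blast
    then show ?thesis by (rule path_ind_shift)
  qed
  show "linking G' u v = linking G u v" if "u \<in> chords G"
    unfolding linking_def pairing_def assms(1)
    using that by (intro sum.cong refl) (simp add: b[OF assms(2)] b[OF assms(3)] p[OF _ assms(2)] p[OF _ assms(3)])
  show "total_linking G' v = total_linking G v"
    unfolding total_linking_def pairing_def assms(1)
    by (intro sum.cong refl) (simp add: b[OF assms(2)] b[OF assms(3)])
qed

text \<open>The lifts \<open>x\<close> and \<open>y\<close> are not separated by any translate of \<open>t\<close>, nor equal to one.\<close>

definition unsep :: "real \<Rightarrow> real \<Rightarrow> real \<Rightarrow> bool" where
  "unsep t x y \<longleftrightarrow> \<lfloor>t - x\<rfloor> = \<lfloor>t - y\<rfloor> \<and> \<lceil>t - x\<rceil> = \<lfloor>t - x\<rfloor> + 1 \<and> \<lceil>t - y\<rceil> = \<lfloor>t - y\<rfloor> + 1"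

lemma floor_minus_swap: "\<lfloor>x - y\<rfloor> = - \<lceil>y - x\<rceil>" for x y :: real
  by (simp add: ceiling_def)

lemma ceiling_minus_swap: "\<lceil>x - y\<rceil> = - \<lfloor>y - x\<rfloor>" for x y :: real
  by (simp add: ceiling_def)

lemma unsep_rules:
  assumes "unsep t x y"
  shows "\<lceil>t - x\<rceil> = \<lfloor>t - y\<rfloor> + 1" "\<lceil>t - y\<rceil> = \<lfloor>t - y\<rfloor> + 1" "\<lfloor>t - x\<rfloor> = \<lfloor>t - y\<rfloor>"
    "\<lfloor>x - t\<rfloor> = - \<lfloor>t - y\<rfloor> - 1" "\<lfloor>y - t\<rfloor> = - \<lfloor>t - y\<rfloor> - 1"
    "\<lceil>x - t\<rceil> = - \<lfloor>t - y\<rfloor>" "\<lceil>y - t\<rceil> = - \<lfloor>t - y\<rfloor>"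
  using assms unfolding unsep_def floor_minus_swap[of x t] floor_minus_swap[of y t]
    ceiling_minus_swap[of x t] ceiling_minus_swap[of y t] by auto

definition avoids :: "('v, 'm) chord_diagram_scheme \<Rightarrow> 'v set \<Rightarrow> real \<Rightarrow> real \<Rightarrow> bool" where
  "avoids G W x y \<longleftrightarrow> (\<forall>w\<in>W. unsep (lpar G w) x y \<and> unsep (rpar G w) x y)"

lemma unsep_functions:
  assumes "unsep l x y" "unsep r x y"
  shows "path_ind l r x = path_ind l r y"
    "half_before l r s x = half_before l r s y" "half_after l r s x = half_after l r s y"
    "half_after l r s x = half_before l r s x"
    "half_after l r s x = half_before l r s y"
  unfolding path_ind_def half_before_def half_after_def
  by (simp_all add: unsep_rules[OF assms(1)] unsep_rules[OF assms(2)])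

text \<open>The ends of the chord \<open>v0\<close> are not separated by the end of any other chord, and \<open>G'\<close> arises by
  removing it.\<close>

locale first_move =
  fixes G G' :: "'v chord_diagram" and V :: "'v set" and v0 :: 'v
  assumes ch: "chords G = insert v0 V" and fin: "finite V" and v0: "v0 \<notin> V"
    and av: "avoids G V (lpar G v0) (rpar G v0)"
    and G': "chords G' = V" "\<And>w. w \<in> V \<Longrightarrow> lpar G' w = lpar G w \<and> rpar G' w = rpar G w \<and> pos G' w = pos G w"
begin

abbreviation "l \<equiv> lpar G v0"
abbreviation "r \<equiv> rpar G v0"

lemma un:
  assumes "w \<in> V"
  shows "unsep (lpar G w) l r" "unsep (rpar G w) l r"
  using av assms unfolding avoids_def by auto

lemmas un_rules = unsep_rules[OF un(1)] unsep_rules[OF un(2)]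
lemmas const = unsep_functions[OF un]

lemma sum_split: "pairing G S F H = S r * F l - S l * H r +
    (\<Sum>w\<in>V. S (rpar G w) * F (lpar G w) - S (lpar G w) * H (rpar G w))"
  unfolding pairing_def ch using fin v0 by simp

text \<open>No other chord ends in the loop, and the half of \<open>v0\<close> itself has opposite jumps at \<open>l\<close> and \<open>r\<close>, whichever
  comes first. Hence the two terms of the chord \<open>v0\<close> in a pairing cancel whenever the other factor
  agrees on both ends.\<close>

lemma loop_weight:
  assumes "v \<in> chords G"
  shows "before G v l = after G v r"
proof -
  have "before G v0 l = after G v0 r"
    unfolding half_before_def half_after_def by (simp add: floor_minus_swap[of r l])
  then show ?thesis using assms const[of v] unfolding ch by auto
qed

lemma rest:
  assumes "v \<in> V"
  shows "(\<Sum>w\<in>V. S (rpar G w) * before G v (lpar G w) - S (lpar G w) * after G v (rpar G w)) =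
    pairing G' S (before G' v) (after G' v)"
  unfolding pairing_def G'(1) using assms G'(2) by (intro sum.cong) auto

lemma linking_survives:
  assumes "u \<in> V" "v \<in> V"
  shows "linking G u v = linking G' u v"
  unfolding linking_def sum_split rest[OF assms(2)]
  using const(1)[OF assms(1) assms(1)] loop_weight[of v] assms ch G'(2) by simp

lemma total_survives:
  assumes "v \<in> V"
  shows "total_linking G v = total_linking G' v"
  unfolding total_linking_def sum_split using rest[OF assms, of "\<lambda>_. 1"] loop_weight[of v] assms ch by simp

lemma total_loop: "total_linking G v0 = 0"
  unfolding total_linking_def sum_split using loop_weight[of v0] ch
  by (auto intro!: sum.neutral simp: half_before_def half_after_def un_rules)

lemma left_loop:
  assumes "\<lfloor>r - l\<rfloor> = 0" "\<lceil>r - l\<rceil> = 1" "v \<in> chords G"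
  shows "linking G v0 v = 0"
proof -
  have "lpath G v0 l = 1" "lpath G v0 r = 1" "\<And>w. w \<in> V \<Longrightarrow> lpath G v0 (lpar G w) = 0 \<and> lpath G v0 (rpar G w) = 0"
    using assms unfolding path_ind_def by (auto simp: un_rules ceiling_minus_swap[of l r])
  then show ?thesis unfolding linking_def sum_split using loop_weight[OF assms(3)] by simp
qed

lemma right_loop:
  assumes "\<lfloor>l - r\<rfloor> = 0" "\<lceil>l - r\<rceil> = 1" "v \<in> chords G"
  shows "linking G v0 v = total_linking G v"
proof -
  have "lpath G v0 l = 1" "lpath G v0 r = 1" "\<And>w. w \<in> V \<Longrightarrow> lpath G v0 (lpar G w) = 1 \<and> lpath G v0 (rpar G w) = 1"
    using assms unfolding path_ind_def by (auto simp: un_rules floor_minus_swap[of r l])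
  then show ?thesis unfolding linking_def total_linking_def sum_split by simp
qed

text \<open>The hypothesis says that the signed half of \<open>v0\<close> is the loop itself and not its complement.\<close>

lemma loop_invisible:
  assumes "u \<in> V" "half_const l r (pos G v0) = 0"
  shows "linking G u v0 = 0"
  unfolding linking_def sum_split using loop_weight[of v0] const(1)[OF assms(1) assms(1)] ch assms
  by (auto intro!: sum.neutral simp: half_before_def half_after_def un_rules)

end

section \<open>Removing two chords that bound a bigon\<close>

lemma pairing_add_right:
  "pairing G S F H + pairing G S F' H' = pairing G S (\<lambda>t. F t + F' t) (\<lambda>t. H t + H' t)"
  unfolding pairing_def sum.distrib[symmetric] by (simp add: algebra_simps)

lemma pairing_add_left:
  "pairing G S F H + pairing G S' F H = pairing G (\<lambda>t. S t + S' t) F H"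
  unfolding pairing_def sum.distrib[symmetric] by (simp add: algebra_simps)

text \<open>The point \<open>t\<close> lies strictly between \<open>x + n\<close> and \<open>x + n + 1\<close>.\<close>

definition gap :: "int \<Rightarrow> real \<Rightarrow> real \<Rightarrow> bool" where
  "gap n t x \<longleftrightarrow> \<lfloor>t - x\<rfloor> = n \<and> \<lceil>t - x\<rceil> = n + 1"

lemma gap_rules:
  assumes "gap n t x"
  shows "\<lfloor>t - x\<rfloor> = n" "\<lceil>t - x\<rceil> = n + 1" "\<lfloor>x - t\<rfloor> = - n - 1" "\<lceil>x - t\<rceil> = - n"
  using assms unfolding gap_def floor_minus_swap[of x t] ceiling_minus_swap[of x t] by auto

text \<open>One of the two strands contains the ends \<open>a1 = rpar G v1\<close> and \<open>a2 = lpar G v2\<close>, the other one contains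
  \<open>b1 = lpar G v1\<close> and \<open>b2 = rpar G v2\<close>; both orders on either strand are possible. The roles of the
  strands differ at the two crossings because one curve passes from one side of the other curve
  to the opposite side and back. As the same strand is the upper one at both, so do the signs.\<close>

locale second_move =
  fixes G G' :: "'v chord_diagram" and V :: "'v set" and v1 v2 :: 'v and n :: int
  assumes ch: "chords G = insert v1 (insert v2 V)" and fin: "finite V"
    and v12: "v1 \<noteq> v2" "v1 \<notin> V" "v2 \<notin> V"
    and sgn: "pos G v1 \<longleftrightarrow> \<not> pos G v2"
    and avA: "avoids G V (rpar G v1) (lpar G v2)" and avB: "avoids G V (lpar G v1) (rpar G v2)"
    and gaps: "gap n (lpar G v1) (rpar G v1)" "gap n (lpar G v1) (lpar G v2)"
      "gap n (rpar G v2) (rpar G v1)" "gap n (rpar G v2) (lpar G v2)"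
    and G': "chords G' = V" "\<And>w. w \<in> V \<Longrightarrow> lpar G' w = lpar G w \<and> rpar G' w = rpar G w \<and> pos G' w = pos G w"
begin

abbreviation "a1 \<equiv> rpar G v1"
abbreviation "b1 \<equiv> lpar G v1"
abbreviation "a2 \<equiv> lpar G v2"
abbreviation "b2 \<equiv> rpar G v2"

lemma un:
  assumes "w \<in> V"
  shows "unsep (lpar G w) a1 a2" "unsep (rpar G w) a1 a2" "unsep (lpar G w) b1 b2" "unsep (rpar G w) b1 b2"
  using avA avB assms unfolding avoids_def by auto

lemmas constA = unsep_functions[OF un(1,2)]
lemmas constB = unsep_functions[OF un(3,4)]
lemmas outer_rules = unsep_rules[OF un(1)] unsep_rules[OF un(2)] unsep_rules[OF un(3)] unsep_rules[OF un(4)]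
lemmas inner_rules = gaps[THEN gap_rules(1)] gaps[THEN gap_rules(2)] gaps[THEN gap_rules(3)] gaps[THEN gap_rules(4)]

lemma sum_split:
  "pairing G S F H = (S a1 * F b1 - S b1 * H a1) + (S b2 * F a2 - S a2 * H b2) +
    (\<Sum>w\<in>V. S (rpar G w) * F (lpar G w) - S (lpar G w) * H (rpar G w))"
  unfolding pairing_def ch using fin v12 by simp

text \<open>For \<open>S\<close> constant on each strand this is how the terms of the bigon disappear from all pairings. The two
  equations on \<open>F\<close> and \<open>H\<close> hold for the chords outside the bigon, and also for the two chords of the
  bigon taken together, whose jumps cancel between the two crossings on either strand.\<close>

lemma bigon_cancels:
  fixes S F H :: "real \<Rightarrow> int"
  assumes "S a1 = S a2" "S b1 = S b2" "F b1 = H b2" "F a2 = H a1"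
  shows "(S a1 * F b1 - S b1 * H a1) + (S b2 * F a2 - S a2 * H b2) = 0"
  using assms by simp

lemma weight_const:
  assumes "v \<in> V"
  shows "before G v b1 = after G v b2" "before G v a2 = after G v a1"
  using constA[OF assms assms] constB[OF assms assms] by metis+

lemma path_const:
  assumes "u \<in> V"
  shows "lpath G u a1 = lpath G u a2" "lpath G u b1 = lpath G u b2"
  using constA(1)[OF assms assms] constB(1)[OF assms assms] by auto

lemma rest:
  assumes "v \<in> V"
  shows "(\<Sum>w\<in>V. S (rpar G w) * before G v (lpar G w) - S (lpar G w) * after G v (rpar G w)) =
    pairing G' S (before G' v) (after G' v)"
  unfolding pairing_def G'(1) using assms G'(2) by (intro sum.cong) auto

definition F where "F t = before G v1 t + before G v2 t"
definition H where "H t = after G v1 t + after G v2 t"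
definition S where "S t = lpath G v1 t + lpath G v2 t"

lemma halves:
  "F t = \<lceil>t - a1\<rceil> - \<lceil>t - b1\<rceil> + \<lceil>t - b2\<rceil> - \<lceil>t - a2\<rceil>"
  "H t = \<lfloor>t - a1\<rfloor> - \<lfloor>t - b1\<rfloor> + \<lfloor>t - b2\<rfloor> - \<lfloor>t - a2\<rfloor>"
proof -
  have "half_const b1 a1 (pos G v1) + half_const a2 b2 (pos G v2) = 0"
    using sgn unfolding half_const_def by (cases "pos G v2") (auto simp: inner_rules)
  then show "F t = \<lceil>t - a1\<rceil> - \<lceil>t - b1\<rceil> + \<lceil>t - b2\<rceil> - \<lceil>t - a2\<rceil>"
    "H t = \<lfloor>t - a1\<rfloor> - \<lfloor>t - b1\<rfloor> + \<lfloor>t - b2\<rfloor> - \<lfloor>t - a2\<rfloor>"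
    unfolding F_def H_def half_before_def half_after_def by simp_all
qed

lemma halves_cancel:
  assumes "unsep t a1 a2" "unsep t b1 b2"
  shows "after G v1 t + after G v2 t = 0"
  using halves(2)[of t] unsep_rules(3)[OF assms(1)] unsep_rules(3)[OF assms(2)] unfolding H_def by simp

lemma halves_outer:
  assumes "w \<in> V"
  shows "F (lpar G w) = 0" "F (rpar G w) = 0" "H (lpar G w) = 0" "H (rpar G w) = 0"
  unfolding halves using assms by (simp_all add: outer_rules)

lemma halves_inner: "F b1 = H b2" "F a2 = H a1"
  unfolding halves by (simp_all add: inner_rules ceiling_minus_swap[of b1 b2] ceiling_minus_swap[of a2 a1])

lemma paths: "S t = \<lfloor>t - b1\<rfloor> - \<lceil>t - a1\<rceil> + \<lfloor>t - a2\<rfloor> - \<lceil>t - b2\<rceil> + 3"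
  unfolding S_def path_ind_def by (simp add: inner_rules)

text \<open>The paths of the two crossings run from the second strand to the first and back, and cover every
  point outside the bigon once.\<close>

lemma paths_outer:
  assumes "w \<in> V"
  shows "S (lpar G w) = 1" "S (rpar G w) = 1"
  unfolding paths using assms by (simp_all add: outer_rules)

lemma paths_inner: "S a1 = S a2" "S b1 = S b2"
  unfolding paths by (simp_all add: inner_rules ceiling_minus_swap[of b1 b2] ceiling_minus_swap[of a2 a1])

lemma add_halves: "pairing G T (before G v1) (after G v1) + pairing G T (before G v2) (after G v2) = pairing G T F H"
  unfolding pairing_add_right F_def H_def ..

lemma add_paths: "pairing G (lpath G v1) F' H' + pairing G (lpath G v2) F' H' = pairing G S F' H'"
  unfolding pairing_add_left S_def ..

lemma linking_survives:
  assumes "u \<in> V" "v \<in> V"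
  shows "linking G u v = linking G' u v"
  unfolding linking_def sum_split rest[OF assms(2)] bigon_cancels[OF path_const[OF assms(1)] weight_const[OF assms(2)]]
  using G'(2)[OF assms(1)] by simp

lemma total_survives:
  assumes "v \<in> V"
  shows "total_linking G v = total_linking G' v"
  unfolding total_linking_def sum_split using rest[OF assms, of "\<lambda>_. 1"] weight_const[OF assms] by simp

lemma linking_cancels:
  assumes "u \<in> V"
  shows "linking G u v1 + linking G u v2 = 0"
  unfolding linking_def add_halves
  unfolding sum_split bigon_cancels[OF path_const[OF assms] halves_inner] using halves_outer by simp

lemma total_cancels: "total_linking G v1 + total_linking G v2 = 0"
  unfolding total_linking_def add_halves unfolding sum_split using halves_outer halves_inner by simp

lemma paths_whole:
  assumes "v \<in> V"
  shows "linking G v1 v + linking G v2 v = total_linking G v"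
  unfolding linking_def total_linking_def add_paths
  unfolding sum_split bigon_cancels[OF paths_inner weight_const[OF assms]]
  using paths_outer weight_const[OF assms] by simp

lemma self_linking: "linking G v1 v1 + linking G v2 v1 + (linking G v1 v2 + linking G v2 v2) = 0"
  unfolding linking_def add_paths add_halves
  unfolding sum_split bigon_cancels[OF paths_inner halves_inner] using halves_outer by simp

end

section \<open>Three chords that bound a triangle\<close>

text \<open>The points lie on one strand, so they are less than \<open>1\<close> apart.\<close>

definition ordered :: "bool \<Rightarrow> real \<Rightarrow> real \<Rightarrow> bool" where
  "ordered f a b \<longleftrightarrow> (if f then a < b \<and> b < a + 1 else b < a \<and> a < b + 1)"

lemma ordered_rules:
  assumes "ordered f a b"
  shows "\<lfloor>a - b\<rfloor> = (if f then -1 else 0)" "\<lceil>a - b\<rceil> = (if f then 0 else 1)"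
    "\<lfloor>b - a\<rfloor> = (if f then 0 else -1)" "\<lceil>b - a\<rceil> = (if f then 1 else 0)"
  using assms unfolding ordered_def by (auto simp: floor_eq_iff ceiling_eq_iff split: if_splits)

text \<open>Two points on one strand are separated by the same translates of two points on another strand.\<close>

definition gaps :: "int \<Rightarrow> real \<Rightarrow> real \<Rightarrow> real \<Rightarrow> real \<Rightarrow> bool" where
  "gaps n a a' b b' \<longleftrightarrow> gap n b a \<and> gap n b a' \<and> gap n b' a \<and> gap n b' a'"

text \<open>The vertices are \<open>X\<close> on the strands \<open>0\<close> and \<open>1\<close>, \<open>Y\<close> on \<open>1\<close> and \<open>2\<close>, and \<open>Z\<close> on \<open>2\<close> and \<open>0\<close>; the
  parameter \<open>x0\<close> is that of \<open>X\<close> on the strand \<open>0\<close>, and so on. Go around the triangle in the order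
  \<open>Z\<close>, \<open>X\<close>, \<open>Y\<close>: the sides lie on the strands \<open>0\<close>, \<open>1\<close>, \<open>2\<close> in turn, and \<open>f0\<close>, \<open>f1\<close>, \<open>f2\<close> say which
  of the strands are traversed in this sense. Everything is invariant under the cyclic rotation of
  strands and vertices, so that statements about \<open>X\<close> suffice.\<close>

definition triangle ::
  "int \<Rightarrow> int \<Rightarrow> int \<Rightarrow> bool \<Rightarrow> bool \<Rightarrow> bool \<Rightarrow> real \<Rightarrow> real \<Rightarrow> real \<Rightarrow> real \<Rightarrow> real \<Rightarrow> real \<Rightarrow> bool" where
  "triangle n01 n12 n20 f0 f1 f2 x0 z0 x1 y1 y2 z2 \<longleftrightarrow>
     gaps n01 x0 z0 x1 y1 \<and> gaps n12 x1 y1 y2 z2 \<and> gaps n20 y2 z2 x0 z0 \<and>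
     ordered f0 z0 x0 \<and> ordered f1 x1 y1 \<and> ordered f2 y2 z2"

lemma triangle_rotate:
  "triangle n01 n12 n20 f0 f1 f2 x0 z0 x1 y1 y2 z2 \<Longrightarrow>
   triangle n12 n20 n01 f1 f2 f0 y1 x1 y2 z2 z0 x0"
  unfolding triangle_def gaps_def by blast

lemma triangle_rules:
  assumes "triangle n01 n12 n20 f0 f1 f2 x0 z0 x1 y1 y2 z2"
  shows "gap n01 x1 x0" "gap n01 x1 z0" "gap n01 y1 x0" "gap n01 y1 z0"
    "gap n12 y2 x1" "gap n12 y2 y1" "gap n12 z2 x1" "gap n12 z2 y1"
    "gap n20 x0 y2" "gap n20 x0 z2" "gap n20 z0 y2" "gap n20 z0 z2"
    "ordered f0 z0 x0" "ordered f1 x1 y1" "ordered f2 y2 z2"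
  using assms unfolding triangle_def gaps_def by auto

text \<open>At a vertex with parameters \<open>p\<close> and \<open>q\<close> on two cyclically consecutive strands, the first strand is
  SE--NW iff \<open>e\<close> holds. For directions \<open>e0\<close>, \<open>e1\<close>, \<open>e2\<close> of the strands along the triangle before the
  move, \<open>e\<close> is \<open>e0 = e1\<close> at \<open>X\<close>, \<open>e1 = e2\<close> at \<open>Y\<close> and \<open>e2 = e0\<close> at \<open>Z\<close>. The move preserves these roles
  but reverses the order of the two vertices on each strand.\<close>

definition lend :: "bool \<Rightarrow> real \<Rightarrow> real \<Rightarrow> real" where "lend e p q = (if e then p else q)"
definition rend :: "bool \<Rightarrow> real \<Rightarrow> real \<Rightarrow> real" where "rend e p q = (if e then q else p)"

definition vterm :: "bool \<Rightarrow> real \<Rightarrow> real \<Rightarrow> (real \<Rightarrow> int) \<Rightarrow> (real \<Rightarrow> int) \<Rightarrow> (real \<Rightarrow> int) \<Rightarrow> int" where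
  "vterm e p q S F H = S (rend e p q) * F (lend e p q) - S (lend e p q) * H (rend e p q)"

text \<open>The terms of the three vertices in a pairing.\<close>

definition tsum where
  "tsum e0 e1 e2 x0 z0 x1 y1 y2 z2 S F H =
     vterm (e0 = e1) x0 x1 S F H + vterm (e1 = e2) y1 y2 S F H + vterm (e2 = e0) z2 z0 S F H"

lemma tsum_rotate:
  "tsum e0 e1 e2 x0 z0 x1 y1 y2 z2 S F H = tsum e1 e2 e0 y1 x1 y2 z2 z0 x0 S F H"
  unfolding tsum_def by simp

text \<open>The values of a cycle before and after the points \<open>p\<close> and \<open>q\<close> of a strand where it jumps by \<open>i\<close> and
  \<open>j\<close>, if its value on entering the strand is \<open>b\<close>; the point \<open>p\<close> comes first iff \<open>f\<close> holds.\<close>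

definition strand_vals ::
    "bool \<Rightarrow> (real \<Rightarrow> int) \<Rightarrow> (real \<Rightarrow> int) \<Rightarrow> int \<Rightarrow> real \<Rightarrow> int \<Rightarrow> real \<Rightarrow> int \<Rightarrow> bool" where
  "strand_vals f F H b p i q j \<longleftrightarrow>
     (if f then F p = b \<and> H p = b + i \<and> F q = b + i \<and> H q = b + i + j
      else F q = b \<and> H q = b + j \<and> F p = b + j \<and> H p = b + i + j)"

text \<open>A cycle that enters the strands with the values \<open>b0\<close>, \<open>b1\<close>, \<open>b2\<close>, and whose jump at a vertex is \<open>j\<close> on
  the strand SW--NE and \<open>- j\<close> on the strand SE--NW.\<close>

definition weighted where
  "weighted e0 e1 e2 f0 f1 f2 x0 z0 x1 y1 y2 z2 b0 b1 b2 jX jY jZ F H \<longleftrightarrow>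
     strand_vals f0 F H b0 z0 (if e2 = e0 then jZ else - jZ) x0 (if e0 = e1 then - jX else jX) \<and>
     strand_vals f1 F H b1 x1 (if e0 = e1 then jX else - jX) y1 (if e1 = e2 then - jY else jY) \<and>
     strand_vals f2 F H b2 y2 (if e1 = e2 then jY else - jY) z2 (if e2 = e0 then - jZ else jZ)"

lemma weighted_rotate:
  "weighted e0 e1 e2 f0 f1 f2 x0 z0 x1 y1 y2 z2 b0 b1 b2 jX jY jZ F H \<Longrightarrow>
   weighted e1 e2 e0 f1 f2 f0 y1 x1 y2 z2 z0 x0 b1 b2 b0 jY jZ jX F H"
  unfolding weighted_def by blast

text \<open>The finite computation behind the invariance under a third move, for paths that do not turn at a
  vertex: the entry values and the jumps of the cycle are the same before and after the move.\<close>

lemma triangle_sum_const: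
  assumes "weighted e0 e1 e2 e0 e1 e2 x0 z0 x1 y1 y2 z2 b0 b1 b2 jX jY jZ F H"
    and "weighted e0 e1 e2 (\<not> e0) (\<not> e1) (\<not> e2) x0' z0' x1' y1' y2' z2' b0 b1 b2 jX jY jZ F' H'"
    and "S z0 = S x0" "S' x0' = S x0" "S' z0' = S x0"
    and "S y1 = S x1" "S' x1' = S x1" "S' y1' = S x1"
    and "S z2 = S y2" "S' y2' = S y2" "S' z2' = S y2"
  shows "tsum e0 e1 e2 x0 z0 x1 y1 y2 z2 S F H = tsum e0 e1 e2 x0' z0' x1' y1' y2' z2' S' F' H'"
  using assms unfolding weighted_def strand_vals_def tsum_def vterm_def lend_def rend_def
  by (cases e0; cases e1; cases e2; simp; (simp add: algebra_simps; fail)?)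

text \<open>The values at the six parameters of the path of \<open>X\<close>, which leaves \<open>X\<close> on its strand SE--NW and returns on
  its strand SW--NE.\<close>

definition corner where
  "corner e f0 f1 x0 z0 x1 y1 y2 z2 s S \<longleftrightarrow>
     S x0 = 1 \<and> S x1 = (1::int) \<and> S z0 = (if e \<longleftrightarrow> f0 then 0 else 1) \<and> S y1 = (if e \<longleftrightarrow> f1 then 0 else 1) \<and>
     S y2 = s \<and> S z2 = s"

lemma triangle_sum_corner:
  assumes "weighted e0 e1 e2 e0 e1 e2 x0 z0 x1 y1 y2 z2 b0 b1 b2 jX jY jZ F H"
    and "weighted e0 e1 e2 (\<not> e0) (\<not> e1) (\<not> e2) x0' z0' x1' y1' y2' z2' b0 b1 b2 jX jY jZ F' H'"
    and "corner (e0 = e1) e0 e1 x0 z0 x1 y1 y2 z2 s S"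
    and "corner (e0 = e1) (\<not> e0) (\<not> e1) x0' z0' x1' y1' y2' z2' s S'"
  shows "tsum e0 e1 e2 x0 z0 x1 y1 y2 z2 S F H = tsum e0 e1 e2 x0' z0' x1' y1' y2' z2' S' F' H'"
  using assms unfolding weighted_def strand_vals_def tsum_def vterm_def lend_def rend_def corner_def
  by (cases e0; cases e1; cases e2; simp; (simp add: algebra_simps; fail)?)

text \<open>The value on the strand that misses \<open>X\<close> is \<open>0\<close> or \<open>1\<close> according to the cyclic order of the strands; it
  is the same before and after the move, since the gaps between the strands are.\<close>

lemma corner_path:
  assumes "triangle n01 n12 n20 f0 f1 f2 x0 z0 x1 y1 y2 z2"
  shows "corner e f0 f1 x0 z0 x1 y1 y2 z2 (if e then - 1 - (n01 + n12 + n20) else n01 + n12 + n20 + 2)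
           (path_ind (lend e x0 x1) (rend e x0 x1))"
proof -
  note t = triangle_rules[OF assms]
  note rules = t(1-12)[THEN gap_rules(1)] t(1-12)[THEN gap_rules(2)]
    t(1-12)[THEN gap_rules(3)] t(1-12)[THEN gap_rules(4)]
    t(13-15)[THEN ordered_rules(1)] t(13-15)[THEN ordered_rules(2)]
    t(13-15)[THEN ordered_rules(3)] t(13-15)[THEN ordered_rules(4)]
  show ?thesis unfolding corner_def path_ind_def lend_def rend_def
    by (cases e; cases f0; cases f1) (simp_all add: rules)
qed

text \<open>The signed half of \<open>X\<close> jumps at \<open>X\<close> only. Its entry values depend on the gaps between the strands,
  their roles and the sign but not on the order of the vertices, so they survive the move.\<close>

lemma vertex_weighted:
  assumes "triangle n01 n12 n20 f0 f1 f2 x0 z0 x1 y1 y2 z2"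
  shows "weighted e0 e1 e2 f0 f1 f2 x0 z0 x1 y1 y2 z2
       ((if e0 = e1 then 1 else 0) - (if s then 0 else 1)) ((if e0 = e1 then 0 else 1) - (if s then 0 else 1))
       ((if e0 = e1 then n01 + n12 + n20 + 2 else - 1 - (n01 + n12 + n20)) - (if s then 0 else 1)) 1 0 0
       (half_before (lend (e0 = e1) x0 x1) (rend (e0 = e1) x0 x1) s)
       (half_after (lend (e0 = e1) x0 x1) (rend (e0 = e1) x0 x1) s)"
proof -
  note t = triangle_rules[OF assms]
  note rules = t(1-12)[THEN gap_rules(1)] t(1-12)[THEN gap_rules(2)]
    t(1-12)[THEN gap_rules(3)] t(1-12)[THEN gap_rules(4)]
    t(13-15)[THEN ordered_rules(1)] t(13-15)[THEN ordered_rules(2)]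
    t(13-15)[THEN ordered_rules(3)] t(13-15)[THEN ordered_rules(4)]
  show ?thesis unfolding weighted_def strand_vals_def half_before_def half_after_def half_const_def lend_def rend_def
    by (cases "e0 = e1"; cases s; cases f0; cases f1; cases f2) (simp_all add: rules)
qed

lemma far_weighted:
  assumes "unsep l x0 z0" "unsep r x0 z0" "unsep l x1 y1" "unsep r x1 y1" "unsep l y2 z2" "unsep r y2 z2"
  shows "weighted e0 e1 e2 f0 f1 f2 x0 z0 x1 y1 y2 z2
     (half_before l r s x0) (half_before l r s x1) (half_before l r s y2) 0 0 0 (half_before l r s) (half_after l r s)"
  using unsep_functions[OF assms(1,2)] unsep_functions[OF assms(3,4)] unsep_functions[OF assms(5,6)]
  unfolding weighted_def strand_vals_def by auto

definition sg :: "bool \<Rightarrow> int" where "sg e = (if e then 1 else - 1)"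

text \<open>The three paths, with the signs of the parity axiom, lead from the strand \<open>0\<close> to \<open>1\<close>, to \<open>2\<close> and back to \<open>0\<close>,
  so together they cover the circle \<open>k\<close> times, except at the vertices. There the differences from
  \<open>k\<close> contribute terms that cancel.\<close>

lemma triangle_sum_whole:
  assumes "triangle n01 n12 n20 e0 e1 e2 x0 z0 x1 y1 y2 z2"
    and "weighted e0 e1 e2 e0 e1 e2 x0 z0 x1 y1 y2 z2 b0 b1 b2 jX jY jZ F H"
  defines "S \<equiv> \<lambda>t. sg (e0 = e1) * path_ind (lend (e0 = e1) x0 x1) (rend (e0 = e1) x0 x1) t +
      sg (e1 = e2) * path_ind (lend (e1 = e2) y1 y2) (rend (e1 = e2) y1 y2) t +
      sg (e2 = e0) * path_ind (lend (e2 = e0) z2 z0) (rend (e2 = e0) z2 z0) t"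
    and "k \<equiv> - (n01 + n12 + n20) - (if e0 = e1 then 0 else 1) - (if e1 = e2 then 0 else 1) - (if e2 = e0 then 0 else 1)"
  shows "tsum e0 e1 e2 x0 z0 x1 y1 y2 z2 S F H = k * tsum e0 e1 e2 x0 z0 x1 y1 y2 z2 (\<lambda>_. 1) F H"
proof -
  note c = corner_path[OF assms(1), of "e0 = e1"]
    corner_path[OF triangle_rotate[OF assms(1)], of "e1 = e2"]
    corner_path[OF triangle_rotate[OF triangle_rotate[OF assms(1)]], of "e2 = e0"]
  show ?thesis
    using c assms(2) unfolding weighted_def strand_vals_def tsum_def vterm_def lend_def rend_def corner_def
      S_def k_def sg_def
    by (cases e0; cases e1; cases e2; simp; (simp add: algebra_simps; fail)?)
qed

lemma whole_outside:
  assumes "triangle n01 n12 n20 e0 e1 e2 x0 z0 x1 y1 y2 z2"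
    and "unsep t x0 z0" "unsep t x1 y1" "unsep t y2 z2"
  shows "sg (e0 = e1) * path_ind (lend (e0 = e1) x0 x1) (rend (e0 = e1) x0 x1) t +
      sg (e1 = e2) * path_ind (lend (e1 = e2) y1 y2) (rend (e1 = e2) y1 y2) t +
      sg (e2 = e0) * path_ind (lend (e2 = e0) z2 z0) (rend (e2 = e0) z2 z0) t =
     - (n01 + n12 + n20) - (if e0 = e1 then 0 else 1) - (if e1 = e2 then 0 else 1) - (if e2 = e0 then 0 else 1)"
proof -
  note t = triangle_rules[OF assms(1)]
  note rules = t(1-12)[THEN gap_rules(1)] t(1-12)[THEN gap_rules(2)]
    t(1-12)[THEN gap_rules(3)] t(1-12)[THEN gap_rules(4)]
    unsep_rules(1-3)[OF assms(2)] unsep_rules(1-3)[OF assms(3)] unsep_rules(1-3)[OF assms(4)]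
  show ?thesis unfolding path_ind_def lend_def rend_def sg_def
    by (cases e0; cases e1; cases e2) (simp_all add: rules)
qed

definition off :: "real \<Rightarrow> real \<Rightarrow> real \<Rightarrow> bool" where
  "off \<alpha> \<beta> t \<longleftrightarrow> (\<forall>k::int. t + k \<notin> {\<alpha>..\<beta>})"

lemma off_unsep:
  assumes "off \<alpha> \<beta> t" "x \<in> {\<alpha>..\<beta>}" "y \<in> {\<alpha>..\<beta>}"
  shows "unsep t x y"
proof -
  have le: "\<lfloor>t - x\<rfloor> \<le> \<lfloor>t - y\<rfloor>" if "x \<in> {\<alpha>..\<beta>}" "y \<in> {\<alpha>..\<beta>}" for x y
  proof (rule ccontr)
    assume "\<not> \<lfloor>t - x\<rfloor> \<le> \<lfloor>t - y\<rfloor>"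
    then have "t - y < \<lfloor>t - x\<rfloor>"
      by (simp add: floor_less_iff not_le)
    then have "\<alpha> \<le> t - \<lfloor>t - x\<rfloor>" "t - \<lfloor>t - x\<rfloor> \<le> \<beta>"
      using that of_int_floor_le[of "t - x"] unfolding atLeastAtMost_iff by linarith+
    then have "t + of_int (- \<lfloor>t - x\<rfloor>) \<in> {\<alpha>..\<beta>}" by simp
    then show False using assms(1) unfolding off_def by blast
  qed
  have ceil: "\<lceil>t - x\<rceil> = \<lfloor>t - x\<rfloor> + 1" if "x \<in> {\<alpha>..\<beta>}" for x
  proof -
    have "t - x \<notin> \<int>"
    proof
      assume "t - x \<in> \<int>"
      then obtain k where "t - x = of_int k" by (auto elim: Ints_cases)
      then have "t + of_int (- k) \<in> {\<alpha>..\<beta>}" using that by (auto simp: algebra_simps)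
      then show False using assms(1) unfolding off_def by blast
    qed
    then show ?thesis by (simp add: ceiling_altdef frac_eq_0_iff) (metis Ints_of_int)
  qed
  show ?thesis unfolding unsep_def using le[OF assms(2,3)] le[OF assms(3,2)] ceil assms by auto
qed

lemma off_shift: "off \<alpha> \<beta> (t + of_int k) \<longleftrightarrow> off \<alpha> \<beta> t"
proof -
  have "off \<alpha> \<beta> (t + of_int k)" if "off \<alpha> \<beta> t" for t k
    using that unfolding off_def by (metis add.assoc of_int_add)
  from this[of t k] this[of "t + of_int k" "- k"] show ?thesis by auto
qed

lemma off_between:
  assumes "\<beta> + of_int m < t" "t < \<alpha> + of_int m + 1"
  shows "off \<alpha> \<beta> t"
  unfolding off_def
proof (intro allI notI)
  fix k :: int assume k: "t + k \<in> {\<alpha>..\<beta>}"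
  then have "real_of_int (m + k) < real_of_int 0" "real_of_int (- 1) < real_of_int (m + k)" using assms by auto
  then show False unfolding of_int_less_iff by simp
qed

text \<open>Two disjoint arcs of the circle lie in a fixed position relative to each other.\<close>

lemma off_gapE:
  assumes "off \<alpha> \<beta> t" "\<alpha> \<le> \<beta>"
  obtains m :: int where "\<beta> + m < t" "t < \<alpha> + m + 1"
proof -
  have "unsep t \<alpha> \<beta>" using off_unsep[OF assms(1)] assms(2) by auto
  then have "\<lfloor>t - \<alpha>\<rfloor> = \<lfloor>t - \<beta>\<rfloor>" "\<lceil>t - \<beta>\<rceil> = \<lfloor>t - \<beta>\<rfloor> + 1" unfolding unsep_def by auto
  then have "\<beta> + \<lfloor>t - \<beta>\<rfloor> < t" "t < \<alpha> + \<lfloor>t - \<beta>\<rfloor> + 1"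
    using floor_correct[of "t - \<alpha>"] ceiling_correct[of "t - \<beta>"] by linarith+
  then show thesis by (rule that)
qed

lemma eventually_off:
  assumes "off \<alpha> \<beta> t" "\<alpha> \<le> \<beta>"
  shows "\<forall>\<^sub>F u in nhds t. off \<alpha> \<beta> u"
proof -
  obtain m :: int where "\<beta> + m < t" "t < \<alpha> + m + 1" using off_gapE[OF assms] by blast
  then have "\<forall>\<^sub>F u in nhds t. u \<in> {\<beta> + m<..<\<alpha> + m + 1}"
    by (intro eventually_nhds_in_open) auto
  then show ?thesis by (rule eventually_mono) (auto intro: off_between)
qed

lemma off_gap:
  assumes "\<And>x. x \<in> {\<alpha>..\<beta>} \<Longrightarrow> off \<gamma> \<delta> x" "\<And>y. y \<in> {\<gamma>..\<delta>} \<Longrightarrow> off \<alpha> \<beta> y"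
    and "\<alpha> \<le> \<beta>" "\<gamma> \<le> \<delta>"
  obtains n where "\<And>x y. x \<in> {\<alpha>..\<beta>} \<Longrightarrow> y \<in> {\<gamma>..\<delta>} \<Longrightarrow> gap n y x"
proof
  fix x y assume xy: "x \<in> {\<alpha>..\<beta>}" "y \<in> {\<gamma>..\<delta>}"
  have "unsep y x \<alpha>" using assms xy by (intro off_unsep[OF assms(2)]) auto
  moreover have "unsep \<alpha> y \<gamma>" using assms xy by (intro off_unsep[OF assms(1)]) auto
  ultimately show "gap \<lfloor>\<gamma> - \<alpha>\<rfloor> y x"
    unfolding gap_def using unsep_rules[of \<alpha> y \<gamma>] unsep_rules[of y x \<alpha>] by simp
qed

text \<open>The data of a third move from \<open>G\<close> to \<open>G'\<close>: the chords correspond by \<open>g\<close>, the chords in \<open>V\<close> stay where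
  they are, and the vertices move within the three strands. The gaps and the roles of the strands
  are the same for both triangles, while the orders on the strands are opposite.\<close>

locale third_move =
  fixes G G' :: "'v chord_diagram" and g :: "'v \<Rightarrow> 'v" and V :: "'v set" and X Y Z :: 'v
    and e0 e1 e2 :: bool and n01 n12 n20 :: int
    and \<alpha>0 \<beta>0 \<alpha>1 \<beta>1 \<alpha>2 \<beta>2 x0 z0 x1 y1 y2 z2 x0' z0' x1' y1' y2' z2' :: real
  assumes chords: "chords G = insert X (insert Y (insert Z V))" "chords G' = g ` chords G"
    and inj: "inj_on g (chords G)" and fin: "finite V"
    and distinct: "X \<noteq> Y" "Y \<noteq> Z" "X \<noteq> Z" "X \<notin> V" "Y \<notin> V" "Z \<notin> V"
    and far_same: "\<And>w. w \<in> V \<Longrightarrow> lpar G' (g w) = lpar G w \<and> rpar G' (g w) = rpar G w"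
    and pos_same: "\<And>w. w \<in> chords G \<Longrightarrow> pos G' (g w) = pos G w"
    and far: "\<And>w t. w \<in> V \<Longrightarrow> t = lpar G w \<or> t = rpar G w \<Longrightarrow> off \<alpha>0 \<beta>0 t \<and> off \<alpha>1 \<beta>1 t \<and> off \<alpha>2 \<beta>2 t"
    and strand0: "{x0, z0, x0', z0'} \<subseteq> {\<alpha>0..\<beta>0}"
    and strand1: "{x1, y1, x1', y1'} \<subseteq> {\<alpha>1..\<beta>1}"
    and strand2: "{y2, z2, y2', z2'} \<subseteq> {\<alpha>2..\<beta>2}"
    and tri: "triangle n01 n12 n20 e0 e1 e2 x0 z0 x1 y1 y2 z2"
    and tri': "triangle n01 n12 n20 (\<not> e0) (\<not> e1) (\<not> e2) x0' z0' x1' y1' y2' z2'"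
    and X: "lpar G X = lend (e0 = e1) x0 x1" "rpar G X = rend (e0 = e1) x0 x1"
    and Y: "lpar G Y = lend (e1 = e2) y1 y2" "rpar G Y = rend (e1 = e2) y1 y2"
    and Z: "lpar G Z = lend (e2 = e0) z2 z0" "rpar G Z = rend (e2 = e0) z2 z0"
    and X': "lpar G' (g X) = lend (e0 = e1) x0' x1'" "rpar G' (g X) = rend (e0 = e1) x0' x1'"
    and Y': "lpar G' (g Y) = lend (e1 = e2) y1' y2'" "rpar G' (g Y) = rend (e1 = e2) y1' y2'"
    and Z': "lpar G' (g Z) = lend (e2 = e0) z2' z0'" "rpar G' (g Z) = rend (e2 = e0) z2' z0'"
begin

abbreviation "tri_sum \<equiv> tsum e0 e1 e2 x0 z0 x1 y1 y2 z2"
abbreviation "tri_sum' \<equiv> tsum e0 e1 e2 x0' z0' x1' y1' y2' z2'"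

lemma pairing_split:
  "pairing G S F H = tri_sum S F H + (\<Sum>w\<in>V. S (rpar G w) * F (lpar G w) - S (lpar G w) * H (rpar G w))"
  unfolding pairing_def chords tsum_def vterm_def using fin distinct by (simp add: X Y Z)

lemma pairing_split':
  "pairing G' S F H = tri_sum' S F H + (\<Sum>w\<in>V. S (rpar G w) * F (lpar G w) - S (lpar G w) * H (rpar G w))"
proof -
  have "pairing G' S F H = (\<Sum>w\<in>chords G. S (rpar G' (g w)) * F (lpar G' (g w)) - S (lpar G' (g w)) * H (rpar G' (g w)))"
    unfolding pairing_def chords(2) by (simp add: sum.reindex[OF inj])
  also have "\<dots> = tri_sum' S F H +
      (\<Sum>w\<in>V. S (rpar G' (g w)) * F (lpar G' (g w)) - S (lpar G' (g w)) * H (rpar G' (g w)))"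
    unfolding tsum_def vterm_def using fin distinct by (simp add: X' Y' Z' chords)
  finally show ?thesis using far_same by simp
qed

lemma far_unsep:
  assumes "off \<alpha>0 \<beta>0 t" "off \<alpha>1 \<beta>1 t" "off \<alpha>2 \<beta>2 t"
  shows "unsep t x0 z0" "unsep t x0 x0'" "unsep t x0 z0'"
    "unsep t x1 y1" "unsep t x1 x1'" "unsep t x1 y1'"
    "unsep t y2 z2" "unsep t y2 y2'" "unsep t y2 z2'"
    "unsep t z0 z0'" "unsep t y1 y1'" "unsep t z2 z2'"
    "unsep t x0' z0'" "unsep t x1' y1'" "unsep t y2' z2'"
  using off_unsep[OF assms(1)] off_unsep[OF assms(2)] off_unsep[OF assms(3)] strand0 strand1 strand2
  by auto

lemma gap_move:
  assumes "unsep t p p'" "unsep t q q'" "gap n p q" "gap n p' q'"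
  shows "path_ind p q t = path_ind p' q' t" "path_ind q p t = path_ind q' p' t"
    "half_before p q s t = half_before p' q' s t" "half_before q p s t = half_before q' p' s t"
    "half_after p q s t = half_after p' q' s t" "half_after q p s t = half_after q' p' s t"
  unfolding path_ind_def half_before_def half_after_def half_const_def
  by (simp_all add: unsep_rules(1-3)[OF assms(1)] unsep_rules(1-3)[OF assms(2)] gap_rules[OF assms(3)] gap_rules[OF assms(4)])

text \<open>The ends of the chord slide within strands that do not contain \<open>t\<close>, so none of the floors involved
  changes its value.\<close>

lemma far_functions:
  assumes v: "v \<in> chords G" and t: "off \<alpha>0 \<beta>0 t" "off \<alpha>1 \<beta>1 t" "off \<alpha>2 \<beta>2 t"
  shows "lpath G' (g v) t = lpath G v t" "before G' (g v) t = before G v t" "after G' (g v) t = after G v t"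
proof -
  note un = far_unsep[OF t]
  note tr = triangle_rules[OF tri] and tr' = triangle_rules[OF tri']
  note m = gap_move[OF un(5) un(2) tr(1) tr'(1)] gap_move[OF un(8) un(11) tr(6) tr'(6)]
    gap_move[OF un(10) un(12) tr(12) tr'(12)]
  consider "v = X" | "v = Y" | "v = Z" | "v \<in> V" using v chords by auto
  then have "lpath G' (g v) t = lpath G v t \<and> before G' (g v) t = before G v t \<and> after G' (g v) t = after G v t"
  proof cases
    case 1
    then show ?thesis using m pos_same[OF v] by (simp add: X X' lend_def rend_def)
  next
    case 2
    then show ?thesis using m pos_same[OF v] by (simp add: Y Y' lend_def rend_def)
  next
    case 3
    then show ?thesis using m pos_same[OF v] by (simp add: Z Z' lend_def rend_def)
  next
    case 4
    then show ?thesis using far_same pos_same[OF v] by simp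
  qed
  then show "lpath G' (g v) t = lpath G v t" "before G' (g v) t = before G v t" "after G' (g v) t = after G v t"
    by auto
qed

text \<open>This makes the finite computations for the triangle applicable to the half of every chord.\<close>

lemma weights:
  assumes v: "v \<in> chords G"
  obtains b0 b1 b2 jX jY jZ where
    "weighted e0 e1 e2 e0 e1 e2 x0 z0 x1 y1 y2 z2 b0 b1 b2 jX jY jZ (before G v) (after G v)"
    "weighted e0 e1 e2 (\<not> e0) (\<not> e1) (\<not> e2) x0' z0' x1' y1' y2' z2' b0 b1 b2 jX jY jZ (before G' (g v)) (after G' (g v))"
proof -
  note r = triangle_rotate[OF tri] and r' = triangle_rotate[OF tri']
  consider "v = X" | "v = Y" | "v = Z" | "v \<in> V" using v chords by auto
  then show thesis
  proof cases
    case 1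
    show thesis
      using vertex_weighted[OF tri, of e0 e1 e2 "pos G v"] vertex_weighted[OF tri', of e0 e1 e2 "pos G v"]
        pos_same[OF v] 1 unfolding X[symmetric] X'[symmetric] by (intro that) simp_all
  next
    case 2
    show thesis
      using weighted_rotate[OF weighted_rotate[OF vertex_weighted[OF r, of e1 e2 e0 "pos G v"]]]
        weighted_rotate[OF weighted_rotate[OF vertex_weighted[OF r', of e1 e2 e0 "pos G v"]]]
        pos_same[OF v] 2 unfolding Y[symmetric] Y'[symmetric] by (intro that) simp_all
  next
    case 3
    show thesis
      using weighted_rotate[OF vertex_weighted[OF triangle_rotate[OF r], of e2 e0 e1 "pos G v"]]
        weighted_rotate[OF vertex_weighted[OF triangle_rotate[OF r'], of e2 e0 e1 "pos G v"]]
        pos_same[OF v] 3 unfolding Z[symmetric] Z'[symmetric] by (intro that) simp_all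
  next
    case 4
    note ul = far_unsep[of "lpar G v"] and ur = far_unsep[of "rpar G v"]
    have f: "off \<alpha>0 \<beta>0 (lpar G v)" "off \<alpha>1 \<beta>1 (lpar G v)" "off \<alpha>2 \<beta>2 (lpar G v)"
      "off \<alpha>0 \<beta>0 (rpar G v)" "off \<alpha>1 \<beta>1 (rpar G v)" "off \<alpha>2 \<beta>2 (rpar G v)"
      using far[OF 4] by auto
    note ul = far_unsep[OF f(1-3)] and ur = far_unsep[OF f(4-6)]
    have same: "before G' (g v) x0' = before G v x0" "before G' (g v) x1' = before G v x1"
      "before G' (g v) y2' = before G v y2"
      using far_same[OF 4] pos_same[OF v] unsep_functions(2)[OF ul(2) ur(2)] unsep_functions(2)[OF ul(5) ur(5)]
        unsep_functions(2)[OF ul(8) ur(8)] by simp_all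
    have f': "lpar G' (g v) = lpar G v" "rpar G' (g v) = rpar G v" using far_same[OF 4] by auto
    show thesis
    proof (rule that)
      show "weighted e0 e1 e2 e0 e1 e2 x0 z0 x1 y1 y2 z2 (before G v x0) (before G v x1) (before G v y2) 0 0 0 (before G v) (after G v)"
        by (rule far_weighted[OF ul(1) ur(1) ul(4) ur(4) ul(7) ur(7)])
      show "weighted e0 e1 e2 (\<not> e0) (\<not> e1) (\<not> e2) x0' z0' x1' y1' y2' z2' (before G v x0) (before G v x1) (before G v y2) 0 0 0 (before G' (g v)) (after G' (g v))"
        unfolding same[symmetric] unfolding f'
        by (rule far_weighted[OF ul(13) ur(13) ul(14) ur(14) ul(15) ur(15)])
    qed
  qed
qed

lemma tri_sum_path:
  assumes u: "u \<in> chords G"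
    and w: "weighted e0 e1 e2 e0 e1 e2 x0 z0 x1 y1 y2 z2 b0 b1 b2 jX jY jZ F H"
    and w': "weighted e0 e1 e2 (\<not> e0) (\<not> e1) (\<not> e2) x0' z0' x1' y1' y2' z2' b0 b1 b2 jX jY jZ F' H'"
  shows "tri_sum (lpath G u) F H = tri_sum' (lpath G' (g u)) F' H'"
proof -
  note r = triangle_rotate[OF tri] and r' = triangle_rotate[OF tri']
  note wr = weighted_rotate[OF w] and wr' = weighted_rotate[OF w']
  consider "u = X" | "u = Y" | "u = Z" | "u \<in> V" using u chords by auto
  then show ?thesis
  proof cases
    case 1
    show ?thesis unfolding 1 X X'
      by (rule triangle_sum_corner[OF w w' corner_path[OF tri] corner_path[OF tri']])
  next
    case 2
    show ?thesis unfolding 2 Y Y' tsum_rotate[of e0 e1 e2]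
      by (rule triangle_sum_corner[OF wr wr' corner_path[OF r] corner_path[OF r']])
  next
    case 3
    show ?thesis unfolding 3 Z Z' tsum_rotate[of e0 e1 e2] tsum_rotate[of e1 e2 e0]
      by (rule triangle_sum_corner[OF weighted_rotate[OF wr] weighted_rotate[OF wr']
            corner_path[OF triangle_rotate[OF r]] corner_path[OF triangle_rotate[OF r']]])
  next
    case 4
    have f: "off \<alpha>0 \<beta>0 (lpar G u)" "off \<alpha>1 \<beta>1 (lpar G u)" "off \<alpha>2 \<beta>2 (lpar G u)"
      "off \<alpha>0 \<beta>0 (rpar G u)" "off \<alpha>1 \<beta>1 (rpar G u)" "off \<alpha>2 \<beta>2 (rpar G u)"
      using far[OF 4] by auto
    note ul = far_unsep[OF f(1-3)] and ur = far_unsep[OF f(4-6)]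
    have f': "lpar G' (g u) = lpar G u" "rpar G' (g u) = rpar G u" using far_same[OF 4] by auto
    note fn = unsep_functions(1)[OF ul(1) ur(1), symmetric] unsep_functions(1)[OF ul(2) ur(2), symmetric]
      unsep_functions(1)[OF ul(3) ur(3), symmetric] unsep_functions(1)[OF ul(4) ur(4), symmetric]
      unsep_functions(1)[OF ul(5) ur(5), symmetric] unsep_functions(1)[OF ul(6) ur(6), symmetric]
      unsep_functions(1)[OF ul(7) ur(7), symmetric] unsep_functions(1)[OF ul(8) ur(8), symmetric]
      unsep_functions(1)[OF ul(9) ur(9), symmetric]
    show ?thesis unfolding f'
      by (rule triangle_sum_const[OF w w']) (rule fn)+
  qed
qed

lemma far_params:
  assumes "w \<in> V"
  shows "off \<alpha>0 \<beta>0 (lpar G w)" "off \<alpha>1 \<beta>1 (lpar G w)" "off \<alpha>2 \<beta>2 (lpar G w)"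
    "off \<alpha>0 \<beta>0 (rpar G w)" "off \<alpha>1 \<beta>1 (rpar G w)" "off \<alpha>2 \<beta>2 (rpar G w)"
  using far[OF assms] by auto

theorem third_move_linking:
  assumes "u \<in> chords G" "v \<in> chords G"
  shows "linking G' (g u) (g v) = linking G u v"
proof -
  obtain b0 b1 b2 jX jY jZ where w:
    "weighted e0 e1 e2 e0 e1 e2 x0 z0 x1 y1 y2 z2 b0 b1 b2 jX jY jZ (before G v) (after G v)"
    "weighted e0 e1 e2 (\<not> e0) (\<not> e1) (\<not> e2) x0' z0' x1' y1' y2' z2' b0 b1 b2 jX jY jZ (before G' (g v)) (after G' (g v))"
    by (rule weights[OF assms(2)])
  show ?thesis
    unfolding linking_def pairing_split pairing_split' tri_sum_path[OF assms(1) w]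
    using far_functions[OF assms(1) far_params(1-3)] far_functions[OF assms(1) far_params(4-6)]
      far_functions[OF assms(2) far_params(1-3)] far_functions[OF assms(2) far_params(4-6)]
    by simp
qed

theorem third_move_total:
  assumes "v \<in> chords G"
  shows "total_linking G' (g v) = total_linking G v"
proof -
  obtain b0 b1 b2 jX jY jZ where w:
    "weighted e0 e1 e2 e0 e1 e2 x0 z0 x1 y1 y2 z2 b0 b1 b2 jX jY jZ (before G v) (after G v)"
    "weighted e0 e1 e2 (\<not> e0) (\<not> e1) (\<not> e2) x0' z0' x1' y1' y2' z2' b0 b1 b2 jX jY jZ (before G' (g v)) (after G' (g v))"
    by (rule weights[OF assms(1)])
  have "tri_sum (\<lambda>_. 1) (before G v) (after G v) = tri_sum' (\<lambda>_. 1) (before G' (g v)) (after G' (g v))"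
    by (rule triangle_sum_const[OF w]) simp_all
  then show ?thesis
    unfolding total_linking_def pairing_split pairing_split'
    using far_functions[OF assms far_params(1-3)] far_functions[OF assms far_params(4-6)]
    by simp
qed

theorem third_move_whole:
  obtains k where "\<And>v. v \<in> chords G \<Longrightarrow>
    sg (e0 = e1) * linking G X v + sg (e1 = e2) * linking G Y v + sg (e2 = e0) * linking G Z v = k * total_linking G v"
proof -
  define k where "k = - (n01 + n12 + n20) - (if e0 = e1 then 0 else 1) - (if e1 = e2 then 0 else 1) - (if e2 = e0 then 0 else 1)"
  define S where "S t = sg (e0 = e1) * lpath G X t + sg (e1 = e2) * lpath G Y t + sg (e2 = e0) * lpath G Z t" for t
  have S: "S = (\<lambda>t. sg (e0 = e1) * path_ind (lend (e0 = e1) x0 x1) (rend (e0 = e1) x0 x1) t +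
      sg (e1 = e2) * path_ind (lend (e1 = e2) y1 y2) (rend (e1 = e2) y1 y2) t +
      sg (e2 = e0) * path_ind (lend (e2 = e0) z2 z0) (rend (e2 = e0) z2 z0) t)"
    unfolding S_def X Y Z ..
  have "sg (e0 = e1) * linking G X v + sg (e1 = e2) * linking G Y v + sg (e2 = e0) * linking G Z v = k * total_linking G v"
    if v: "v \<in> chords G" for v
  proof -
    obtain b0 b1 b2 jX jY jZ where w:
      "weighted e0 e1 e2 e0 e1 e2 x0 z0 x1 y1 y2 z2 b0 b1 b2 jX jY jZ (before G v) (after G v)"
      by (rule weights[OF v])
    have "sg (e0 = e1) * linking G X v + sg (e1 = e2) * linking G Y v + sg (e2 = e0) * linking G Z v =
        pairing G S (before G v) (after G v)"
      unfolding linking_def pairing_def sum_distrib_left sum.distrib[symmetric] S_def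
      by (intro sum.cong refl) (simp add: algebra_simps)
    also have "\<dots> = k * tri_sum (\<lambda>_. 1) (before G v) (after G v) +
        (\<Sum>w\<in>V. k * before G v (lpar G w) - k * after G v (rpar G w))"
    proof -
      have "S t = k" if "off \<alpha>0 \<beta>0 t" "off \<alpha>1 \<beta>1 t" "off \<alpha>2 \<beta>2 t" for t
        unfolding S k_def
        using whole_outside[OF tri far_unsep(1)[OF that] far_unsep(4)[OF that] far_unsep(7)[OF that]] .
      then show ?thesis
        unfolding pairing_split using triangle_sum_whole[OF tri w] far_params unfolding S k_def by simp
    qed
    also have "\<dots> = k * total_linking G v"
      unfolding total_linking_def pairing_split by (simp add: sum_distrib_left algebra_simps)
    finally show ?thesis .
  qed
  then show thesis by (rule that)
qed

end

section \<open>Crossings and their parameters\<close>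

lemma same_mod_1_refl [simp]: "same_mod_1 t t"
  unfolding same_mod_1_def by (rule exI[of _ 0]) simp

lemma same_mod_1_sym: "same_mod_1 s t \<Longrightarrow> same_mod_1 t s"
  unfolding same_mod_1_def by (metis add_diff_cancel diff_add_cancel of_int_minus uminus_add_conv_diff add.commute)

lemma same_mod_1_trans: "same_mod_1 s t \<Longrightarrow> same_mod_1 t u \<Longrightarrow> same_mod_1 s u"
  unfolding same_mod_1_def by (metis add.assoc of_int_add)

lemma same_mod_1_Ints: "same_mod_1 s t \<longleftrightarrow> s - t \<in> \<int>"
  unfolding same_mod_1_def by (auto elim!: Ints_cases) (metis add.commute diff_add_cancel)

lemma ceiling_floor_Ints: "\<lceil>x\<rceil> = \<lfloor>x\<rfloor> + (if x \<in> \<int> then 0 else 1)" for x :: real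
  by (auto simp: ceiling_altdef elim!: Ints_cases) (metis Ints_of_int)

lemma virtual_diagramD:
  assumes "virtual_diagram D"
  shows curve_periodic: "curve D (t + 1) = curve D t"
    and curve_differentiable: "curve D differentiable at t"
    and vel_continuous: "continuous_on UNIV (vel D)"
    and vel_nonzero: "vel D t \<noteq> 0"
    and finite_double_points: "finite (double_points D)"
    and no_triple_points: "curve D s = curve D t \<Longrightarrow> curve D t = curve D u \<Longrightarrow>
      s - t \<in> \<int> \<or> t - u \<in> \<int> \<or> s - u \<in> \<int>"
    and transversal: "curve D s = curve D t \<Longrightarrow> s - t \<notin> \<int> \<Longrightarrow> det2 (vel D s) (vel D t) \<noteq> 0"
    and over_periodic: "t + 1 \<in> over D \<longleftrightarrow> t \<in> over D"
    and over_double: "s \<in> over D \<Longrightarrow> \<exists>t. t \<notin> over D \<and> s - t \<notin> \<int> \<and> curve D t = curve D s"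
  using assms unfolding virtual_diagram_def by blast+

lemma curve_shift:
  assumes "virtual_diagram D"
  shows "curve D (t + of_int k) = curve D t"
proof (induction k rule: int_induct[where k = 0])
  case (step1 i)
  then show ?case using curve_periodic[OF assms, of "t + of_int i"] by (simp add: add.assoc)
next
  case (step2 i)
  then show ?case using curve_periodic[OF assms, of "t + of_int (i - 1)"] by (simp add: algebra_simps)
qed simp

lemma over_shift:
  assumes "virtual_diagram D"
  shows "t + of_int k \<in> over D \<longleftrightarrow> t \<in> over D"
proof (induction k rule: int_induct[where k = 0])
  case (step1 i)
  then show ?case using over_periodic[OF assms, of "t + of_int i"] by (simp add: add.assoc)
next
  case (step2 i)
  then show ?case using over_periodic[OF assms, of "t + of_int (i - 1)"] by (simp add: algebra_simps)
qed simp

lemma has_vel: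
  assumes "virtual_diagram D"
  shows "(curve D has_vector_derivative vel D t) (at t)"
  using curve_differentiable[OF assms, of t] unfolding vel_def by (simp add: vector_derivative_works)

lemma vel_unique:
  assumes "virtual_diagram D" "(f has_vector_derivative w) (at t)" "\<forall>\<^sub>F s in nhds t. f s = curve D s"
  shows "vel D t = w"
proof -
  have "(curve D has_vector_derivative w) (at t)"
    using assms(2) unfolding has_vector_derivative_def
    by (rule has_derivative_transform_eventually)
      (use assms(3) in \<open>auto simp: eventually_at_filter elim: eventually_mono dest: eventually_nhds_x_imp_x\<close>)
  then show ?thesis using vector_derivative_at unfolding vel_def by blast
qed

lemma vel_shift:
  assumes "virtual_diagram D"
  shows "vel D (t + of_int k) = vel D t"
proof -
  have "((\<lambda>s. s + of_int k) has_vector_derivative 1) (at t)"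
    by (auto intro!: derivative_eq_intros)
  from vector_diff_chain_at[OF this has_vel[OF assms]]
  have "(curve D has_vector_derivative vel D (t + of_int k)) (at t)"
    by (simp add: o_def curve_shift[OF assms])
  then show ?thesis using vector_derivative_at unfolding vel_def by metis
qed

lemma same_mod_1_curve:
  assumes "virtual_diagram D" "same_mod_1 s t"
  shows "curve D s = curve D t" "vel D s = vel D t" "s \<in> over D \<longleftrightarrow> t \<in> over D"
  using assms curve_shift vel_shift over_shift unfolding same_mod_1_def by auto

lemma det2_antisym: "det2 w u = - det2 u w" and det2_self [simp]: "det2 u u = 0"
  unfolding det2_def by simp_all

lemma classical_strands:
  assumes D: "virtual_diagram D" and v: "v \<in> classical D"
  obtains r l where "curve D r = v" "curve D l = v" "det2 (vel D r) (vel D l) > 0"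
    "\<not> same_mod_1 r l" "r \<in> over D \<longleftrightarrow> l \<notin> over D"
    "\<And>u. curve D u = v \<Longrightarrow> same_mod_1 u r \<or> same_mod_1 u l"
proof -
  obtain s where s: "s \<in> over D" "curve D s = v" using v unfolding classical_def by auto
  obtain t where t: "t \<notin> over D" "s - t \<notin> \<int>" "curve D t = v" using over_double[OF D s(1)] s by auto
  have nz: "det2 (vel D s) (vel D t) \<noteq> 0" using transversal[OF D _ t(2)] s t by simp
  have two: "same_mod_1 u s \<or> same_mod_1 u t" if "curve D u = v" for u
    using no_triple_points[OF D, of u s t] that s t by (auto simp: same_mod_1_Ints)
  have ns: "\<not> same_mod_1 s t" "\<not> same_mod_1 t s" using t(2) same_mod_1_sym by (auto simp: same_mod_1_Ints)
  show thesis
  proof (cases "det2 (vel D s) (vel D t) > 0")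
    case True
    then show thesis using s t ns two by (intro that[of s t]) auto
  next
    case False
    then show thesis using s t ns two nz by (intro that[of t s]) (auto simp: det2_antisym[of "vel D t"])
  qed
qed

lemma unique_lift:
  assumes P: "\<And>u. P u \<longleftrightarrow> same_mod_1 u r"
  shows "P (THE t. 0 \<le> t \<and> t < 1 \<and> P t)" "0 \<le> (THE t. 0 \<le> t \<and> t < 1 \<and> P t)" "(THE t. 0 \<le> t \<and> t < 1 \<and> P t) < 1"
proof -
  have "(THE t. 0 \<le> t \<and> t < 1 \<and> P t) = frac r"
  proof (rule the_equality)
    show "0 \<le> frac r \<and> frac r < 1 \<and> P (frac r)"
      unfolding P same_mod_1_def frac_def using frac_ge_0[of r] frac_lt_1[of r]
      by (auto simp: frac_def intro: exI[of _ "- \<lfloor>r\<rfloor>"])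
    fix t assume t: "0 \<le> t \<and> t < 1 \<and> P t"
    then obtain k :: int where "t = r + k" unfolding P same_mod_1_def by blast
    then have "r - t \<in> \<int>" by simp
    then show "t = frac r" using t frac_unique_iff[of r t] by simp
  qed
  moreover have "P (frac r)"
    unfolding P same_mod_1_def frac_def by (auto intro: exI[of _ "- \<lfloor>r\<rfloor>"])
  ultimately show "P (THE t. 0 \<le> t \<and> t < 1 \<and> P t)" "0 \<le> (THE t. 0 \<le> t \<and> t < 1 \<and> P t)" "(THE t. 0 \<le> t \<and> t < 1 \<and> P t) < 1"
    by (simp_all add: frac_lt_1)
qed

lemma crossing_params:
  assumes D: "virtual_diagram D" and v: "v \<in> classical D"
  shows ne_strand_iff: "ne_strand D v u \<longleftrightarrow> same_mod_1 u (ne_param D v)"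
    and nw_strand_iff: "nw_strand D v u \<longleftrightarrow> same_mod_1 u (nw_param D v)"
    and curve_eq_iff: "curve D u = v \<longleftrightarrow> same_mod_1 u (ne_param D v) \<or> same_mod_1 u (nw_param D v)"
    and params_distinct: "\<not> same_mod_1 (ne_param D v) (nw_param D v)"
    and det2_params: "det2 (vel D (ne_param D v)) (vel D (nw_param D v)) > 0"
    and over_params: "ne_param D v \<in> over D \<longleftrightarrow> nw_param D v \<notin> over D"
    and ne_param_bounds: "0 \<le> ne_param D v" "ne_param D v < 1"
    and nw_param_bounds: "0 \<le> nw_param D v" "nw_param D v < 1"
proof -
  obtain r l where rl: "curve D r = v" "curve D l = v" "det2 (vel D r) (vel D l) > 0"
    "\<not> same_mod_1 r l" "r \<in> over D \<longleftrightarrow> l \<notin> over D"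
    and two: "\<And>u. curve D u = v \<Longrightarrow> same_mod_1 u r \<or> same_mod_1 u l"
    by (rule classical_strands[OF D v]) blast
  have cu: "curve D u = v \<longleftrightarrow> same_mod_1 u r \<or> same_mod_1 u l" for u
    using two rl same_mod_1_curve[OF D] by metis
  have ne: "ne_strand D v u \<longleftrightarrow> same_mod_1 u r" for u
  proof
    assume "ne_strand D v u"
    then obtain k where k: "curve D u = v" "curve D k = v" "det2 (vel D u) (vel D k) > 0"
      unfolding ne_strand_def by auto
    show "same_mod_1 u r"
    proof (rule ccontr)
      assume "\<not> same_mod_1 u r"
      then have "same_mod_1 u l" using two k by blast
      moreover have "same_mod_1 k r \<or> same_mod_1 k l" using two k by blast
      ultimately show False using k(3) rl(3) same_mod_1_curve(2)[OF D] det2_antisym[of "vel D l" "vel D r"]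
        by (metis det2_self less_irrefl neg_0_less_iff_less not_less_iff_gr_or_eq)
    qed
  next
    assume "same_mod_1 u r"
    then show "ne_strand D v u" unfolding ne_strand_def using rl same_mod_1_curve[OF D] by metis
  qed
  have nw: "nw_strand D v u \<longleftrightarrow> same_mod_1 u l" for u
  proof
    assume "nw_strand D v u"
    then obtain k where k: "curve D u = v" "curve D k = v" "det2 (vel D k) (vel D u) > 0"
      unfolding nw_strand_def by auto
    show "same_mod_1 u l"
    proof (rule ccontr)
      assume "\<not> same_mod_1 u l"
      then have "same_mod_1 u r" using two k by blast
      moreover have "same_mod_1 k r \<or> same_mod_1 k l" using two k by blast
      ultimately show False using k(3) rl(3) same_mod_1_curve(2)[OF D] det2_antisym[of "vel D l" "vel D r"]
        by (metis det2_self less_irrefl neg_0_less_iff_less not_less_iff_gr_or_eq)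
    qed
  next
    assume "same_mod_1 u l"
    then show "nw_strand D v u" unfolding nw_strand_def using rl same_mod_1_curve[OF D] by metis
  qed
  have r: "same_mod_1 (ne_param D v) r"
    unfolding ne_param_def using unique_lift(1)[of "ne_strand D v" r] ne by blast
  have l: "same_mod_1 (nw_param D v) l"
    unfolding nw_param_def using unique_lift(1)[of "nw_strand D v" l] nw by blast
  show "0 \<le> ne_param D v" "ne_param D v < 1" unfolding ne_param_def by (rule unique_lift; rule ne)+
  show "0 \<le> nw_param D v" "nw_param D v < 1" unfolding nw_param_def by (rule unique_lift; rule nw)+
  have eq: "same_mod_1 u r \<longleftrightarrow> same_mod_1 u (ne_param D v)" "same_mod_1 u l \<longleftrightarrow> same_mod_1 u (nw_param D v)" for u
    using r l same_mod_1_sym same_mod_1_trans by blast+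
  show "ne_strand D v u \<longleftrightarrow> same_mod_1 u (ne_param D v)" using ne eq by simp
  show "nw_strand D v u \<longleftrightarrow> same_mod_1 u (nw_param D v)" using nw eq by simp
  show "curve D u = v \<longleftrightarrow> same_mod_1 u (ne_param D v) \<or> same_mod_1 u (nw_param D v)" using cu eq by simp
  show "\<not> same_mod_1 (ne_param D v) (nw_param D v)"
    using rl(4) r l same_mod_1_sym same_mod_1_trans by blast
  show "det2 (vel D (ne_param D v)) (vel D (nw_param D v)) > 0"
    using rl(3) same_mod_1_curve(2)[OF D r] same_mod_1_curve(2)[OF D l] by simp
  show "ne_param D v \<in> over D \<longleftrightarrow> nw_param D v \<notin> over D"
    using rl(5) same_mod_1_curve(3)[OF D r] same_mod_1_curve(3)[OF D l] by simp
qed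

lemma curve_params:
  assumes "virtual_diagram D" "v \<in> classical D"
  shows "curve D (ne_param D v) = v" "curve D (nw_param D v) = v"
  using curve_eq_iff[OF assms] by auto

text \<open>This is how the roles of the strands at a crossing are determined in all that follows.\<close>

lemma params_eqI:
  assumes D: "virtual_diagram D" and v: "v \<in> classical D"
    and st: "curve D s = v" "curve D t = v" "det2 (vel D s) (vel D t) > 0"
  shows "same_mod_1 (ne_param D v) s" "same_mod_1 (nw_param D v) t"
proof -
  have "ne_strand D v s" "nw_strand D v t" unfolding ne_strand_def nw_strand_def using st by auto
  then show "same_mod_1 (ne_param D v) s" "same_mod_1 (nw_param D v) t"
    using ne_strand_iff[OF D v] nw_strand_iff[OF D v] same_mod_1_sym by blast+
qed

lemma same_mod_1_eq:
  assumes "same_mod_1 s t" "0 \<le> s" "s < 1" "0 \<le> t" "t < 1"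
  shows "s = t"
proof -
  obtain k :: int where "s = t + k" using assms(1) unfolding same_mod_1_def by blast
  then have "real_of_int k < 1" "- 1 < real_of_int k" using assms by linarith+
  then have "k = 0" by linarith
  then show ?thesis using \<open>s = t + k\<close> by simp
qed

lemma writhe_iff:
  assumes D: "virtual_diagram D" and v: "v \<in> classical D"
  shows "writhe D v = (if ne_param D v \<in> over D then 1 else - 1)"
proof -
  have "(\<exists>s t. s \<in> over D \<and> t \<notin> over D \<and> curve D s = v \<and> curve D t = v \<and> det2 (vel D s) (vel D t) > 0) \<longleftrightarrow>
      ne_param D v \<in> over D" (is "?L \<longleftrightarrow> ?R")
  proof
    assume ?L
    then obtain s t where st: "s \<in> over D" "curve D s = v" "curve D t = v" "det2 (vel D s) (vel D t) > 0" by blast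
    show ?R using params_eqI(1)[OF D v st(2-4)] st(1) same_mod_1_curve(3)[OF D] by blast
  next
    assume ?R
    then show ?L using over_params[OF D v] det2_params[OF D v] curve_params[OF D v] by blast
  qed
  then show ?thesis unfolding writhe_def by simp
qed

lemma classical_double_points:
  assumes "virtual_diagram D"
  shows "classical D \<subseteq> double_points D"
  unfolding classical_def double_points_def using over_double[OF assms] by blast

lemma finite_classical:
  assumes "virtual_diagram D"
  shows "finite (classical D)"
  using classical_double_points[OF assms] finite_double_points[OF assms] finite_subset by blast

lemma params_of_distinct:
  assumes D: "virtual_diagram D" and v: "v \<in> classical D" "w \<in> classical D"
  shows "same_mod_1 (ne_param D w) (ne_param D v) \<longleftrightarrow> w = v"
    "same_mod_1 (nw_param D w) (nw_param D v) \<longleftrightarrow> w = v"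
    "\<not> same_mod_1 (ne_param D w) (nw_param D v)"
    "\<not> same_mod_1 (nw_param D w) (ne_param D v)"
proof -
  note c = curve_params[OF D v(1)] curve_params[OF D v(2)]
  show "same_mod_1 (ne_param D w) (ne_param D v) \<longleftrightarrow> w = v" "same_mod_1 (nw_param D w) (nw_param D v) \<longleftrightarrow> w = v"
    using same_mod_1_curve(1)[OF D] c by fastforce+
  show "\<not> same_mod_1 (ne_param D w) (nw_param D v)" "\<not> same_mod_1 (nw_param D w) (ne_param D v)"
    using same_mod_1_curve(1)[OF D] c params_distinct[OF D v(1)] same_mod_1_sym by metis+
qed

section \<open>Arcs, halves and intersection numbers\<close>

definition gauss :: "vdiagram \<Rightarrow> complex chord_diagram" where
  "gauss D = \<lparr>chords = classical D, lpar = nw_param D, rpar = ne_param D, pos = (\<lambda>v. writhe D v = 1)\<rparr>"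

lemma gauss_simps [simp]:
  "chords (gauss D) = classical D" "lpar (gauss D) = nw_param D" "rpar (gauss D) = ne_param D"
  "pos (gauss D) v \<longleftrightarrow> writhe D v = 1"
  unfolding gauss_def by simp_all

abbreviation lk :: "vdiagram \<Rightarrow> complex \<Rightarrow> complex \<Rightarrow> int" where
  "lk D \<equiv> linking (gauss D)"

abbreviation total_lk :: "vdiagram \<Rightarrow> complex \<Rightarrow> int" where
  "total_lk D \<equiv> total_linking (gauss D)"

abbreviation signed_half :: "vdiagram \<Rightarrow> complex \<Rightarrow> real set \<Rightarrow> int" where
  "signed_half D v a \<equiv> writhe D v * minus_half D v a"

text \<open>The lifts will be chosen in the strand that contains the crossing.\<close>

lemma choose_lifts:
  assumes l: "\<And>w. same_mod_1 (l w) (nw_param D w)" and r: "\<And>w. same_mod_1 (r w) (ne_param D w)"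
  defines "G \<equiv> (gauss D)\<lparr>lpar := l, rpar := r\<rparr>"
  shows "u \<in> classical D \<Longrightarrow> v \<in> classical D \<Longrightarrow> lk D u v = linking G u v"
    and "v \<in> classical D \<Longrightarrow> total_lk D v = total_linking G v"
    and "after (gauss D) v t = after G v t"
proof -
  show "lk D u v = linking G u v" if "u \<in> classical D" "v \<in> classical D"
    using pairing_shift(1)[of G "gauss D" v u] that l r by (simp add: G_def)
  show "total_lk D v = total_linking G v" if "v \<in> classical D"
    using pairing_shift(2)[of G "gauss D" v] that l r by (simp add: G_def)
  obtain i j :: int where "r v = ne_param D v + i" "l v = nw_param D v + j"
    using l[of v] r[of v] unfolding same_mod_1_def by blast
  then show "after (gauss D) v t = after G v t"
    using half_after_shift[of "l v" _ j "r v" _ i t t 0] by (simp add: G_def)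
qed

lemma eventually_floor_at_left:
  fixes r t :: real
  shows "\<forall>\<^sub>F u in at_left t. \<lfloor>u - r\<rfloor> = \<lceil>t - r\<rceil> - 1 \<and> \<lceil>u - r\<rceil> = \<lceil>t - r\<rceil>"
proof -
  have "r + (\<lceil>t - r\<rceil> - 1) < t" using ceiling_correct[of "t - r"] by linarith
  from eventually_at_left_real[OF this] show ?thesis
  proof eventually_elim
    case (elim u)
    moreover have "t \<le> r + \<lceil>t - r\<rceil>" using ceiling_correct[of "t - r"] by linarith
    ultimately show ?case by (auto simp: floor_eq_iff ceiling_eq_iff)
  qed
qed

lemma eventually_floor_at_right:
  fixes r t :: real
  shows "\<forall>\<^sub>F u in at_right t. \<lfloor>u - r\<rfloor> = \<lfloor>t - r\<rfloor> \<and> \<lceil>u - r\<rceil> = \<lfloor>t - r\<rfloor> + 1"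
proof -
  have "t < r + (\<lfloor>t - r\<rfloor> + 1)" using floor_correct[of "t - r"] by linarith
  from eventually_at_right_real[OF this] show ?thesis
  proof eventually_elim
    case (elim u)
    moreover have "r + \<lfloor>t - r\<rfloor> \<le> t" using floor_correct[of "t - r"] by linarith
    ultimately show ?case by (auto simp: floor_eq_iff ceiling_eq_iff)
  qed
qed

lemma not_same_mod_1_iff: "\<not> same_mod_1 u r \<longleftrightarrow> \<lceil>u - r\<rceil> = \<lfloor>u - r\<rfloor> + 1"
  unfolding same_mod_1_Ints ceiling_floor_Ints by auto

lemma eventually_not_same_mod_1:
  "\<forall>\<^sub>F u in at_left t. \<not> same_mod_1 u r" "\<forall>\<^sub>F u in at_right t. \<not> same_mod_1 u r"
  unfolding not_same_mod_1_iff
  using eventually_floor_at_left[of r t] eventually_floor_at_right[of r t] by (auto elim: eventually_mono)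

lemma eventually_not_classical:
  assumes D: "virtual_diagram D"
  shows "\<forall>\<^sub>F u in at_left t. curve D u \<notin> classical D" "\<forall>\<^sub>F u in at_right t. curve D u \<notin> classical D"
proof -
  have *: "curve D u \<notin> classical D" if "\<forall>v\<in>classical D. \<not> same_mod_1 u (ne_param D v) \<and> \<not> same_mod_1 u (nw_param D v)" for u
    using that curve_eq_iff[OF D] by blast
  have "\<forall>\<^sub>F u in at_left t. \<forall>v\<in>classical D. \<not> same_mod_1 u (ne_param D v) \<and> \<not> same_mod_1 u (nw_param D v)"
    by (intro eventually_ball_finite finite_classical[OF D] ballI eventually_conj eventually_not_same_mod_1)
  then show "\<forall>\<^sub>F u in at_left t. curve D u \<notin> classical D" by (rule eventually_mono) (rule *)
  have "\<forall>\<^sub>F u in at_right t. \<forall>v\<in>classical D. \<not> same_mod_1 u (ne_param D v) \<and> \<not> same_mod_1 u (nw_param D v)"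
    by (intro eventually_ball_finite finite_classical[OF D] ballI eventually_conj eventually_not_same_mod_1)
  then show "\<forall>\<^sub>F u in at_right t. curve D u \<notin> classical D" by (rule eventually_mono) (rule *)
qed

definition joined :: "vdiagram \<Rightarrow> real \<Rightarrow> real \<Rightarrow> bool" where
  "joined D s t \<longleftrightarrow> (\<forall>u\<in>closed_segment s t. curve D u \<notin> classical D)"

lemma closed_segment_shift: "closed_segment (s + k) (t + k) = (\<lambda>u. u + k) ` closed_segment s t" for k :: real
  using closed_segment_translation_eq[of k] by (auto simp: closed_segment_eq_real_ivl image_iff) 

lemma joined_shift:
  assumes "virtual_diagram D"
  shows "joined D (s + of_int k) (t + of_int k) \<longleftrightarrow> joined D s t"
  unfolding joined_def closed_segment_shift using curve_shift[OF assms] by auto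

lemma joined_trans: "joined D s t \<Longrightarrow> joined D t u \<Longrightarrow> joined D s u"
  unfolding joined_def closed_segment_eq_real_ivl by (auto split: if_splits)

lemma joined_sym: "joined D s t \<Longrightarrow> joined D t s"
  unfolding joined_def by (simp add: closed_segment_commute)

lemma arc_of_iff: "s \<in> arc_of D t \<longleftrightarrow> (\<exists>k::int. joined D s (t + of_int k))"
  unfolding arc_of_def joined_def by simp

lemma arc_of_sym:
  assumes D: "virtual_diagram D" and "s \<in> arc_of D t"
  shows "t \<in> arc_of D s"
proof -
  obtain k :: int where "joined D s (t + of_int k)" using assms(2) arc_of_iff by auto
  then have "joined D t (s + of_int (- k))"
    using joined_sym joined_shift[OF D, of "t + of_int k" "- k" s] by simp
  then show ?thesis unfolding arc_of_iff by blast
qed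

lemma arc_of_trans:
  assumes D: "virtual_diagram D" and "s \<in> arc_of D t" "t \<in> arc_of D u"
  shows "s \<in> arc_of D u"
proof -
  obtain k j :: int where "joined D s (t + of_int k)" "joined D t (u + of_int j)" using assms arc_of_iff by metis
  then have "joined D s (u + of_int j + of_int k)"
    using joined_trans joined_shift[OF D, of t k "u + of_int j"] by blast
  then have "joined D s (u + of_int (j + k))" by (simp add: add.assoc)
  then show ?thesis unfolding arc_of_iff by blast
qed

lemma arcs_arc_of:
  assumes D: "virtual_diagram D" and "a \<in> arcs D" "t \<in> a"
  shows "a = arc_of D t" "curve D t \<notin> classical D"
proof -
  obtain s where s: "a = arc_of D s" using assms unfolding arcs_def by auto
  show "a = arc_of D t" using assms s arc_of_sym[OF D] arc_of_trans[OF D] by blast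
  show "curve D t \<notin> classical D" using assms(3) unfolding s arc_of_iff joined_def by auto
qed

lemma unique_arc:
  assumes D: "virtual_diagram D" and F: "F \<noteq> bot" and a: "a \<in> arcs D" "\<forall>\<^sub>F s in F. s \<in> a"
  shows "(THE a. a \<in> arcs D \<and> (\<forall>\<^sub>F s in F. s \<in> a)) = a"
proof (rule the_equality)
  show "a \<in> arcs D \<and> (\<forall>\<^sub>F s in F. s \<in> a)" using a by simp
  fix b assume b: "b \<in> arcs D \<and> (\<forall>\<^sub>F s in F. s \<in> b)"
  then have "\<forall>\<^sub>F s in F. s \<in> a \<and> s \<in> b" using a by (auto intro: eventually_conj)
  then obtain s where "s \<in> a" "s \<in> b" using eventually_happens'[OF F] by blast
  then show "b = a" using arcs_arc_of(1)[OF D] a b by blast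
qed

lemma interval_arc:
  assumes m: "b < m" "m < c" and free: "\<And>u. b < u \<Longrightarrow> u < c \<Longrightarrow> curve D u \<notin> classical D"
  shows "arc_of D m \<in> arcs D" "b < s \<Longrightarrow> s < c \<Longrightarrow> s \<in> arc_of D m"
proof -
  show "arc_of D m \<in> arcs D" unfolding arcs_def using free m by auto
  show "s \<in> arc_of D m" if "b < s" "s < c"
    unfolding arc_of_iff joined_def using that m free
    by (intro exI[of _ 0]) (auto simp: closed_segment_eq_real_ivl split: if_splits)
qed

lemma in_arc:
  assumes D: "virtual_diagram D"
  shows "in_arc D t \<in> arcs D" "\<forall>\<^sub>F s in at_left t. s \<in> in_arc D t"
proof -
  obtain b where b: "b < t" "\<And>u. b < u \<Longrightarrow> u < t \<Longrightarrow> curve D u \<notin> classical D"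
    using eventually_not_classical(1)[OF D, of t] unfolding eventually_at_left_field by blast
  obtain m where m: "b < m" "m < t" using dense[OF b(1)] by blast
  note a = interval_arc[OF m b(2)]
  have ev: "\<forall>\<^sub>F s in at_left t. s \<in> arc_of D m"
    unfolding eventually_at_left_field using b(1) a(2) by blast
  have "in_arc D t = arc_of D m" unfolding in_arc_def by (rule unique_arc[OF D _ a(1) ev]) simp
  then show "in_arc D t \<in> arcs D" "\<forall>\<^sub>F s in at_left t. s \<in> in_arc D t" using a(1) ev by auto
qed

lemma out_arc:
  assumes D: "virtual_diagram D"
  shows "out_arc D t \<in> arcs D" "\<forall>\<^sub>F s in at_right t. s \<in> out_arc D t"
proof -
  obtain b where b: "t < b" "\<And>u. t < u \<Longrightarrow> u < b \<Longrightarrow> curve D u \<notin> classical D"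
    using eventually_not_classical(2)[OF D, of t] unfolding eventually_at_right_field by blast
  obtain m where m: "t < m" "m < b" using dense[OF b(1)] by blast
  note a = interval_arc[OF m b(2)]
  have ev: "\<forall>\<^sub>F s in at_right t. s \<in> arc_of D m"
    unfolding eventually_at_right_field using b(1) a(2) by blast
  have "out_arc D t = arc_of D m" unfolding out_arc_def by (rule unique_arc[OF D _ a(1) ev]) simp
  then show "out_arc D t \<in> arcs D" "\<forall>\<^sub>F s in at_right t. s \<in> out_arc D t" using a(1) ev by auto
qed

text \<open>A floor function is constant on a segment that avoids its jumps. Therefore the halves of a crossing,
  which are functions of the parameter, are constant on every arc.\<close>

lemma floor_segment:
  fixes s t r :: real
  assumes "\<And>u k. u \<in> closed_segment s t \<Longrightarrow> u \<noteq> r + of_int k"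
  shows "\<lfloor>s - r\<rfloor> = \<lfloor>t - r\<rfloor>"
proof -
  have le: "\<lfloor>t - r\<rfloor> \<le> \<lfloor>s - r\<rfloor>" if "s \<le> t" "\<And>u k. u \<in> closed_segment s t \<Longrightarrow> u \<noteq> r + of_int k" for s t :: real
  proof (rule ccontr)
    assume "\<not> \<lfloor>t - r\<rfloor> \<le> \<lfloor>s - r\<rfloor>"
    then have "s - r < \<lfloor>t - r\<rfloor>" by (simp add: floor_less_iff not_le)
    then have "r + \<lfloor>t - r\<rfloor> \<in> closed_segment s t"
      using that(1) of_int_floor_le[of "t - r"] unfolding closed_segment_eq_real_ivl by (auto simp: algebra_simps)
    then show False using that(2) by blast
  qed
  have mono: "\<lfloor>s - r\<rfloor> \<le> \<lfloor>t - r\<rfloor>" if "s \<le> t" for s t :: real using that by (simp add: floor_mono)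
  show ?thesis
  proof (cases "s \<le> t")
    case True
    then show ?thesis using le[OF True] mono[OF True] assms by fastforce
  next
    case False
    then show ?thesis using le[of t s] mono[of t s] assms by (fastforce simp: closed_segment_commute)
  qed
qed

lemma path_ind_arc:
  assumes D: "virtual_diagram D" and v: "v \<in> classical D" and s: "s \<in> arc_of D t"
  shows "path_ind (nw_param D v) (ne_param D v) s = path_ind (nw_param D v) (ne_param D v) t"
    and "path_ind (ne_param D v) (nw_param D v) s = path_ind (ne_param D v) (nw_param D v) t"
proof -
  obtain k :: int where k: "joined D s (t + of_int k)" using s arc_of_iff by auto
  have nin: "\<not> same_mod_1 u (ne_param D v)" "\<not> same_mod_1 u (nw_param D v)" if "u \<in> closed_segment s (t + of_int k)" for u
    using k that curve_eq_iff[OF D v, of u] v unfolding joined_def by auto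
  have fl: "\<lfloor>s - ne_param D v\<rfloor> = \<lfloor>t + of_int k - ne_param D v\<rfloor>" "\<lfloor>s - nw_param D v\<rfloor> = \<lfloor>t + of_int k - nw_param D v\<rfloor>"
    using nin unfolding same_mod_1_def by (intro floor_segment; blast)+
  have ce: "\<lceil>s - ne_param D v\<rceil> = \<lceil>t + of_int k - ne_param D v\<rceil>" "\<lceil>s - nw_param D v\<rceil> = \<lceil>t + of_int k - nw_param D v\<rceil>"
    using nin[of s] nin[of "t + of_int k"] fl unfolding not_same_mod_1_iff by simp_all
  have "path_ind (nw_param D v) (ne_param D v) s = path_ind (nw_param D v) (ne_param D v) (t + of_int k)"
    "path_ind (ne_param D v) (nw_param D v) s = path_ind (ne_param D v) (nw_param D v) (t + of_int k)"
    unfolding path_ind_def using fl ce by simp_all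
  moreover have "path_ind (nw_param D v) (ne_param D v) (t + of_int k) = path_ind (nw_param D v) (ne_param D v) t"
    "path_ind (ne_param D v) (nw_param D v) (t + of_int k) = path_ind (ne_param D v) (nw_param D v) t"
    by (rule path_ind_shift[of _ _ 0 _ _ 0]; simp)+
  ultimately show "path_ind (nw_param D v) (ne_param D v) s = path_ind (nw_param D v) (ne_param D v) t"
    "path_ind (ne_param D v) (nw_param D v) s = path_ind (ne_param D v) (nw_param D v) t" by simp_all
qed

lemma path_ind_01:
  assumes "\<not> same_mod_1 t r"
  shows "path_ind l r t = 0 \<or> path_ind l r t = 1"
proof -
  have "\<lceil>t - r\<rceil> = \<lfloor>t - r\<rfloor> + 1" using assms not_same_mod_1_iff by simp
  moreover have "\<lfloor>t - l\<rfloor> - \<lfloor>t - r\<rfloor> - \<lfloor>r - l\<rfloor> = 0 \<or> \<lfloor>t - l\<rfloor> - \<lfloor>t - r\<rfloor> - \<lfloor>r - l\<rfloor> = 1"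
    by linarith
  ultimately show ?thesis unfolding path_ind_def by linarith
qed

lemma cyclic_interval_iff:
  assumes "\<not> same_mod_1 t l" "\<not> same_mod_1 t r"
  shows "(\<exists>l' r'. same_mod_1 l' l \<and> same_mod_1 r' r \<and> l' < t \<and> t < r' \<and> r' < l' + 1) \<longleftrightarrow> path_ind l r t = 1"
proof
  assume "\<exists>l' r'. same_mod_1 l' l \<and> same_mod_1 r' r \<and> l' < t \<and> t < r' \<and> r' < l' + 1"
  then obtain l' r' where lr: "same_mod_1 l' l" "same_mod_1 r' r" and o: "l' < t" "t < r'" "r' < l' + 1" by blast
  obtain i j :: int where ij: "l' = l + i" "r' = r + j" using lr unfolding same_mod_1_def by blast
  have "path_ind l r t = path_ind l' r' t"
    using path_ind_shift[OF ij, of t t 0] by simp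
  moreover have "\<lfloor>t - l'\<rfloor> = 0" "\<lceil>t - r'\<rceil> = 0" "\<lfloor>r' - l'\<rfloor> = 0"
    using o by (simp_all add: floor_eq_iff ceiling_eq_iff)
  ultimately show "path_ind l r t = 1" unfolding path_ind_def by simp
next
  assume p: "path_ind l r t = 1"
  \<comment> \<open>the last lift of \<open>l\<close> before \<open>t\<close> and the first lift of \<open>r\<close> after it\<close>
  define l' where "l' = l + of_int \<lfloor>t - l\<rfloor>"
  define r' where "r' = r + of_int \<lceil>t - r\<rceil>"
  have sm: "same_mod_1 l' l" "same_mod_1 r' r" unfolding l'_def r'_def same_mod_1_def by auto
  have "\<not> same_mod_1 t l'" "\<not> same_mod_1 t r'" using sm assms same_mod_1_trans by blast+
  then have "t \<noteq> l'" "t \<noteq> r'" by auto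
  moreover have "l' \<le> t" "t \<le> r'" unfolding l'_def r'_def
    using of_int_floor_le[of "t - l"] le_of_int_ceiling[of "t - r"] by linarith+
  moreover have "r' < l' + 1"
  proof -
    have "\<lfloor>r - l\<rfloor> = \<lfloor>t - l\<rfloor> - \<lceil>t - r\<rceil>" using p unfolding path_ind_def by simp
    then have "r - l < of_int \<lfloor>t - l\<rfloor> - of_int \<lceil>t - r\<rceil> + 1"
      using floor_correct[of "r - l"] by simp
    then show ?thesis unfolding l'_def r'_def by simp
  qed
  ultimately show "\<exists>l' r'. same_mod_1 l' l \<and> same_mod_1 r' r \<and> l' < t \<and> t < r' \<and> r' < l' + 1"
    using sm by (intro exI[of _ l'] exI[of _ r']) auto
qed

text \<open>An arc is either contained in a half or disjoint from it, so that one point of the arc decides.\<close>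

lemma half_values:
  assumes D: "virtual_diagram D" and v: "v \<in> classical D" and a: "a \<in> arcs D" "t \<in> a"
  shows "left_half D v a = path_ind (nw_param D v) (ne_param D v) t"
    and "right_half D v a = path_ind (ne_param D v) (nw_param D v) t"
proof -
  have nin: "\<not> same_mod_1 u (ne_param D v)" "\<not> same_mod_1 u (nw_param D v)" if "u \<in> a" for u
    using arcs_arc_of(2)[OF D a(1) that] curve_eq_iff[OF D v, of u] v by auto
  have L: "u \<in> left_half_params D v \<longleftrightarrow> path_ind (nw_param D v) (ne_param D v) t = 1" if "u \<in> a" for u
    unfolding left_half_params_def mem_Collect_eq ne_strand_iff[OF D v] nw_strand_iff[OF D v]
    using cyclic_interval_iff[OF nin(2) nin(1), OF that that]
      path_ind_arc(1)[OF D v, of u t] arcs_arc_of(1)[OF D a] that by simp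
  have R: "u \<in> right_half_params D v \<longleftrightarrow> path_ind (ne_param D v) (nw_param D v) t = 1" if "u \<in> a" for u
  proof -
    have "u \<in> right_half_params D v \<longleftrightarrow>
      (\<exists>r l. same_mod_1 r (ne_param D v) \<and> same_mod_1 l (nw_param D v) \<and> r < u \<and> u < l \<and> l < r + 1)"
      unfolding right_half_params_def mem_Collect_eq ne_strand_iff[OF D v] nw_strand_iff[OF D v] by blast
    then show ?thesis
    using cyclic_interval_iff[OF nin(1) nin(2), OF that that]
      path_ind_arc(2)[OF D v, of u t] arcs_arc_of(1)[OF D a] that by simp
  qed
  show "left_half D v a = path_ind (nw_param D v) (ne_param D v) t"
    unfolding left_half_def subset_iff using L a(2) path_ind_01[OF nin(1)[OF a(2)]] by auto
  show "right_half D v a = path_ind (ne_param D v) (nw_param D v) t"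
    unfolding right_half_def subset_iff using R a(2) path_ind_01[OF nin(2)[OF a(2)]] by auto
qed

lemma signed_half:
  assumes D: "virtual_diagram D" and v: "v \<in> classical D" and a: "a \<in> arcs D" "t \<in> a"
  shows "signed_half D v a = after (gauss D) v t"
proof -
  have nin: "\<not> same_mod_1 t (ne_param D v)" "\<not> same_mod_1 t (nw_param D v)"
    using arcs_arc_of(2)[OF D a] curve_eq_iff[OF D v, of t] v by auto
  have dist: "\<not> same_mod_1 (nw_param D v) (ne_param D v)" using params_distinct[OF D v] same_mod_1_sym by blast
  note ce = nin[unfolded not_same_mod_1_iff] dist[unfolded not_same_mod_1_iff]
  have w: "writhe D v = 1 \<or> writhe D v = -1" unfolding writhe_def by auto
  have fl: "\<lfloor>ne_param D v - nw_param D v\<rfloor> = - \<lfloor>nw_param D v - ne_param D v\<rfloor> - 1"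
    using ce(3) floor_minus_swap[of "ne_param D v" "nw_param D v"] by simp
  show ?thesis
    using w half_values[OF D v a] ce fl
    unfolding minus_half_def half_after_def half_const_def path_ind_def by auto
qed

text \<open>The arcs that enter and leave a crossing see the one-sided limits, also at the crossing \<open>v\<close> itself.\<close>

lemma signed_half_in_out:
  assumes D: "virtual_diagram D" and v: "v \<in> classical D"
  shows "signed_half D v (in_arc D t) = before (gauss D) v t"
    and "signed_half D v (out_arc D t) = after (gauss D) v t"
proof -
  have ev: "\<forall>\<^sub>F u in at_left t. u \<in> in_arc D t \<and> after (gauss D) v u = before (gauss D) v t"
    using in_arc(2)[OF D, of t] eventually_floor_at_left[of "ne_param D v" t] eventually_floor_at_left[of "nw_param D v" t]
    by eventually_elim (simp add: half_after_def half_before_def)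
  then obtain u where u: "u \<in> in_arc D t" "after (gauss D) v u = before (gauss D) v t"
    using eventually_happens'[OF trivial_limit_at_left_real ev] by blast
  show "signed_half D v (in_arc D t) = before (gauss D) v t"
    using signed_half[OF D v in_arc(1)[OF D] u(1)] u(2) by simp
  have ev: "\<forall>\<^sub>F u in at_right t. u \<in> out_arc D t \<and> after (gauss D) v u = after (gauss D) v t"
    using out_arc(2)[OF D, of t] eventually_floor_at_right[of "ne_param D v" t] eventually_floor_at_right[of "nw_param D v" t]
    by eventually_elim (simp add: half_after_def)
  then obtain u where u: "u \<in> out_arc D t" "after (gauss D) v u = after (gauss D) v t"
    using eventually_happens'[OF trivial_limit_at_right_real ev] by blast
  show "signed_half D v (out_arc D t) = after (gauss D) v t"
    using signed_half[OF D v out_arc(1)[OF D] u(1)] u(2) by simp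
qed

lemma left_half_in_out:
  assumes D: "virtual_diagram D" and v: "v \<in> classical D"
  shows "left_half D v (in_arc D t) =
      \<lceil>t - nw_param D v\<rceil> - \<lceil>t - ne_param D v\<rceil> - \<lfloor>ne_param D v - nw_param D v\<rfloor>" (is "_ = ?B")
    and "left_half D v (out_arc D t) =
      \<lfloor>t - nw_param D v\<rfloor> - \<lfloor>t - ne_param D v\<rfloor> - \<lfloor>ne_param D v - nw_param D v\<rfloor>" (is "_ = ?A")
proof -
  have ev: "\<forall>\<^sub>F u in at_left t. u \<in> in_arc D t \<and> path_ind (nw_param D v) (ne_param D v) u = ?B"
    using in_arc(2)[OF D, of t] eventually_floor_at_left[of "ne_param D v" t] eventually_floor_at_left[of "nw_param D v" t]
    by eventually_elim (simp add: path_ind_def)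
  then obtain u where u: "u \<in> in_arc D t" "path_ind (nw_param D v) (ne_param D v) u = ?B"
    using eventually_happens'[OF trivial_limit_at_left_real ev] by blast
  show "left_half D v (in_arc D t) = ?B"
    using half_values(1)[OF D v in_arc(1)[OF D] u(1)] u(2) by simp
  have ev: "\<forall>\<^sub>F u in at_right t. u \<in> out_arc D t \<and> path_ind (nw_param D v) (ne_param D v) u = ?A"
    using out_arc(2)[OF D, of t] eventually_floor_at_right[of "ne_param D v" t] eventually_floor_at_right[of "nw_param D v" t]
    by eventually_elim (simp add: path_ind_def)
  then obtain u where u: "u \<in> out_arc D t" "path_ind (nw_param D v) (ne_param D v) u = ?A"
    using eventually_happens'[OF trivial_limit_at_right_real ev] by blast
  show "left_half D v (out_arc D t) = ?A"
    using half_values(1)[OF D v out_arc(1)[OF D] u(1)] u(2) by simp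
qed

theorem intersection_linking:
  assumes D: "virtual_diagram D" and v: "v \<in> classical D" "v' \<in> classical D"
  shows "writhe D v' * intersection_number D (left_half D v) (minus_half D v') = lk D v v'"
proof -
  have "left_half D v (SW D w) * (signed_half D v' (SE D w)) -
      left_half D v (NW D w) * (signed_half D v' (NE D w)) =
      lpath (gauss D) v (ne_param D w) * before (gauss D) v' (nw_param D w) -
      lpath (gauss D) v (nw_param D w) * after (gauss D) v' (ne_param D w)" if w: "w \<in> classical D" for w
  proof -
    note ns = params_of_distinct(3,4)[OF D v(1) w, unfolded not_same_mod_1_iff]
    show ?thesis
      unfolding SW_def SE_def NW_def NE_def signed_half_in_out[OF D v(2)] left_half_in_out[OF D v(1)]
      by (simp add: path_ind_def ns)
  qed
  then show ?thesis
    unfolding intersection_number_def linking_def pairing_def sum_distrib_left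
    by (auto intro!: sum.cong simp: algebra_simps)
qed

text \<open>The index parity is defined with the path of \<open>v\<close> in the first place, whereas \<open>total_linking\<close> has the
  signed half of \<open>v\<close> in the second. The two agree term by term: the half differs from the path by a
  sign and a multiple of the whole circle, and the form is antisymmetric.\<close>

theorem ip_total_linking:
  assumes D: "virtual_diagram D" and v: "v \<in> classical D"
  shows "ip D v = - total_lk D v"
proof -
  have "left_half D v (SW D w) - left_half D v (NW D w) =
      before (gauss D) v (nw_param D w) - after (gauss D) v (ne_param D w)" if w: "w \<in> classical D" for w
  proof -
    note ns = params_of_distinct(3,4)[OF D v w, unfolded not_same_mod_1_iff]
    have "\<lceil>ne_param D w - ne_param D v\<rceil> - \<lfloor>ne_param D w - ne_param D v\<rfloor> =
        \<lceil>nw_param D w - nw_param D v\<rceil> - \<lfloor>nw_param D w - nw_param D v\<rfloor>"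
      using params_of_distinct(1,2)[OF D v w] not_same_mod_1_iff[of "ne_param D w"] not_same_mod_1_iff[of "nw_param D w"]
      by (cases "w = v") auto
    then show ?thesis
      unfolding SW_def NW_def left_half_in_out[OF D v]
      by (simp add: half_before_def half_after_def ns)
  qed
  then show ?thesis
    unfolding ip_def intersection_number_def total_linking_def pairing_def whole_def
    by (auto intro!: sum.cong)
qed

text \<open>At \<open>v\<close> itself the jumps on the two strands are opposite, and elsewhere there are none.\<close>

lemma signed_half_cycle:
  assumes D: "virtual_diagram D" and v: "v \<in> classical D" and w: "w \<in> classical D"
  shows "before (gauss D) v (ne_param D w) + before (gauss D) v (nw_param D w) =
     after (gauss D) v (nw_param D w) + after (gauss D) v (ne_param D w)"
proof -
  note ns = params_of_distinct(3,4)[OF D v w, unfolded not_same_mod_1_iff]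
  have "\<lceil>ne_param D w - ne_param D v\<rceil> - \<lfloor>ne_param D w - ne_param D v\<rfloor> =
      \<lceil>nw_param D w - nw_param D v\<rceil> - \<lfloor>nw_param D w - nw_param D v\<rfloor>"
    using params_of_distinct(1,2)[OF D v w] not_same_mod_1_iff[of "ne_param D w"] not_same_mod_1_iff[of "nw_param D w"]
    by (cases "w = v") auto
  then show ?thesis by (simp add: half_before_def half_after_def ns)
qed

section \<open>Isotopies and detour moves\<close>

text \<open>The outcome of a move that keeps all crossings.\<close>

text \<open>The outcome of isotopies, detour moves and third moves.\<close>

definition keeps_crossings ::
    "vdiagram \<Rightarrow> vdiagram \<Rightarrow> (complex \<Rightarrow> complex) \<Rightarrow> (real set \<times> real set) set \<Rightarrow> bool" where
  "keeps_crossings D D' g c \<longleftrightarrow>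
     bij_betw g (classical D) (classical D') \<and>
     (\<forall>u\<in>classical D. \<forall>v\<in>classical D. lk D' (g u) (g v) = lk D u v) \<and>
     (\<forall>v\<in>classical D. total_lk D' (g v) = total_lk D v) \<and>
     (\<forall>(a, a')\<in>c. \<forall>v\<in>classical D. signed_half D' (g v) a' = signed_half D v a)"

text \<open>The roles of the strands depend on the velocities only, hence on the curve near the two parameters.\<close>

lemma same_crossing:
  assumes D: "virtual_diagram D" and D': "virtual_diagram D'" and v: "v \<in> classical D" "v \<in> classical D'"
    and ne: "\<forall>\<^sub>F u in nhds (ne_param D v). curve D' u = curve D u"
    and nw: "\<forall>\<^sub>F u in nhds (nw_param D v). curve D' u = curve D u"
    and ov: "ne_param D v \<in> over D' \<longleftrightarrow> ne_param D v \<in> over D"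
  shows "ne_param D' v = ne_param D v" "nw_param D' v = nw_param D v" "writhe D' v = writhe D v"
proof -
  have vel: "vel D' (ne_param D v) = vel D (ne_param D v)" "vel D' (nw_param D v) = vel D (nw_param D v)"
    using ne nw by (auto intro!: vel_unique[OF D' has_vel[OF D]] elim: eventually_mono)
  have c: "curve D' (ne_param D v) = v" "curve D' (nw_param D v) = v"
    using eventually_nhds_x_imp_x[OF ne] eventually_nhds_x_imp_x[OF nw] curve_params[OF D v(1)] by auto
  have sm: "same_mod_1 (ne_param D' v) (ne_param D v)" "same_mod_1 (nw_param D' v) (nw_param D v)"
    using params_eqI[OF D' v(2) c] det2_params[OF D v(1)] vel by simp_all
  show ne': "ne_param D' v = ne_param D v" "nw_param D' v = nw_param D v"
    using same_mod_1_eq[OF sm(1)] same_mod_1_eq[OF sm(2)]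
      ne_param_bounds[OF D v(1)] ne_param_bounds[OF D' v(2)] nw_param_bounds[OF D v(1)] nw_param_bounds[OF D' v(2)]
    by auto
  show "writhe D' v = writhe D v" unfolding writhe_iff[OF D v(1)] writhe_iff[OF D' v(2)] ne' using ov by simp
qed

lemma detour_move_keeps:
  assumes D: "virtual_diagram D" and D': "virtual_diagram D'" and m: "detour_move D f c D'"
  shows "keeps_crossings D D' id c" "f = {(v, id v) | v. v \<in> classical D}"
proof -
  obtain \<alpha> \<beta> where ab: "\<alpha> < \<beta>" "\<beta> < \<alpha> + 1" and ov: "over D' = over D"
    and out: "\<And>t. off \<alpha> \<beta> t \<Longrightarrow> curve D' t = curve D t"
    and inn: "\<And>t. t \<in> {\<alpha>..\<beta>} \<Longrightarrow> curve D t \<notin> classical D \<and> curve D' t \<notin> classical D'"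
    and f: "f = Id_on (classical D)" and c: "c = Id_on (arcs D)"
    using m unfolding detour_move_def off_def by blast
  have offX: "off \<alpha> \<beta> t" if "curve D t \<in> classical D" for t
    using that inn curve_shift[OF D] unfolding off_def by metis
  have offX': "off \<alpha> \<beta> t" if "curve D' t \<in> classical D'" for t
    using that inn curve_shift[OF D'] unfolding off_def by metis
  have cl: "classical D' = classical D"
  proof -
    have "curve D' t = curve D t" if "t \<in> over D" for t
      using that offX[of t] out unfolding classical_def by blast
    then show ?thesis unfolding classical_def ov by simp
  qed
  have near: "\<forall>\<^sub>F u in nhds t. curve D' u = curve D u" if t: "curve D t \<in> classical D" for t
  proof -
    have o: "off \<alpha> \<beta> t" by (rule offX[OF t])
    show ?thesis by (rule eventually_mono[OF eventually_off[OF o less_imp_le[OF ab(1)]] out])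
  qed
  have same: "ne_param D' v = ne_param D v" "nw_param D' v = nw_param D v" "writhe D' v = writhe D v"
    if v: "v \<in> classical D" for v
    using same_crossing[OF D D' v _ near near] v cl ov curve_params[OF D v] by auto
  have half: "minus_half D' v = minus_half D v" if v: "v \<in> classical D" for v
  proof -
    have v': "v \<in> classical D'" using v cl by simp
    have "nw_strand D' v = nw_strand D v" "ne_strand D' v = ne_strand D v"
      using nw_strand_iff[OF D v] nw_strand_iff[OF D' v'] ne_strand_iff[OF D v] ne_strand_iff[OF D' v'] same[OF v]
      by auto
    then show ?thesis
      unfolding minus_half_def same[OF v] left_half_def[abs_def] right_half_def[abs_def]
        left_half_params_def right_half_params_def by simp
  qed
  have G: "lk D' u v = lk D u v" "total_lk D' v = total_lk D v"
    if "u \<in> classical D" "v \<in> classical D" for u v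
    using that same by (intro pairing_shift; simp add: cl)+
  show "keeps_crossings D D' id c"
    unfolding keeps_crossings_def using G half same cl by (auto simp: c)
  show "f = {(v, id v) | v. v \<in> classical D}" unfolding f by auto
qed

locale orientation_preserving =
  fixes h :: "complex \<Rightarrow> complex" and h' :: "complex \<Rightarrow> complex \<Rightarrow> complex"
  assumes inj_h: "inj h"
    and deriv: "\<And>z. (h has_derivative h' z) (at z)"
    and orient: "\<And>z u w. sgn (det2 (h' z u) (h' z w)) = sgn (det2 u w)"
    and cont': "\<And>w. continuous_on UNIV (\<lambda>z. h' z w)"

lemma linear_complex_expand:
  assumes "linear (L :: complex \<Rightarrow> complex)"
  shows "L u = Re u *\<^sub>R L 1 + Im u *\<^sub>R L \<i>"
proof -
  have "u = Re u *\<^sub>R 1 + Im u *\<^sub>R \<i>" by (simp add: complex_eq_iff)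
  then have "L u = L (Re u *\<^sub>R 1 + Im u *\<^sub>R \<i>)" by simp
  then show ?thesis using assms by (simp add: linear_add linear_scale)
qed

lemma det2_linear:
  assumes "linear (L :: complex \<Rightarrow> complex)"
  shows "det2 (L u) (L w) = det2 (L 1) (L \<i>) * det2 u w"
  unfolding linear_complex_expand[OF assms, of u] linear_complex_expand[OF assms, of w] det2_def
  by (simp add: algebra_simps)

text \<open>The determinant of the derivative never vanishes during the isotopy, and it is positive at the start.\<close>

lemma plane_isotopic_orientation:
  assumes "plane_isotopic h"
  obtains h' where "orientation_preserving h h'"
proof -
  obtain H H' where H: "H 0 = id" "H 1 = h"
    and d: "\<And>t z. t \<in> {0..1::real} \<Longrightarrow> bij (H t) \<and> (H t has_derivative H' t z) (at z) \<and> bij (H' t z)"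
    and c: "\<And>w. continuous_on ({0..1} \<times> UNIV) (\<lambda>(t, z). H' t z w)"
    using assms unfolding plane_isotopic_def by blast
  have lin: "linear (H' t z)" if "t \<in> {0..1}" for t z
    using d[OF that] has_derivative_linear by blast
  have pos: "det2 (H' 1 z 1) (H' 1 z \<i>) > 0" for z
  proof -
    define \<delta> where "\<delta> t = det2 (H' t z 1) (H' t z \<i>)" for t
    have "continuous_on {0..1} (\<lambda>t. H' t z w)" for w
      by (rule continuous_on_compose2[OF c, of "{0..1}" "\<lambda>t. (t, z)", simplified])
        (auto intro!: continuous_intros)
    then have cont: "continuous_on {0..1} \<delta>" unfolding \<delta>_def det2_def by (intro continuous_intros)
    \<comment> \<open>a vanishing determinant would contradict the surjectivity of the derivative\<close>
    have nz: "\<delta> t \<noteq> 0" if t: "t \<in> {0..1}" for t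
    proof
      assume "\<delta> t = 0"
      then have z0: "det2 (H' t z u) (H' t z w) = 0" for u w
        using det2_linear[OF lin[OF t], of z u w] unfolding \<delta>_def by simp
      have "surj (H' t z)" using d[OF t] bij_is_surj by blast
      then obtain u w where "H' t z u = 1" "H' t z w = \<i>" by (metis surjD)
      then show False using z0[of u w] by (simp add: det2_def)
    qed
    have "(id has_derivative H' 0 z) (at z)" using d[of 0 z] H by simp
    then have "H' 0 z = id" using has_derivative_unique has_derivative_id by blast
    then have "\<delta> 0 > 0" unfolding \<delta>_def det2_def by simp
    moreover have False if "\<delta> 1 \<le> 0"
      using IVT2'[of \<delta> 1 0 0] that \<open>\<delta> 0 > 0\<close> cont nz by force
    ultimately show ?thesis unfolding \<delta>_def by force
  qed
  have "orientation_preserving h (H' 1)"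
  proof
    show "inj h" using d[of 1] H bij_is_inj by auto
    show "(h has_derivative H' 1 z) (at z)" for z using d[of 1 z] H by auto
    show "sgn (det2 (H' 1 z u) (H' 1 z w)) = sgn (det2 u w)" for z u w
      using det2_linear[OF lin[of 1], of z u w] pos[of z] by (simp add: sgn_mult)
    show "continuous_on UNIV (\<lambda>z. H' 1 z w)" for w
      by (rule continuous_on_compose2[OF c, of UNIV "\<lambda>z. (1, z)", simplified])
        (auto intro!: continuous_intros)
  qed
  then show thesis by (rule that)
qed

context orientation_preserving
begin

lemma cont: "continuous_on UNIV h"
  using deriv by (meson continuous_at_imp_continuous_on has_derivative_continuous)

lemma lin: "linear (h' z)"
  using deriv has_derivative_linear by blast

lemma deriv_curve:
  assumes "(\<gamma> has_vector_derivative w) (at t)"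
  shows "((\<lambda>t. h (\<gamma> t)) has_vector_derivative h' (\<gamma> t) w) (at t)"
proof -
  have "((\<lambda>t. h (\<gamma> t)) has_derivative (\<lambda>s. h' (\<gamma> t) (s *\<^sub>R w))) (at t)"
    using has_derivative_compose[OF assms[unfolded has_vector_derivative_def] deriv] by (simp add: o_def)
  then show ?thesis unfolding has_vector_derivative_def using linear_scale[OF lin] by simp
qed

end

lemma reparametrization_props:
  assumes "reparametrization \<phi>"
  shows "strict_mono \<phi>" "surj \<phi>" "\<phi> (t + of_int k) = \<phi> t + of_int k"
proof -
  have per: "\<phi> (t + 1) = \<phi> t + 1" for t using assms unfolding reparametrization_def by simp
  obtain \<phi>' where d: "\<forall>t. (\<phi> has_real_derivative \<phi>' t) (at t) \<and> \<phi>' t > 0"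
    using assms unfolding reparametrization_def by (elim conjE exE) (rule that)
  show "strict_mono \<phi>"
  proof (rule strict_monoI)
    fix x y :: real
    assume "x < y"
    then show "\<phi> x < \<phi> y" by (rule DERIV_pos_imp_increasing) (use d in blast)
  qed
  have shift: "\<phi> (t + of_int k) = \<phi> t + of_int k" for t k
  proof (induction k rule: int_induct[where k = 0])
    case (step1 i)
    then show ?case using per[of "t + of_int i"] by (simp add: add.assoc)
  next
    case (step2 i)
    then show ?case using per[of "t + of_int (i - 1)"] by (simp add: algebra_simps)
  qed simp
  then show "\<phi> (t + of_int k) = \<phi> t + of_int k" .
  have cont: "continuous_on S \<phi>" for S
    using d by (meson DERIV_continuous continuous_at_imp_continuous_on)
  show "surj \<phi>"
    unfolding surj_def
  proof
    fix y
    define k where "k = \<lfloor>y - \<phi> 0\<rfloor>"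
    have "\<phi> (of_int k) \<le> y" "y \<le> \<phi> (of_int (k + 1))"
    proof -
      have "\<phi> (of_int k) = \<phi> 0 + of_int k" "\<phi> (of_int (k + 1)) = \<phi> 0 + of_int (k + 1)"
        using shift[of 0 k] shift[of 0 "k + 1"] by simp_all
      then show "\<phi> (of_int k) \<le> y" "y \<le> \<phi> (of_int (k + 1))"
        using floor_correct[of "y - \<phi> 0"] unfolding k_def by linarith+
    qed
    then show "\<exists>x. y = \<phi> x"
      using IVT'[of \<phi> "of_int k" y "of_int (k + 1)"] cont by force
  qed
qed

lemma reparametrization_floor:
  assumes "reparametrization \<phi>"
  shows "\<lfloor>\<phi> s - \<phi> t\<rfloor> = \<lfloor>s - t\<rfloor>" "\<lceil>\<phi> s - \<phi> t\<rceil> = \<lceil>s - t\<rceil>"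
proof -
  note p = reparametrization_props[OF assms]
  have fl: "\<lfloor>\<phi> s - \<phi> t\<rfloor> = \<lfloor>s - t\<rfloor>" for s t
  proof (rule floor_unique)
    have "t + of_int \<lfloor>s - t\<rfloor> \<le> s" "s < t + of_int (\<lfloor>s - t\<rfloor> + 1)" using floor_correct[of "s - t"] by linarith+
    then have "\<phi> (t + of_int \<lfloor>s - t\<rfloor>) \<le> \<phi> s" "\<phi> s < \<phi> (t + of_int (\<lfloor>s - t\<rfloor> + 1))"
      using p(1) by (simp_all only: strict_mono_less_eq strict_mono_less)
    then show "of_int \<lfloor>s - t\<rfloor> \<le> \<phi> s - \<phi> t" "\<phi> s - \<phi> t < of_int \<lfloor>s - t\<rfloor> + 1" unfolding p(3) by simp_all
  qed
  show "\<lfloor>\<phi> s - \<phi> t\<rfloor> = \<lfloor>s - t\<rfloor>" by (rule fl)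
  show "\<lceil>\<phi> s - \<phi> t\<rceil> = \<lceil>s - t\<rceil>" unfolding ceiling_minus_swap[of "\<phi> s"] ceiling_minus_swap[of s] fl ..
qed

text \<open>The reparametrization carries the crossing parameters of \<open>D'\<close> to those of \<open>D\<close>. It is increasing and
  commutes with integer shifts, so it preserves the floor of every difference.\<close>

lemma isotopy_move_keeps:
  assumes D: "virtual_diagram D" and D': "virtual_diagram D'" and m: "isotopy_move D f c D'"
  obtains g where "keeps_crossings D D' g c" "f = {(v, g v) | v. v \<in> classical D}"
proof -
  obtain h \<phi> where h: "plane_isotopic h" and \<phi>: "reparametrization \<phi>"
    and cv: "curve D' = h \<circ> curve D \<circ> \<phi>" and ov: "over D' = \<phi> -` over D"
    and f: "f = {(v, h v) | v. v \<in> classical D}" and c: "c = {(a, \<phi> -` a) | a. a \<in> arcs D}"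
    using m unfolding isotopy_move_def by blast
  obtain h' where "orientation_preserving h h'" using plane_isotopic_orientation[OF h] .
  then interpret orientation_preserving h h' .
  note p = reparametrization_props[OF \<phi>]
  obtain \<phi>' where d: "\<forall>t. (\<phi> has_real_derivative \<phi>' t) (at t) \<and> \<phi>' t > 0"
    using \<phi> unfolding reparametrization_def by (elim conjE exE) (rule that)
  have vel: "vel D' t = h' (curve D (\<phi> t)) (\<phi>' t *\<^sub>R vel D (\<phi> t))" for t
  proof (rule vel_unique[OF D'])
    have "(\<phi> has_vector_derivative \<phi>' t) (at t)" using d has_real_derivative_iff_has_vector_derivative by blast
    from vector_diff_chain_at[OF this has_vel[OF D]]
    have "((\<lambda>s. curve D (\<phi> s)) has_vector_derivative \<phi>' t *\<^sub>R vel D (\<phi> t)) (at t)" by (simp add: o_def)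
    from deriv_curve[OF this]
    show "((\<lambda>s. h (curve D (\<phi> s))) has_vector_derivative h' (curve D (\<phi> t)) (\<phi>' t *\<^sub>R vel D (\<phi> t))) (at t)" .
    show "\<forall>\<^sub>F s in nhds t. h (curve D (\<phi> s)) = curve D' s" unfolding cv by simp
  qed
  have det: "det2 (vel D' s) (vel D' t) > 0 \<longleftrightarrow> det2 (vel D (\<phi> s)) (vel D (\<phi> t)) > 0"
    if "curve D (\<phi> s) = curve D (\<phi> t)" for s t
  proof -
    have "det2 (\<phi>' s *\<^sub>R u) (\<phi>' t *\<^sub>R w) = \<phi>' s * \<phi>' t * det2 u w" for u w
      unfolding det2_def by (simp add: algebra_simps)
    moreover have "sgn (\<phi>' s) = 1" "sgn (\<phi>' t) = 1" using d by simp_all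
    ultimately have "sgn (det2 (vel D' s) (vel D' t)) = sgn (det2 (vel D (\<phi> s)) (vel D (\<phi> t)))"
      unfolding vel that orient by (simp add: sgn_mult)
    then show ?thesis by (metis sgn_greater)
  qed
  have hc: "curve D' t = h v \<longleftrightarrow> curve D (\<phi> t) = v" for t v
    unfolding cv using inj_h by (auto dest: injD)
  have cl: "classical D' = h ` classical D"
  proof -
    have "\<phi> ` (\<phi> -` over D) = over D" using p(2) surj_image_vimage_eq by blast
    then show ?thesis unfolding classical_def cv ov by (metis image_comp)
  qed
  have ne: "ne_strand D' (h v) t \<longleftrightarrow> ne_strand D v (\<phi> t)" for t v
    unfolding ne_strand_def hc using det p(2) by (metis surjD)
  have nw: "nw_strand D' (h v) t \<longleftrightarrow> nw_strand D v (\<phi> t)" for t v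
    unfolding nw_strand_def hc using det p(2) by (metis surjD)
  have par: "same_mod_1 (\<phi> (ne_param D' (h v))) (ne_param D v)" "same_mod_1 (\<phi> (nw_param D' (h v))) (nw_param D v)"
    if v: "v \<in> classical D" for v
  proof -
    have v': "h v \<in> classical D'" using v cl by simp
    show "same_mod_1 (\<phi> (ne_param D' (h v))) (ne_param D v)" "same_mod_1 (\<phi> (nw_param D' (h v))) (nw_param D v)"
      using ne_strand_iff[OF D v] ne_strand_iff[OF D' v'] nw_strand_iff[OF D v] nw_strand_iff[OF D' v']
        ne[of v "ne_param D' (h v)"] nw[of v "nw_param D' (h v)"] by auto
  qed
  have wr: "writhe D' (h v) = writhe D v" if v: "v \<in> classical D" for v
  proof -
    have v': "h v \<in> classical D'" using v cl by simp
    show ?thesis unfolding writhe_iff[OF D v] writhe_iff[OF D' v'] ov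
      using same_mod_1_curve(3)[OF D par(1)[OF v]] by simp
  qed
  have mono: "\<phi> s < \<phi> t \<longleftrightarrow> s < t" for s t using p(1) strict_mono_less by blast
  have lt1: "\<phi> s < \<phi> t + 1 \<longleftrightarrow> s < t + 1" for s t using mono[of s "t + 1"] p(3)[of t 1] by simp
  have ex2: "(\<exists>l r. Q l r) \<longleftrightarrow> (\<exists>l r. Q (\<phi> l) (\<phi> r))" for Q :: "real \<Rightarrow> real \<Rightarrow> bool"
    using p(2) by (metis surjD)
  have left: "left_half_params D' (h v) = \<phi> -` left_half_params D v" for v
  proof -
    have "t \<in> left_half_params D' (h v) \<longleftrightarrow> \<phi> t \<in> left_half_params D v" for t
      unfolding left_half_params_def mem_Collect_eq ne nw
        ex2[of "\<lambda>l r. nw_strand D v l \<and> ne_strand D v r \<and> l < \<phi> t \<and> \<phi> t < r \<and> r < l + 1"]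
        mono lt1 ..
    then show ?thesis by auto
  qed
  have right: "right_half_params D' (h v) = \<phi> -` right_half_params D v" for v
  proof -
    have "t \<in> right_half_params D' (h v) \<longleftrightarrow> \<phi> t \<in> right_half_params D v" for t
      unfolding right_half_params_def mem_Collect_eq ne nw
        ex2[of "\<lambda>l r. nw_strand D v l \<and> ne_strand D v r \<and> r < \<phi> t \<and> \<phi> t < l \<and> l < r + 1"]
        mono lt1 ..
    then show ?thesis by auto
  qed
  have sub: "\<phi> -` a \<subseteq> \<phi> -` b \<longleftrightarrow> a \<subseteq> b" for a b :: "real set"
    using p(2) by (metis surj_image_vimage_eq image_mono vimage_mono)
  have half: "minus_half D' (h v) (\<phi> -` a) = minus_half D v a" if "v \<in> classical D" for v a
    unfolding minus_half_def wr[OF that] left_half_def right_half_def left right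
    by (simp add: sub)
  define G where "G = \<lparr>chords = classical D, lpar = (\<lambda>v. \<phi> (nw_param D' (h v))),
    rpar = (\<lambda>v. \<phi> (ne_param D' (h v))), pos = (\<lambda>v. writhe D v = 1)\<rparr>"
  have Gs: "chords G = classical D" "lpar G v = \<phi> (nw_param D' (h v))" "rpar G v = \<phi> (ne_param D' (h v))"
    "pos G v \<longleftrightarrow> writhe D v = 1" for v unfolding G_def by simp_all
  have inj: "inj_on h (classical D)" using inj_h by (simp add: inj_on_def)
  have fn: "path_ind (\<phi> l) (\<phi> r) (\<phi> t) = path_ind l r t" "half_before (\<phi> l) (\<phi> r) s (\<phi> t) = half_before l r s t"
    "half_after (\<phi> l) (\<phi> r) s (\<phi> t) = half_after l r s t" for l r t s
    unfolding path_ind_def half_before_def half_after_def half_const_def reparametrization_floor[OF \<phi>] by simp_all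
  have "lk D' (h u) (h v) = linking G u v" if "u \<in> classical D" "v \<in> classical D" for u v
    unfolding linking_def pairing_def Gs fn
    by (simp add: cl sum.reindex[OF inj] wr[OF that(2)])
  moreover have "total_lk D' (h v) = total_linking G v" if "v \<in> classical D" for v
    unfolding total_linking_def pairing_def Gs fn
    by (simp add: cl sum.reindex[OF inj] wr[OF that])
  moreover have "linking G u v = lk D u v" "total_linking G v = total_lk D v"
    if "u \<in> classical D" "v \<in> classical D" for u v
    using that par by (intro pairing_shift; simp add: Gs)+
  ultimately have "keeps_crossings D D' h c"
    unfolding keeps_crossings_def bij_betw_def using inj cl half wr by (auto simp: c)
  then show thesis using f by (rule that)
qed

section \<open>Strands in a disc\<close>

lemma off_same_mod_1: "same_mod_1 s t \<Longrightarrow> off \<alpha> \<beta> s \<longleftrightarrow> off \<alpha> \<beta> t"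
  unfolding same_mod_1_def using off_shift by blast

lemma open_preimage_curve:
  assumes D: "virtual_diagram D" and R: "closed R"
  shows "open {t. curve D t \<notin> R}"
proof -
  have "continuous_on UNIV (curve D)"
    using has_vel[OF D] by (meson continuous_at_imp_continuous_on has_vector_derivative_continuous)
  then have "open (curve D -` (- R))" using R by (simp add: open_Compl continuous_on_open_vimage)
  then show ?thesis by (simp add: vimage_def)
qed

text \<open>The complement of the closed disc is open, so outside of it the curves agree near every crossing.\<close>

lemma outside_region:
  assumes D: "virtual_diagram D" and D': "virtual_diagram D'" and R: "closed R" and ag: "agree_off R D D'"
  shows classical_outside: "v \<notin> R \<Longrightarrow> v \<in> classical D' \<longleftrightarrow> v \<in> classical D"
    and params_outside: "v \<in> classical D - R \<Longrightarrow>
      ne_param D' v = ne_param D v \<and> nw_param D' v = nw_param D v \<and> writhe D' v = writhe D v"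
proof -
  have a: "curve D' t \<in> R \<longleftrightarrow> curve D t \<in> R"
    "curve D t \<notin> R \<Longrightarrow> curve D' t = curve D t" "curve D t \<notin> R \<Longrightarrow> t \<in> over D' \<longleftrightarrow> t \<in> over D" for t
    using ag unfolding agree_off_def by auto
  show cl: "v \<in> classical D' \<longleftrightarrow> v \<in> classical D" if "v \<notin> R" for v
  proof
    assume "v \<in> classical D'"
    then obtain t where t: "t \<in> over D'" "curve D' t = v" unfolding classical_def by blast
    then have "curve D t \<notin> R" using a(1) that by blast
    then show "v \<in> classical D" using a(2,3)[of t] t unfolding classical_def by blast
  next
    assume "v \<in> classical D"
    then obtain t where t: "t \<in> over D" "curve D t = v" unfolding classical_def by blast
    then have "curve D t \<notin> R" using that by blast
    then show "v \<in> classical D'" using a(2,3)[of t] t unfolding classical_def by (metis imageI)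
  qed
  show "ne_param D' v = ne_param D v \<and> nw_param D' v = nw_param D v \<and> writhe D' v = writhe D v"
    if v: "v \<in> classical D - R"
  proof -
    have near: "\<forall>\<^sub>F u in nhds t. curve D' u = curve D u" if "curve D t = v" for t
      using eventually_nhds_in_open[OF open_preimage_curve[OF D R], of t] a(2) v that
      by (auto elim!: eventually_mono)
    show ?thesis
      using same_crossing[OF D D', of v] near curve_params[OF D, of v] cl[of v] a(3) v by auto
  qed
qed

text \<open>The strands in the disc with chosen lifts \<open>{\<alpha> i..\<beta> i}\<close>.\<close>

locale strand_system =
  fixes R :: "complex set" and D :: vdiagram and n :: nat and T :: "nat \<Rightarrow> real set"
    and \<alpha> \<beta> :: "nat \<Rightarrow> real"
  assumes lt: "i < n \<Longrightarrow> \<alpha> i < \<beta> i" "i < n \<Longrightarrow> \<beta> i < \<alpha> i + 1"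
    and T: "i < n \<Longrightarrow> t \<in> T i \<longleftrightarrow> \<not> off (\<alpha> i) (\<beta> i) t"
    and disj: "i < n \<Longrightarrow> j < n \<Longrightarrow> i \<noteq> j \<Longrightarrow> t \<in> T i \<Longrightarrow> t \<notin> T j"
    and inside: "curve D t \<in> R \<longleftrightarrow> (\<exists>i<n. t \<in> T i)"

lemma strandsE:
  assumes "strands R D n T"
  obtains \<alpha> \<beta> where "strand_system R D n T \<alpha> \<beta>"
proof -
  have "\<forall>i. \<exists>\<alpha> \<beta>. i < n \<longrightarrow> \<alpha> < \<beta> \<and> \<beta> < \<alpha> + 1 \<and> T i = {t. \<exists>k::int. t + of_int k \<in> {\<alpha>..\<beta>}}"
    using assms unfolding strands_def by blast
  then obtain \<alpha> \<beta> where ab: "\<And>i. i < n \<Longrightarrow> \<alpha> i < \<beta> i \<and> \<beta> i < \<alpha> i + 1 \<and> T i = {t. \<exists>k::int. t + of_int k \<in> {\<alpha> i..\<beta> i}}"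
    by metis
  have dj: "disjoint_family_on T {..<n}" and ins: "{t. curve D t \<in> R} = (\<Union>i<n. T i)"
    using assms unfolding strands_def by auto
  have "strand_system R D n T \<alpha> \<beta>"
  proof
    show "\<alpha> i < \<beta> i" "\<beta> i < \<alpha> i + 1" if "i < n" for i using ab[OF that] by auto
    show "t \<in> T i \<longleftrightarrow> \<not> off (\<alpha> i) (\<beta> i) t" if "i < n" for i t using ab[OF that] unfolding off_def by auto
    show "t \<notin> T j" if "i < n" "j < n" "i \<noteq> j" "t \<in> T i" for i j t
      using dj that unfolding disjoint_family_on_def by auto
    show "curve D t \<in> R \<longleftrightarrow> (\<exists>i<n. t \<in> T i)" for t using ins by auto
  qed
  then show thesis by (rule that)
qed

context strand_system
begin

abbreviation "strand i \<equiv> {\<alpha> i..\<beta> i}"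

lemma interval_T:
  assumes "i < n" "t \<in> strand i"
  shows "t \<in> T i" "curve D t \<in> R"
proof -
  have "\<not> off (\<alpha> i) (\<beta> i) t" using assms(2) unfolding off_def by (metis add.right_neutral of_int_0)
  then show "t \<in> T i" using T assms(1) by blast
  then show "curve D t \<in> R" using inside assms(1) by blast
qed

lemma T_lift:
  assumes "i < n" "t \<in> T i"
  obtains s where "same_mod_1 s t" "s \<in> strand i"
  using assms T[of i t] unfolding off_def same_mod_1_def by blast

lemma other_off:
  assumes "i < n" "j < n" "i \<noteq> j" "t \<in> strand i"
  shows "off (\<alpha> j) (\<beta> j) t"
  using disj[OF assms(1-3) interval_T(1)[OF assms(1,4)]] T assms(2) by blast

lemma outside_off: "curve D t \<notin> R \<longleftrightarrow> (\<forall>i<n. off (\<alpha> i) (\<beta> i) t)"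
  using inside T by blast

text \<open>The strands are disjoint and closed, so the curve is outside the disc just before and just after each
  of them.\<close>

lemma exits:
  assumes i: "i < n"
  shows "\<forall>\<^sub>F t in at_left (\<alpha> i). curve D t \<notin> R" "\<forall>\<^sub>F t in at_right (\<beta> i). curve D t \<notin> R"
proof -
  have other: "\<forall>\<^sub>F t in at s within S. off (\<alpha> j) (\<beta> j) t" if "j < n" "j \<noteq> i" "s \<in> strand i" for j s S
  proof -
    have "\<forall>\<^sub>F t in nhds s. off (\<alpha> j) (\<beta> j) t"
      by (rule eventually_off[OF other_off[OF i that(1) that(2)[symmetric] that(3)]]) (use lt[OF that(1)] in simp)
    then show ?thesis unfolding eventually_at_filter by (rule eventually_mono) simp
  qed
  have L: "\<forall>\<^sub>F t in at_left (\<alpha> i). off (\<alpha> j) (\<beta> j) t" if j: "j < n" for j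
  proof (cases "j = i")
    case True
    have "\<beta> i - 1 < \<alpha> i" using lt[OF i] by simp
    from eventually_at_left_real[OF this] show ?thesis
      unfolding True by (rule eventually_mono) (intro off_between[where m = "-1"], auto)
  qed (use other[OF j] lt[OF i] in auto)
  have U: "\<forall>\<^sub>F t in at_right (\<beta> i). off (\<alpha> j) (\<beta> j) t" if j: "j < n" for j
  proof (cases "j = i")
    case True
    have "\<beta> i < \<alpha> i + 1" using lt[OF i] by simp
    from eventually_at_right_real[OF this] show ?thesis
      unfolding True by (rule eventually_mono) (intro off_between[where m = 0], auto)
  qed (use other[OF j] lt[OF i] in auto)
  have "\<forall>\<^sub>F t in at_left (\<alpha> i). \<forall>j\<in>{..<n}. off (\<alpha> j) (\<beta> j) t"
    using L by (intro eventually_ball_finite) auto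
  then show "\<forall>\<^sub>F t in at_left (\<alpha> i). curve D t \<notin> R" by (rule eventually_mono) (use outside_off in auto)
  have "\<forall>\<^sub>F t in at_right (\<beta> i). \<forall>j\<in>{..<n}. off (\<alpha> j) (\<beta> j) t"
    using U by (intro eventually_ball_finite) auto
  then show "\<forall>\<^sub>F t in at_right (\<beta> i). curve D t \<notin> R" by (rule eventually_mono) (use outside_off in auto)
qed

text \<open>A connected piece of the curve in the disc stays in one lift of one strand.\<close>

lemma stays:
  assumes i: "i < n" and s: "s \<in> strand i" and seg: "curve D ` closed_segment s t \<subseteq> R"
  shows "t \<in> strand i"
proof (rule ccontr)
  assume "t \<notin> strand i"
  then consider "t < \<alpha> i" | "\<beta> i < t" by fastforce
  then show False
  proof cases
    case 1
    have "\<forall>\<^sub>F u in at_left (\<alpha> i). u \<in> {t<..<\<alpha> i} \<and> curve D u \<notin> R"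
      using eventually_at_left_real[OF 1] exits(1)[OF i] by (rule eventually_conj)
    then obtain u where "u \<in> {t<..<\<alpha> i}" "curve D u \<notin> R"
      using eventually_happens'[OF trivial_limit_at_left_real] by blast
    moreover from this have "u \<in> closed_segment s t" using s by (auto simp: closed_segment_eq_real_ivl)
    ultimately show False using seg by blast
  next
    case 2
    have "\<forall>\<^sub>F u in at_right (\<beta> i). u \<in> {\<beta> i<..<t} \<and> curve D u \<notin> R"
      using eventually_at_right_real[OF 2] exits(2)[OF i] by (rule eventually_conj)
    then obtain u where "u \<in> {\<beta> i<..<t}" "curve D u \<notin> R"
      using eventually_happens'[OF trivial_limit_at_right_real] by blast
    moreover from this have "u \<in> closed_segment s t" using s by (auto simp: closed_segment_eq_real_ivl)
    ultimately show False using seg by blast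
  qed
qed

lemma segment_in_strand:
  assumes "i < n" "s \<in> strand i" "t \<in> strand i"
  shows "curve D ` closed_segment s t \<subseteq> R"
proof -
  have "closed_segment s t \<subseteq> strand i"
    using assms(2,3) by (auto simp: closed_segment_eq_real_ivl split: if_splits)
  then show ?thesis using interval_T(2)[OF assms(1)] by blast
qed

text \<open>The end of a strand is a limit of points outside the disc.\<close>

lemma frontier_limit:
  assumes D: "virtual_diagram D" and i: "i < n" and R: "R = region h" and h: "continuous_on UNIV h"
  shows "norm (h (curve D (\<alpha> i))) = 1" "norm (h (curve D (\<beta> i))) = 1"
proof -
  have cont: "isCont (\<lambda>t. norm (h (curve D t))) t" for t
  proof -
    have "isCont h (curve D t)" using h continuous_on_eq_continuous_at by blast
    then have "isCont (\<lambda>t. h (curve D t)) t"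
      using has_vector_derivative_continuous[OF has_vel[OF D]] continuous_at_compose[of t "curve D" h]
      by (simp add: o_def)
    then show ?thesis by (intro continuous_intros)
  qed
  have le: "norm (h (curve D t)) \<le> 1 \<longleftrightarrow> curve D t \<in> R" for t unfolding R region_def by simp
  have ge: "1 \<le> norm (h (curve D t))" if "curve D t \<notin> R" for t using that le[of t] by linarith
  have lim: "((\<lambda>t. norm (h (curve D t))) \<longlongrightarrow> norm (h (curve D t))) (at t within S)" for t S
    using cont[of t] unfolding isCont_def by (rule tendsto_within_subset) simp
  have "1 \<le> norm (h (curve D (\<alpha> i)))"
    by (rule tendsto_lowerbound[OF lim[of "\<alpha> i" "{..<\<alpha> i}"]])
      (use exits(1)[OF i] ge in \<open>auto elim!: eventually_mono\<close>)
  moreover have "1 \<le> norm (h (curve D (\<beta> i)))"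
    by (rule tendsto_lowerbound[OF lim[of "\<beta> i" "{\<beta> i<..}"]])
      (use exits(2)[OF i] ge in \<open>auto elim!: eventually_mono\<close>)
  moreover have "norm (h (curve D (\<alpha> i))) \<le> 1" "norm (h (curve D (\<beta> i))) \<le> 1"
    unfolding le using interval_T(2)[OF i] lt[OF i] by auto
  ultimately show "norm (h (curve D (\<alpha> i))) = 1" "norm (h (curve D (\<beta> i))) = 1" by auto
qed

text \<open>This makes the direction in which a strand crosses the disc the same before and after a move.\<close>

lemma agree_at_ends:
  assumes D: "virtual_diagram D" and D': "virtual_diagram D'" and i: "i < n" and ag: "agree_off R D D'"
  shows "curve D' (\<alpha> i) = curve D (\<alpha> i)" "curve D' (\<beta> i) = curve D (\<beta> i)"
proof -
  have lim: "(curve D \<longlongrightarrow> curve D t) (at t within S)" "(curve D' \<longlongrightarrow> curve D' t) (at t within S)" for t S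
    using has_vector_derivative_continuous[OF has_vel[OF D]] has_vector_derivative_continuous[OF has_vel[OF D']]
    unfolding isCont_def by (auto intro: tendsto_within_subset)
  have eq: "curve D' t = curve D t" if "curve D t \<notin> R" for t using ag that unfolding agree_off_def by blast
  have "(curve D \<longlongrightarrow> curve D' (\<alpha> i)) (at_left (\<alpha> i))"
    by (rule Lim_transform_eventually[OF lim(2)]) (use exits(1)[OF i] eq in \<open>auto elim!: eventually_mono\<close>)
  then show "curve D' (\<alpha> i) = curve D (\<alpha> i)"
    using lim(1) tendsto_unique trivial_limit_at_left_real by metis
  have "(curve D \<longlongrightarrow> curve D' (\<beta> i)) (at_right (\<beta> i))"
    by (rule Lim_transform_eventually[OF lim(2)]) (use exits(2)[OF i] eq in \<open>auto elim!: eventually_mono\<close>)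
  then show "curve D' (\<beta> i) = curve D (\<beta> i)"
    using lim(1) tendsto_unique trivial_limit_at_right_real by metis
qed

end

text \<open>Along the graph the velocity is a multiple of the tangent \<open>(1, g')\<close>. As it never vanishes, its first
  component has a constant sign \<open>e\<close>, the direction of the strand. At the ends of the strand the
  curve is on the graph on one side only, which is enough to determine the derivative.\<close>

lemma (in orientation_preserving) graph_strand:
  assumes D: "virtual_diagram D" and ab: "\<alpha> < \<beta>"
    and g: "\<And>x. (g has_real_derivative g' x) (at x)"
    and graph: "\<And>t. t \<in> {\<alpha>..\<beta>} \<Longrightarrow> Im (h (curve D t)) = g (Re (h (curve D t)))"
  obtains e :: real where "e = 1 \<or> e = -1"
    "\<And>s t. s \<in> {\<alpha>..\<beta>} \<Longrightarrow> t \<in> {\<alpha>..\<beta>} \<Longrightarrow> s < t \<Longrightarrow> e * Re (h (curve D s)) < e * Re (h (curve D t))"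
    "\<And>t. t \<in> {\<alpha>..\<beta>} \<Longrightarrow> \<exists>c>0. h' (curve D t) (vel D t) = Complex (c * e) (c * e * g' (Re (h (curve D t))))"
proof -
  define X where "X t = Re (h (curve D t))" for t
  define Y where "Y t = Im (h (curve D t))" for t
  define w where "w t = h' (curve D t) (vel D t)" for t
  have hd: "((\<lambda>t. h (curve D t)) has_vector_derivative w t) (at t)" for t
    unfolding w_def by (rule deriv_curve[OF has_vel[OF D]])
  have dX: "(X has_real_derivative Re (w t)) (at t)" for t
    using bounded_linear.has_vector_derivative[OF bounded_linear_Re hd] unfolding X_def has_real_derivative_iff_has_vector_derivative .
  have dY: "(Y has_real_derivative Im (w t)) (at t)" for t
    using bounded_linear.has_vector_derivative[OF bounded_linear_Im hd] unfolding Y_def has_real_derivative_iff_has_vector_derivative .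
  have Im: "Im (w t) = g' (X t) * Re (w t)" if t: "t \<in> {\<alpha>..\<beta>}" for t
  proof -
    have "((\<lambda>t. g (X t)) has_real_derivative g' (X t) * Re (w t)) (at t within {\<alpha>..\<beta>})"
      using DERIV_chain2[OF g dX] by (rule DERIV_subset) simp
    then have "(Y has_real_derivative g' (X t) * Re (w t)) (at t within {\<alpha>..\<beta>})"
      by (rule has_field_derivative_transform_within[of _ _ _ _ 1])
        (use t graph in \<open>auto simp: X_def Y_def\<close>)
    moreover have "(Y has_real_derivative Im (w t)) (at t within {\<alpha>..\<beta>})" using dY by (rule DERIV_subset) simp
    ultimately show ?thesis
      unfolding has_real_derivative_iff_has_vector_derivative
      using vector_derivative_unique_within_closed_interval[OF ab, of t Y] t by simp
  qed
  have nz: "Re (w t) \<noteq> 0" if t: "t \<in> {\<alpha>..\<beta>}" for t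
  proof
    assume "Re (w t) = 0"
    then have "w t = 0" using Im[OF t] by (simp add: complex_eq_iff)
    then have "det2 (w t) u = 0" for u by (simp add: det2_def)
    then have "det2 (vel D t) u = 0" for u
      using orient[of "curve D t" "vel D t" u] unfolding w_def by (metis sgn_0 sgn_eq_0_iff)
    from this[of 1] this[of \<i>] have "vel D t = 0" by (simp add: det2_def complex_eq_iff)
    then show False using vel_nonzero[OF D] by blast
  qed
  have cw: "continuous_on {\<alpha>..\<beta>} (\<lambda>t. Re (w t))"
  proof -
    have c: "continuous_on {\<alpha>..\<beta>} (curve D)" "continuous_on {\<alpha>..\<beta>} (vel D)"
      by (intro continuous_at_imp_continuous_on ballI has_vector_derivative_continuous[OF has_vel[OF D]])
        (rule continuous_on_subset[OF vel_continuous[OF D]], simp)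
    have "w t = Re (vel D t) *\<^sub>R h' (curve D t) 1 + Im (vel D t) *\<^sub>R h' (curve D t) \<i>" for t
      unfolding w_def by (rule linear_complex_expand[OF lin])
    moreover have "continuous_on {\<alpha>..\<beta>} (\<lambda>t. h' (curve D t) u)" for u
      by (rule continuous_on_compose2[OF cont' c(1)]) simp
    ultimately show ?thesis using c by (auto intro!: continuous_intros)
  qed
  \<comment> \<open>the component is continuous, so a change of sign would force a zero\<close>
  have sign: "Re (w s) > 0 \<longleftrightarrow> Re (w t) > 0" if "s \<in> {\<alpha>..\<beta>}" "t \<in> {\<alpha>..\<beta>}" for s t
  proof (rule ccontr)
    assume "\<not> ?thesis"
    then have "0 \<in> closed_segment (Re (w s)) (Re (w t))" by (auto simp: closed_segment_eq_real_ivl not_less)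
    moreover have "connected ((\<lambda>t. Re (w t)) ` {\<alpha>..\<beta>})" using cw by (intro connected_continuous_image) auto
    then have "closed_segment (Re (w s)) (Re (w t)) \<subseteq> (\<lambda>t. Re (w t)) ` {\<alpha>..\<beta>}"
      using that by (intro closed_segment_subset) (auto simp: is_interval_convex is_interval_connected_1)
    ultimately show False using nz by auto
  qed
  define e :: real where "e = (if Re (w \<alpha>) > 0 then 1 else -1)"
  have e: "e * Re (w t) > 0" if "t \<in> {\<alpha>..\<beta>}" for t
    using sign[OF that, of \<alpha>] nz[OF that] ab unfolding e_def by (auto simp: not_less order.order_iff_strict)
  show thesis
  proof (rule that)
    show e1: "e = 1 \<or> e = -1" unfolding e_def by auto
    show "e * Re (h (curve D s)) < e * Re (h (curve D t))" if "s \<in> {\<alpha>..\<beta>}" "t \<in> {\<alpha>..\<beta>}" "s < t" for s t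
      unfolding X_def[symmetric] using that(3)
    proof (rule DERIV_pos_imp_increasing)
      fix x assume "s \<le> x" "x \<le> t"
      then have "x \<in> {\<alpha>..\<beta>}" using that by auto
      then show "\<exists>y. ((\<lambda>t. e * X t) has_real_derivative y) (at x) \<and> 0 < y"
        using DERIV_cmult[OF dX, of e x] e by blast
    qed
    show "\<exists>c>0. h' (curve D t) (vel D t) = Complex (c * e) (c * e * g' (Re (h (curve D t))))" if t: "t \<in> {\<alpha>..\<beta>}" for t
    proof (intro exI conjI)
      show "e * Re (w t) > 0" by (rule e[OF t])
      show "h' (curve D t) (vel D t) = Complex (e * Re (w t) * e) (e * Re (w t) * e * g' (Re (h (curve D t))))"
        using Im[OF t] e1 unfolding w_def[symmetric] X_def[symmetric] by (auto simp: complex_eq_iff)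
    qed
  qed
qed

lemma (in orientation_preserving) graph_crossing_sign:
  assumes "curve D s = curve D t"
    and "c > 0" "h' (curve D s) (vel D s) = Complex (c * e) (c * e * m)"
    and "c' > 0" "h' (curve D t) (vel D t) = Complex (c' * e') (c' * e' * m')"
  shows "sgn (det2 (vel D s) (vel D t)) = sgn (e * e' * (m' - m))"
proof -
  have "sgn (det2 (vel D s) (vel D t)) = sgn (det2 (h' (curve D s) (vel D s)) (h' (curve D t) (vel D t)))"
    using orient[of "curve D s"] assms(1) by simp
  also have "det2 (h' (curve D s) (vel D s)) (h' (curve D t) (vel D t)) = c * c' * (e * e' * (m' - m))"
    unfolding assms(3,5) det2_def by (simp add: algebra_simps)
  also have "sgn \<dots> = sgn (e * e' * (m' - m))" using assms(2,4) by (simp add: sgn_mult)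
  finally show ?thesis .
qed

text \<open>The strand enters the disc at one end of the graph, and being monotone it leaves it at the other.\<close>

lemma graph_strand_covers:
  fixes X :: "real \<Rightarrow> real"
  assumes ab: "\<alpha> < \<beta>" and cont: "continuous_on {\<alpha>..\<beta>} X" and e: "e = 1 \<or> e = -1"
    and mono: "e * X \<alpha> < e * X \<beta>"
    and ends: "\<bar>X \<alpha>\<bar> = m" "\<bar>X \<beta>\<bar> = m"
  shows "X \<alpha> = - e * m" "X \<beta> = e * m" "m > 0" "x \<in> {- m..m} \<Longrightarrow> \<exists>t\<in>{\<alpha>..\<beta>}. X t = x"
proof -
  show X: "X \<alpha> = - e * m" "X \<beta> = e * m" "m > 0" using e mono ends by auto
  show "\<exists>t\<in>{\<alpha>..\<beta>}. X t = x" if "x \<in> {- m..m}"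
    using e
  proof
    assume "e = 1"
    then show ?thesis using IVT'[of X \<alpha> x \<beta>] X that ab cont by force
  next
    assume "e = -1"
    then show ?thesis using IVT2'[of X \<beta> x \<alpha>] X that ab cont by force
  qed
qed

section \<open>The first and the second move\<close>

lemma closed_region:
  assumes "continuous_on UNIV h"
  shows "closed (region h)"
  unfolding region_def using assms by (simp add: continuous_on_closed_vimage)

lemma plane_isotopic_closed_region:
  assumes "plane_isotopic h"
  shows "closed (region h)"
proof -
  obtain h' where "orientation_preserving h h'" using plane_isotopic_orientation[OF assms] .
  then interpret orientation_preserving h h' .
  show ?thesis by (rule closed_region[OF cont])
qed

lemma arc_corr_half:
  assumes D: "virtual_diagram D" and D': "virtual_diagram D'" and c: "(a, a') \<in> arc_corr R D D'"
  obtains t where "curve D t \<notin> R"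
    "\<And>v. v \<in> classical D \<Longrightarrow> signed_half D v a = after (gauss D) v t"
    "\<And>v. v \<in> classical D' \<Longrightarrow> signed_half D' v a' = after (gauss D') v t"
proof -
  obtain t where t: "a \<in> arcs D" "a' \<in> arcs D'" "t \<in> a" "t \<in> a'" "curve D t \<notin> R"
    using c unfolding arc_corr_def by auto
  then show thesis using signed_half[OF D] signed_half[OF D'] by (intro that) auto
qed

lemma surviving_half:
  assumes D: "virtual_diagram D" and D': "virtual_diagram D'" and c: "(a, a') \<in> arc_corr R D D'"
    and v: "v \<in> classical D" "v \<in> classical D'"
    and same: "ne_param D' v = ne_param D v \<and> nw_param D' v = nw_param D v \<and> writhe D' v = writhe D v"
  shows "signed_half D v a = signed_half D' v a'"
proof (rule arc_corr_half[OF D D' c])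
  fix t
  assume h: "\<And>v. v \<in> classical D \<Longrightarrow> signed_half D v a = after (gauss D) v t"
    and h': "\<And>v. v \<in> classical D' \<Longrightarrow> signed_half D' v a' = after (gauss D') v t"
  show ?thesis unfolding h[OF v(1)] h'[OF v(2)] using same by simp
qed

text \<open>No crossing of \<open>D'\<close> is left in the disc, so the correspondence of crossings is the identity where defined.\<close>

lemma removed_crossings:
  assumes D: "virtual_diagram D" and D': "virtual_diagram D'" and R: "closed R" and ag: "agree_off R D D'"
    and none: "double_points D' \<inter> R = {}"
  shows "classical D' = classical D - R" "crossing_corr R D D' = Id_on (classical D')"
    and "v \<in> classical D' \<Longrightarrow> ne_param D' v = ne_param D v \<and> nw_param D' v = nw_param D v \<and> writhe D' v = writhe D v"
proof -
  have e: "classical D' \<inter> R = {}" using none classical_double_points[OF D'] by blast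
  then show cl: "classical D' = classical D - R"
    using classical_outside[OF D D' R ag] by blast
  show "crossing_corr R D D' = Id_on (classical D')"
    unfolding crossing_corr_def cl using e by auto
  show "ne_param D' v = ne_param D v \<and> nw_param D' v = nw_param D v \<and> writhe D' v = writhe D v"
    if "v \<in> classical D'"
    using params_outside[OF D D' R ag] that cl by blast
qed

lemma (in strand_system) param_off:
  assumes D: "virtual_diagram D" and v: "v \<in> classical D - R" and i: "i < n"
  shows "off (\<alpha> i) (\<beta> i) (ne_param D v)" "off (\<alpha> i) (\<beta> i) (nw_param D v)"
  using outside_off[of "ne_param D v"] outside_off[of "nw_param D v"] curve_params[OF D, of v] v i by auto

text \<open>The outcome of a first move. The last assumption is where the reducedness of the index comes in: either
  the half of \<open>v0\<close> is the removed loop, or \<open>v0\<close> is of type \<open>l\<^sub>+\<close> or \<open>r\<^sub>-\<close>.\<close>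

locale loop_removal =
  fixes R :: "complex set" and D D' :: vdiagram and v0 :: complex
  assumes vertices: "classical D \<inter> R = {v0}" and crossings: "classical D = insert v0 (classical D')"
    and removed: "v0 \<notin> classical D'" and correspondence: "crossing_corr R D D' = Id_on (classical D')"
    and linking_survives: "\<And>u v. u \<in> classical D' \<Longrightarrow> v \<in> classical D' \<Longrightarrow> lk D u v = lk D' u v"
    and total_survives: "\<And>v. v \<in> classical D' \<Longrightarrow> total_lk D v = total_lk D' v"
    and half_survives: "\<And>a a' v. (a, a') \<in> arc_corr R D D' \<Longrightarrow> v \<in> classical D' \<Longrightarrow>
      signed_half D v a = signed_half D' v a'"
    and total_loop: "total_lk D v0 = 0"
    and path: "(\<forall>v\<in>classical D. lk D v0 v = 0) \<or>
      (\<forall>v\<in>classical D. lk D v0 v = total_lk D v)"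
    and invisible: "(\<forall>u\<in>classical D'. lk D u v0 = 0) \<and>
        (\<forall>(a, a')\<in>arc_corr R D D'. signed_half D v0 a = 0) \<or>
      curve D ` left_half_params D v0 \<subseteq> R \<and> writhe D v0 = 1 \<or>
      curve D ` right_half_params D v0 \<subseteq> R \<and> writhe D v0 = -1"

text \<open>Both parameters of the crossing lie in the only strand; their order says which half is the loop.\<close>

lemma reid1_loop_removal:
  assumes D: "virtual_diagram D" and D': "virtual_diagram D'" and r: "reid1 R D D'"
  obtains v0 where "loop_removal R D D' v0"
proof -
  obtain h T v0 where h: "plane_isotopic h" "R = region h" and ag: "agree_off R D D'" and st: "strands R D 1 T"
    and v0: "v0 \<in> classical D" and dp: "double_points D \<inter> R = {v0}" and dp': "double_points D' \<inter> R = {}"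
    using r unfolding reid1_def by blast
  have R: "closed R" unfolding h(2) by (rule plane_isotopic_closed_region[OF h(1)])
  obtain \<alpha> \<beta> where "strand_system R D 1 T \<alpha> \<beta>" by (rule strandsE[OF st])
  then interpret strand_system R D 1 T \<alpha> \<beta> .
  note rem = removed_crossings[OF D D' R ag dp']
  have v0R: "classical D \<inter> R = {v0}" using dp v0 classical_double_points[OF D] by auto
  have ch: "classical D = insert v0 (classical D')" and notin: "v0 \<notin> classical D'"
    using v0R unfolding rem(1) by auto
  note cp = curve_params[OF D v0]
  have "ne_param D v0 \<in> T 0" "nw_param D v0 \<in> T 0"
    using inside[of "ne_param D v0"] inside[of "nw_param D v0"] cp v0R by auto
  then obtain a b where a: "same_mod_1 a (ne_param D v0)" "a \<in> strand 0"
    and b: "same_mod_1 b (nw_param D v0)" "b \<in> strand 0"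
    using T_lift[of 0] by (metis less_one)
  have ab: "a \<noteq> b" using params_distinct[OF D v0] a b same_mod_1_sym same_mod_1_trans by blast
  have len: "\<beta> 0 < \<alpha> 0 + 1" using lt[of 0] by simp
  \<comment> \<open>the chord diagram with lifts in the strand as the ends of the chord \<open>v0\<close>\<close>
  define G where "G = (gauss D)\<lparr>lpar := (nw_param D)(v0 := b), rpar := (ne_param D)(v0 := a)\<rparr>"
  have Gs: "chords G = insert v0 (classical D')" "lpar G v0 = b" "rpar G v0 = a"
    "pos G v \<longleftrightarrow> writhe D v = 1"
    "v \<in> classical D' \<Longrightarrow> lpar G v = nw_param D v \<and> rpar G v = ne_param D v" for v
    unfolding G_def using ch notin by auto
  have sm: "same_mod_1 (((nw_param D)(v0 := b)) w) (nw_param D w)" "same_mod_1 (((ne_param D)(v0 := a)) w) (ne_param D w)" for w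
    using a(1) b(1) by simp_all
  note link = choose_lifts[OF sm, folded G_def]
  have off: "off (\<alpha> 0) (\<beta> 0) (ne_param D w)" "off (\<alpha> 0) (\<beta> 0) (nw_param D w)" if "w \<in> classical D'" for w
    using param_off[OF D, of w 0] that rem(1) by auto
  have av: "avoids G (classical D') (lpar G v0) (rpar G v0)"
    unfolding avoids_def using off_unsep[OF off(1) b(2) a(2)] off_unsep[OF off(2) b(2) a(2)] Gs by auto
  have G': "chords (gauss D') = classical D'"
    "\<And>w. w \<in> classical D' \<Longrightarrow> lpar (gauss D') w = lpar G w \<and> rpar (gauss D') w = rpar G w \<and> pos (gauss D') w = pos G w"
    using rem(3) Gs by auto
  interpret M: first_move G "gauss D'" "classical D'" v0
    by unfold_locales (use Gs(1) finite_classical[OF D'] notin av G' in auto)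
  have in_D: "v \<in> classical D" if "v \<in> classical D'" for v using ch that by auto
  have halfR: "curve D t \<in> R" if "c < t" "t < d" "d < c + 1" "same_mod_1 c c'" "same_mod_1 d d'"
    "c' < d'" "c' \<in> strand 0" "d' \<in> strand 0" for t c d c' d'
  proof -
    obtain i j :: int where ij: "c = c' + i" "d = d' + j" using \<open>same_mod_1 c c'\<close> \<open>same_mod_1 d d'\<close>
      unfolding same_mod_1_def by blast
    then have "real_of_int (i - j) < real_of_int 1" "real_of_int (- 1) < real_of_int (i - j)" using that len by auto
    then have "i = j" unfolding of_int_less_iff by simp
    then have "t + of_int (- i) \<in> strand 0" using that ij by auto
    then have "curve D (t + of_int (- i)) \<in> R" using interval_T(2)[of 0] by simp
    then show ?thesis unfolding curve_shift[OF D] .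
  qed
  have far: "unsep t b a" if "curve D t \<notin> R" for t
    using that outside_off[of t] off_unsep[of "\<alpha> 0" "\<beta> 0" t b a] a b by auto
  have half0: "after (gauss D) v0 t = half_const b a (writhe D v0 = 1)" if "curve D t \<notin> R" for t
    unfolding link(3) Gs unfolding half_after_def using unsep_rules(3)[OF far[OF that]] by simp
  have invisible: "(\<forall>u\<in>classical D'. lk D u v0 = 0) \<and>
      (\<forall>(c, c')\<in>arc_corr R D D'. signed_half D v0 c = 0)"
    if "half_const b a (writhe D v0 = 1) = 0"
    using that half0 v0 M.loop_invisible link in_D Gs by (auto elim!: arc_corr_half[OF D D'])
  have left_or_right: "((\<forall>v\<in>classical D. lk D v0 v = 0) \<or>
     (\<forall>v\<in>classical D. lk D v0 v = total_lk D v)) \<and>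
    ((\<forall>u\<in>classical D'. lk D u v0 = 0) \<and>
     (\<forall>(a, a')\<in>arc_corr R D D'. signed_half D v0 a = 0) \<or>
     curve D ` left_half_params D v0 \<subseteq> R \<and> writhe D v0 = 1 \<or>
     curve D ` right_half_params D v0 \<subseteq> R \<and> writhe D v0 = -1)"
  proof (cases "b < a")
    case True
    have fl: "\<lfloor>a - b\<rfloor> = 0" "\<lceil>a - b\<rceil> = 1" using True a b len by (auto simp: floor_eq_iff ceiling_eq_iff)
    have L: "curve D ` left_half_params D v0 \<subseteq> R"
    proof
      fix z assume "z \<in> curve D ` left_half_params D v0"
      then obtain t l r where z: "z = curve D t" "same_mod_1 l (nw_param D v0)" "same_mod_1 r (ne_param D v0)"
        "l < t" "t < r" "r < l + 1"
        unfolding left_half_params_def ne_strand_iff[OF D v0] nw_strand_iff[OF D v0] by auto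
      have "same_mod_1 l b" "same_mod_1 r a" using z a b same_mod_1_sym same_mod_1_trans by blast+
      then show "z \<in> R" using halfR[OF z(4-6) _ _ True b(2) a(2)] z(1) by blast
    qed
    have "\<forall>v\<in>classical D. lk D v0 v = 0"
      using M.left_loop[unfolded Gs(2,3), OF fl] link v0 Gs(1) ch by auto
    moreover have "(\<forall>u\<in>classical D'. lk D u v0 = 0) \<and>
     (\<forall>(a, a')\<in>arc_corr R D D'. signed_half D v0 a = 0)" if "writhe D v0 \<noteq> 1"
      by (rule invisible) (use that fl in \<open>simp add: half_const_def floor_minus_swap[of b a]\<close>)
    ultimately show ?thesis using L by blast
  next
    case False
    then have ab': "a < b" using ab by simp
    have fl: "\<lfloor>b - a\<rfloor> = 0" "\<lceil>b - a\<rceil> = 1" using ab' a b len by (auto simp: floor_eq_iff ceiling_eq_iff)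
    have R: "curve D ` right_half_params D v0 \<subseteq> R"
    proof
      fix z assume "z \<in> curve D ` right_half_params D v0"
      then obtain t l r where z: "z = curve D t" "same_mod_1 l (nw_param D v0)" "same_mod_1 r (ne_param D v0)"
        "r < t" "t < l" "l < r + 1"
        unfolding right_half_params_def ne_strand_iff[OF D v0] nw_strand_iff[OF D v0] by auto
      have "same_mod_1 l b" "same_mod_1 r a" using z a b same_mod_1_sym same_mod_1_trans by blast+
      then show "z \<in> R" using halfR[OF z(4-6) _ _ ab' a(2) b(2)] z(1) by blast
    qed
    have "\<forall>v\<in>classical D. lk D v0 v = total_lk D v"
      using M.right_loop[unfolded Gs(2,3), OF fl] link v0 Gs(1) ch by auto
    moreover have "(\<forall>u\<in>classical D'. lk D u v0 = 0) \<and>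
     (\<forall>(a, a')\<in>arc_corr R D D'. signed_half D v0 a = 0)" if "writhe D v0 = 1"
      by (rule invisible) (use that fl in \<open>simp add: half_const_def\<close>)
    moreover have "writhe D v0 = 1 \<or> writhe D v0 = -1" unfolding writhe_def by auto
    ultimately show ?thesis using R by blast
  qed
  have "loop_removal R D D' v0"
  proof (unfold_locales, fact v0R, fact ch, fact notin, fact rem(2))
    show "lk D u v = lk D' u v" if "u \<in> classical D'" "v \<in> classical D'" for u v
      using link(1)[OF in_D in_D] M.linking_survives that by simp
    show "total_lk D v = total_lk D' v" if "v \<in> classical D'" for v
      using link(2)[OF in_D] M.total_survives that by simp
    show "signed_half D v c = signed_half D' v c'"
      if c: "(c, c') \<in> arc_corr R D D'" and v: "v \<in> classical D'" for c c' v
      by (rule surviving_half[OF D D' c in_D[OF v] v rem(3)[OF v]])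
    show "total_lk D v0 = 0" using link(2)[OF v0] M.total_loop by simp
  qed (rule conjunct1[OF left_or_right], rule conjunct2[OF left_or_right])
  then show thesis by (rule that)
qed

lemma (in strand_system) crossing_strands:
  assumes D: "virtual_diagram D" and v: "v \<in> classical D" "v \<in> R"
    and inj: "\<And>i s t. i < n \<Longrightarrow> s \<in> strand i \<Longrightarrow> t \<in> strand i \<Longrightarrow> curve D s = curve D t \<Longrightarrow> s = t"
  obtains i j s t where "i < n" "j < n" "i \<noteq> j" "s \<in> strand i" "t \<in> strand j"
    "same_mod_1 s (ne_param D v)" "same_mod_1 t (nw_param D v)"
proof -
  note cp = curve_params[OF D v(1)]
  obtain i where i: "i < n" "ne_param D v \<in> T i" using inside[of "ne_param D v"] cp v(2) by auto
  obtain j where j: "j < n" "nw_param D v \<in> T j" using inside[of "nw_param D v"] cp v(2) by auto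
  obtain s where s: "same_mod_1 s (ne_param D v)" "s \<in> strand i" by (rule T_lift[OF i])
  obtain t where t: "same_mod_1 t (nw_param D v)" "t \<in> strand j" by (rule T_lift[OF j])
  have "i \<noteq> j"
  proof
    assume "i = j"
    then have "s = t" using inj[OF i(1) s(2)] t(2) same_mod_1_curve(1)[OF D s(1)] same_mod_1_curve(1)[OF D t(1)] cp by auto
    then show False using s(1) t(1) params_distinct[OF D v(1)] same_mod_1_sym same_mod_1_trans by blast
  qed
  then show thesis using that i j s t by blast
qed

text \<open>The outcome of a second move. Only sums over the two crossings are recorded: the single terms depend on
  how the strands run, the sums do not.\<close>

locale bigon_removal =
  fixes R :: "complex set" and D D' :: vdiagram and v1 v2 :: complex
  assumes vertices: "classical D \<inter> R = {v1, v2}" and distinct: "v1 \<noteq> v2"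
    and crossings: "classical D = insert v1 (insert v2 (classical D'))"
    and removed: "v1 \<notin> classical D'" "v2 \<notin> classical D'"
    and correspondence: "crossing_corr R D D' = Id_on (classical D')"
    and linking_survives: "\<And>u v. u \<in> classical D' \<Longrightarrow> v \<in> classical D' \<Longrightarrow> lk D u v = lk D' u v"
    and total_survives: "\<And>v. v \<in> classical D' \<Longrightarrow> total_lk D v = total_lk D' v"
    and half_survives: "\<And>a a' v. (a, a') \<in> arc_corr R D D' \<Longrightarrow> v \<in> classical D' \<Longrightarrow>
      signed_half D v a = signed_half D' v a'"
    and linking_cancels: "\<And>u. u \<in> classical D' \<Longrightarrow> lk D u v1 + lk D u v2 = 0"
    and total_cancels: "total_lk D v1 + total_lk D v2 = 0"
    and half_cancels: "\<And>a a'. (a, a') \<in> arc_corr R D D' \<Longrightarrow> signed_half D v1 a + signed_half D v2 a = 0"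
    and paths_whole: "\<And>v. v \<in> classical D' \<Longrightarrow> lk D v1 v + lk D v2 v = total_lk D v"
    and self_linking: "lk D v1 v1 + lk D v2 v1 + (lk D v1 v2 + lk D v2 v2) = 0"

text \<open>The line and the parabola meet at the abscissas \<open>-1/2\<close> and \<open>1/2\<close>, where the slopes of the parabola
  have opposite signs. So the two strands exchange their roles between the crossings.\<close>

lemma reid2_bigon_removal:
  assumes D: "virtual_diagram D" and D': "virtual_diagram D'" and r: "reid2 R D D'"
  obtains v1 v2 where "bigon_removal R D D' v1 v2"
proof -
  obtain h T w1 w2 where h: "plane_isotopic h" "R = region h" and ag: "agree_off R D D'" and st: "strands R D 2 T"
    and line: "\<forall>t\<in>T 0. Im (h (curve D t)) = 0"
    and parabola: "\<forall>t\<in>T 1. Im (h (curve D t)) = 2 * (Re (h (curve D t)))\<^sup>2 - 1 / 2"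
    and w: "w1 \<noteq> w2" "{w1, w2} \<subseteq> classical D" and dp: "double_points D \<inter> R = {w1, w2}"
    and ov: "(\<forall>t\<in>T 0. curve D t \<in> {w1, w2} \<longrightarrow> t \<in> over D) \<or> (\<forall>t\<in>T 0. curve D t \<in> {w1, w2} \<longrightarrow> t \<notin> over D)"
    and dp': "double_points D' \<inter> R = {}"
    using r unfolding reid2_def by (elim exE conjE) (rule that; assumption)
  have R: "closed R" unfolding h(2) by (rule plane_isotopic_closed_region[OF h(1)])
  obtain h' where "orientation_preserving h h'" using plane_isotopic_orientation[OF h(1)] .
  then interpret orientation_preserving h h' .
  obtain \<alpha> \<beta> where "strand_system R D 2 T \<alpha> \<beta>" by (rule strandsE[OF st])
  then interpret strand_system R D 2 T \<alpha> \<beta> .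
  note rem = removed_crossings[OF D D' R ag dp']
  have wR: "classical D \<inter> R = {w1, w2}" using dp w classical_double_points[OF D] by auto
  define X where "X t = Re (h (curve D t))" for t
  have lt0: "\<alpha> 0 < \<beta> 0" and lt1: "\<alpha> 1 < \<beta> 1" using lt by auto
  have g0: "((\<lambda>x. 0) has_real_derivative 0) (at x)" for x :: real by simp
  have g1: "((\<lambda>x. 2 * x\<^sup>2 - 1 / 2) has_real_derivative 4 * x) (at x)" for x :: real
    by (auto intro!: derivative_eq_intros)
  have gr0: "Im (h (curve D t)) = 0" if "t \<in> strand 0" for t using line interval_T(1)[of 0] that by auto
  have gr1: "Im (h (curve D t)) = 2 * (Re (h (curve D t)))\<^sup>2 - 1 / 2" if "t \<in> strand 1" for t
    using parabola interval_T(1)[of 1] that by auto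
  obtain e0 :: real where e0: "e0 = 1 \<or> e0 = -1"
    "\<And>s t. s \<in> strand 0 \<Longrightarrow> t \<in> strand 0 \<Longrightarrow> s < t \<Longrightarrow> e0 * Re (h (curve D s)) < e0 * Re (h (curve D t))"
    "\<And>t. t \<in> strand 0 \<Longrightarrow> \<exists>c>0. h' (curve D t) (vel D t) = Complex (c * e0) (c * e0 * 0)"
    using graph_strand[OF D lt0 g0 gr0] by metis
  obtain e1 :: real where e1: "e1 = 1 \<or> e1 = -1"
    "\<And>s t. s \<in> strand 1 \<Longrightarrow> t \<in> strand 1 \<Longrightarrow> s < t \<Longrightarrow> e1 * Re (h (curve D s)) < e1 * Re (h (curve D t))"
    "\<And>t. t \<in> strand 1 \<Longrightarrow> \<exists>c>0. h' (curve D t) (vel D t) = Complex (c * e1) (c * e1 * (4 * Re (h (curve D t))))"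
    using graph_strand[OF D lt1 g1 gr1] by metis
  have inj: "s = t" if "i < 2" "s \<in> strand i" "t \<in> strand i" "curve D s = curve D t" for i s t
  proof -
    have "i = 0 \<or> i = 1" using that(1) by auto
    then show ?thesis
      using that e0(2)[of s t] e0(2)[of t s] e1(2)[of s t] e1(2)[of t s] by (metis less_irrefl not_less_iff_gr_or_eq)
  qed
  have cross: "\<exists>s t. s \<in> strand 0 \<and> t \<in> strand 1 \<and>
      (if e0 * e1 * Re (h v) > 0 then same_mod_1 s (ne_param D v) \<and> same_mod_1 t (nw_param D v)
       else same_mod_1 s (nw_param D v) \<and> same_mod_1 t (ne_param D v))"
    and height: "Im (h v) = 0" "\<bar>Re (h v)\<bar> = 1 / 2" if v: "v \<in> {w1, w2}" for v
  proof -
    have vc: "v \<in> classical D" "v \<in> R" using v wR by auto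
    obtain i j s t where ij: "i < 2" "j < 2" "i \<noteq> j" "s \<in> strand i" "t \<in> strand j"
      "same_mod_1 s (ne_param D v)" "same_mod_1 t (nw_param D v)"
      by (rule crossing_strands[OF D vc inj])
    have cst: "curve D s = v" "curve D t = v"
      using same_mod_1_curve(1)[OF D ij(6)] same_mod_1_curve(1)[OF D ij(7)] curve_params[OF D vc(1)] by auto
    have det: "det2 (vel D s) (vel D t) > 0"
      using det2_params[OF D vc(1)] same_mod_1_curve(2)[OF D ij(6)] same_mod_1_curve(2)[OF D ij(7)] by simp
    obtain s0 s1 where s01: "s0 \<in> strand 0" "s1 \<in> strand 1" "s0 = s \<and> s1 = t \<or> s0 = t \<and> s1 = s"
    proof (cases "i = 0")
      case True
      then have "i = 0" "j = 1" using ij(2,3) by auto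
      then show thesis using ij(4,5) that[of s t] by auto
    next
      case False
      then have "i = 1" "j = 0" using ij(1-3) by auto
      then show thesis using ij(4,5) that[of t s] by auto
    qed
    have c01: "curve D s0 = v" "curve D s1 = v" using s01 cst by auto
    show im: "Im (h v) = 0" using gr0[OF s01(1)] c01 by simp
    have "2 * (Re (h v))\<^sup>2 - 1 / 2 = 0" using gr1[OF s01(2)] c01 im by simp
    then have "(Re (h v))\<^sup>2 = (1 / 2)\<^sup>2" by (simp add: power2_eq_square)
    then have "\<bar>Re (h v)\<bar> = \<bar>1 / 2\<bar>" unfolding power2_eq_iff by auto
    then show "\<bar>Re (h v)\<bar> = 1 / 2" by simp
    obtain c0 c1 where c: "c0 > 0" "h' (curve D s0) (vel D s0) = Complex (c0 * e0) (c0 * e0 * 0)"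
      "c1 > 0" "h' (curve D s1) (vel D s1) = Complex (c1 * e1) (c1 * e1 * (4 * Re (h (curve D s1))))"
      using e0(3)[OF s01(1)] e1(3)[OF s01(2)] by blast
    have "sgn (det2 (vel D s0) (vel D s1)) = sgn (e0 * e1 * (4 * Re (h (curve D s1)) - 0))"
      using graph_crossing_sign[OF _ c] c01 by simp
    moreover have "e0 * e1 * (4 * Re (h (curve D s1)) - 0) = 4 * (e0 * e1 * Re (h v))" using c01 by simp
    ultimately have "sgn (det2 (vel D s0) (vel D s1)) = sgn (4 * (e0 * e1 * Re (h v)))" by (simp only:)
    then have "det2 (vel D s0) (vel D s1) > 0 \<longleftrightarrow> 4 * (e0 * e1 * Re (h v)) > 0" by (metis sgn_greater)
    then have "det2 (vel D s0) (vel D s1) > 0 \<longleftrightarrow> e0 * e1 * Re (h v) > 0" by (simp add: mult.assoc)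
    then have "s0 = s \<and> s1 = t \<longleftrightarrow> e0 * e1 * Re (h v) > 0"
      using s01(3) det det2_antisym[of "vel D s" "vel D t"] disj[of 0 1 s0] interval_T(1)[of 0 s0] interval_T(1)[of 1 s1] s01
      by auto
    then show "\<exists>s t. s \<in> strand 0 \<and> t \<in> strand 1 \<and>
      (if e0 * e1 * Re (h v) > 0 then same_mod_1 s (ne_param D v) \<and> same_mod_1 t (nw_param D v)
       else same_mod_1 s (nw_param D v) \<and> same_mod_1 t (ne_param D v))"
      using s01 ij by (intro exI[of _ s0] exI[of _ s1]) auto
  qed
  have "h w1 \<noteq> h w2" using w(1) inj_h by (auto dest: injD)
  then have Re12: "Re (h w1) = - Re (h w2)"
    using height[of w1] height[of w2] by (auto simp: complex_eq_iff abs_if split: if_splits)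
  have "e0 * e1 * Re (h w2) \<noteq> 0" using e0(1) e1(1) height(2)[of w2] by auto
  moreover have "e0 * e1 * Re (h w1) = - (e0 * e1 * Re (h w2))" unfolding Re12 by simp
  ultimately have sg: "e0 * e1 * Re (h w1) > 0 \<longleftrightarrow> \<not> e0 * e1 * Re (h w2) > 0" by linarith
  \<comment> \<open>at \<open>v1\<close> the straight strand is SW--NE, at \<open>v2\<close> it is SE--NW\<close>
  obtain v1 v2 where v12: "{v1, v2} = {w1, w2}" "e0 * e1 * Re (h v1) > 0" "\<not> e0 * e1 * Re (h v2) > 0"
    using sg by (metis insert_commute)
  have vne: "v1 \<noteq> v2" using v12 by auto
  have v1: "v1 \<in> classical D" "v1 \<in> {w1, w2}" and v2: "v2 \<in> classical D" "v2 \<in> {w1, w2}" using v12 w by auto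
  have vR: "classical D \<inter> R = {v1, v2}" using wR v12 by simp
  have ch: "classical D = insert v1 (insert v2 (classical D'))" and notin: "v1 \<notin> classical D'" "v2 \<notin> classical D'"
    using vR unfolding rem(1) by auto
  obtain a1 b1 where ab1: "a1 \<in> strand 0" "b1 \<in> strand 1" "same_mod_1 a1 (ne_param D v1)" "same_mod_1 b1 (nw_param D v1)"
    using cross[OF v1(2)] v12 by auto
  obtain a2 b2 where ab2: "a2 \<in> strand 0" "b2 \<in> strand 1" "same_mod_1 a2 (nw_param D v2)" "same_mod_1 b2 (ne_param D v2)"
    using cross[OF v2(2)] v12 by auto
  have T0: "a1 \<in> T 0" "a2 \<in> T 0" using interval_T(1)[of 0] ab1 ab2 by auto
  have ca: "curve D a1 = v1" "curve D a2 = v2"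
    using same_mod_1_curve(1)[OF D ab1(3)] same_mod_1_curve(1)[OF D ab2(3)] curve_params[OF D v1(1)] curve_params[OF D v2(1)]
    by auto
  have "a1 \<in> over D \<longleftrightarrow> a2 \<in> over D" using ov T0 ca v1 v2 by metis
  then have wr: "writhe D v1 = 1 \<longleftrightarrow> \<not> writhe D v2 = 1"
    unfolding writhe_iff[OF D v1(1)] writhe_iff[OF D v2(1)]
    using same_mod_1_curve(3)[OF D ab1(3)] same_mod_1_curve(3)[OF D ab2(3)] over_params[OF D v2(1)] by auto
  define G where "G = (gauss D)\<lparr>lpar := (nw_param D)(v1 := b1, v2 := a2), rpar := (ne_param D)(v1 := a1, v2 := b2)\<rparr>"
  have Gs: "chords G = insert v1 (insert v2 (classical D'))" "lpar G v1 = b1" "rpar G v1 = a1" "lpar G v2 = a2" "rpar G v2 = b2"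
    "pos G v \<longleftrightarrow> writhe D v = 1"
    "v \<in> classical D' \<Longrightarrow> lpar G v = nw_param D v \<and> rpar G v = ne_param D v" for v
    unfolding G_def using ch notin vne by auto
  have sm: "same_mod_1 (((nw_param D)(v1 := b1, v2 := a2)) w) (nw_param D w)"
    "same_mod_1 (((ne_param D)(v1 := a1, v2 := b2)) w) (ne_param D w)" for w
    using ab1 ab2 by simp_all
  note link = choose_lifts[OF sm, folded G_def]
  have off: "off (\<alpha> i) (\<beta> i) (ne_param D w)" "off (\<alpha> i) (\<beta> i) (nw_param D w)" if "w \<in> classical D'" "i < 2" for w i
    using param_off[OF D, of w i] that rem(1) by auto
  have avA: "avoids G (classical D') a1 a2" and avB: "avoids G (classical D') b1 b2"
    unfolding avoids_def using off_unsep[OF off(1) ab1(1) ab2(1)] off_unsep[OF off(2) ab1(1) ab2(1)]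
      off_unsep[OF off(1) ab1(2) ab2(2)] off_unsep[OF off(2) ab1(2) ab2(2)] Gs by auto
  obtain k where k: "\<And>x y. x \<in> strand 0 \<Longrightarrow> y \<in> strand 1 \<Longrightarrow> gap k y x"
    by (rule off_gap[of "\<alpha> 0" "\<beta> 0" "\<alpha> 1" "\<beta> 1"]) (use other_off[of 0 1] other_off[of 1 0] lt0 lt1 in auto)
  have G': "chords (gauss D') = classical D'"
    "\<And>w. w \<in> classical D' \<Longrightarrow> lpar (gauss D') w = lpar G w \<and> rpar (gauss D') w = rpar G w \<and> pos (gauss D') w = pos G w"
    using rem(3) Gs by auto
  interpret M: second_move G "gauss D'" "classical D'" v1 v2 k
    by unfold_locales (use Gs finite_classical[OF D'] vne notin wr avA avB k ab1(1,2) ab2(1,2) G' in auto)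
  have in_D: "v \<in> classical D" if "v \<in> classical D'" for v using ch that by auto
  have "bigon_removal R D D' v1 v2"
  proof (unfold_locales, fact vR, fact vne, fact ch, fact notin(1), fact notin(2), fact rem(2))
    show "lk D u v = lk D' u v" if "u \<in> classical D'" "v \<in> classical D'" for u v
      using link(1)[OF in_D in_D] M.linking_survives that by simp
    show "total_lk D v = total_lk D' v" if "v \<in> classical D'" for v
      using link(2)[OF in_D] M.total_survives that by simp
    show "signed_half D v c = signed_half D' v c'"
      if c: "(c, c') \<in> arc_corr R D D'" and v: "v \<in> classical D'" for c c' v
      by (rule surviving_half[OF D D' c in_D[OF v] v rem(3)[OF v]])
    show "lk D u v1 + lk D u v2 = 0" if "u \<in> classical D'" for u
      using link(1)[OF in_D[OF that]] M.linking_cancels that v1(1) v2(1) by simp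
    show "total_lk D v1 + total_lk D v2 = 0"
      using link(2) M.total_cancels v1(1) v2(1) by simp
    show "signed_half D v1 c + signed_half D v2 c = 0" if c: "(c, c') \<in> arc_corr R D D'" for c c'
    proof (rule arc_corr_half[OF D D' c])
      fix t assume t: "curve D t \<notin> R"
        and h: "\<And>v. v \<in> classical D \<Longrightarrow> signed_half D v c = after (gauss D) v t"
      have "unsep t a1 a2" "unsep t b1 b2"
        using t outside_off[of t] off_unsep[of "\<alpha> 0" "\<beta> 0" t a1 a2] off_unsep[of "\<alpha> 1" "\<beta> 1" t b1 b2] ab1 ab2 by auto
      then show ?thesis using M.halves_cancel[of t] h[OF v1(1)] h[OF v2(1)] unfolding link(3) Gs by simp
    qed
    show "lk D v1 v + lk D v2 v = total_lk D v" if "v \<in> classical D'" for v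
      using link(1)[OF _ in_D[OF that]] link(2)[OF in_D[OF that]] M.paths_whole that v1(1) v2(1) by simp
    show "lk D v1 v1 + lk D v2 v1 + (lk D v1 v2 + lk D v2 v2) = 0"
      using link(1) M.self_linking v1(1) v2(1) by simp
  qed
  then show thesis by (rule that)
qed

section \<open>The picture of a third move\<close>

text \<open>The graphs on which the three strands lie, with \<open>\<kappa> = -1\<close> before the move and \<open>\<kappa> = 1\<close> after it, and below
  their slopes and the largest abscissas they reach in the unit disc.\<close>

definition graph_fun :: "real \<Rightarrow> nat \<Rightarrow> real \<Rightarrow> real" where
  "graph_fun \<kappa> i x = (if i = 0 then x else if i = 1 then - x else \<kappa> * ((1 - x\<^sup>2)\<^sup>2 / 2))"

definition graph_slope :: "real \<Rightarrow> nat \<Rightarrow> real \<Rightarrow> real" where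
  "graph_slope \<kappa> i x = (if i = 0 then 1 else if i = 1 then - 1 else - 2 * \<kappa> * x * (1 - x\<^sup>2))"

definition half_width :: "nat \<Rightarrow> real" where
  "half_width i = (if i < 2 then sqrt (1 / 2) else 1)"

lemma graph_fun_deriv: "(graph_fun \<kappa> i has_real_derivative graph_slope \<kappa> i x) (at x)"
  unfolding graph_fun_def[abs_def] graph_slope_def
  by (auto intro!: derivative_eq_intros simp: power2_eq_square field_simps)

text \<open>For the third graph put \<open>y = 1 - x\<^sup>2\<close>. The equation becomes \<open>4 y = y\<^sup>4\<close>, and \<open>y \<le> 1\<close> excludes \<open>y\<^sup>3 = 4\<close>.\<close>

lemma graph_fun_circle:
  assumes \<kappa>: "\<kappa> = 1 \<or> \<kappa> = -1" and c: "x\<^sup>2 + (graph_fun \<kappa> i x)\<^sup>2 = 1"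
  shows "\<bar>x\<bar> = half_width i"
proof (cases "i < 2")
  case True
  then have "x\<^sup>2 = 1 / 2" using c unfolding graph_fun_def by (auto split: if_splits)
  then have "sqrt (x\<^sup>2) = sqrt (1 / 2)" by (simp only:)
  then show ?thesis using True unfolding half_width_def real_sqrt_abs by simp
next
  case False
  define y where "y = 1 - x\<^sup>2"
  have "(graph_fun \<kappa> i x)\<^sup>2 = (y\<^sup>2 / 2)\<^sup>2" using \<kappa> False unfolding graph_fun_def y_def by auto
  then have e: "y = (y\<^sup>2 / 2)\<^sup>2" using c unfolding y_def by simp
  have "y \<le> 1" unfolding y_def by simp
  have "0 \<le> y" by (subst e) simp
  have "y = 0"
  proof (rule ccontr)
    assume "y \<noteq> 0"
    moreover have "y * (4 - y * (y * y)) = 0" using e by (simp add: power2_eq_square algebra_simps)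
    ultimately have "4 = y * (y * y)" by simp
    moreover have "y * y \<le> 1 * 1" using \<open>y \<le> 1\<close> \<open>0 \<le> y\<close> by (intro mult_mono) auto
    then have "y * (y * y) \<le> 1 * 1" using \<open>y \<le> 1\<close> \<open>0 \<le> y\<close> by (intro mult_mono) auto
    ultimately show False by simp
  qed
  then have "x\<^sup>2 = 1" unfolding y_def by simp
  then have "\<bar>x\<bar> = 1" unfolding power2_eq_1_iff by auto
  then show ?thesis using False unfolding half_width_def by simp
qed

text \<open>Up to sign, the abscissa of the two crossings on the third strand.\<close>

lemma quartic_root: obtains q :: real where "0 < q" "q < 1" "q = (1 - q\<^sup>2)\<^sup>2 / 2"
proof -
  have c: "continuous_on {0..1} (\<lambda>q::real. q - (1 - q\<^sup>2)\<^sup>2 / 2)" by (intro continuous_intros) auto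
  obtain q :: real where q: "0 \<le> q" "q \<le> 1" "q - (1 - q\<^sup>2)\<^sup>2 / 2 = 0"
    using IVT'[of "\<lambda>q. q - (1 - q\<^sup>2)\<^sup>2 / 2" 0 0 1, OF _ _ _ c] by auto
  moreover have "q \<noteq> 0" "q \<noteq> 1" using q(3) by auto
  ultimately show thesis by (intro that[of q]) auto
qed

lemma quartic_root_unique:
  fixes x q :: real
  assumes q: "0 < q" "q < 1" "q = (1 - q\<^sup>2)\<^sup>2 / 2" and x: "x = (1 - x\<^sup>2)\<^sup>2 / 2" "\<bar>x\<bar> \<le> 1"
  shows "x = q"
proof -
  have x0: "0 \<le> x" using x(1) by (metis divide_nonneg_nonneg zero_le_numeral zero_le_power2)
  have mono: "(1 - t\<^sup>2)\<^sup>2 / 2 \<le> (1 - s\<^sup>2)\<^sup>2 / 2" if "0 \<le> s" "s \<le> t" "t \<le> 1" for s t :: real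
  proof -
    have "s\<^sup>2 \<le> t\<^sup>2" using that by (intro power_mono) auto
    moreover have "t\<^sup>2 \<le> 1" using that by (simp add: power_le_one)
    ultimately show ?thesis by (auto intro!: power_mono divide_right_mono)
  qed
  show ?thesis
  proof (cases "x \<le> q")
    case True
    then show ?thesis using mono[OF x0 True less_imp_le[OF q(2)]] q(3) x(1) by linarith
  next
    case False
    then have "q \<le> x" "x \<le> 1" using x(2) by auto
    then show ?thesis using mono[OF less_imp_le[OF q(1)]] q(3) x(1) by force
  qed
qed

text \<open>With \<open>q\<close> the root in \<open>quartic_root\<close>, the abscissa of the crossing of the strands \<open>i\<close> and \<open>j\<close>. For two different
  numbers below \<open>3\<close> the sum identifies the pair.\<close>

definition crossing_abscissa :: "real \<Rightarrow> real \<Rightarrow> nat \<Rightarrow> nat \<Rightarrow> real" where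
  "crossing_abscissa \<kappa> q i j = (if i + j = 1 then 0 else if i + j = 2 then \<kappa> * q else - \<kappa> * q)"

lemma graph_fun_cross:
  assumes \<kappa>: "\<kappa> = 1 \<or> \<kappa> = -1" and q: "0 < q" "q < 1" "q = (1 - q\<^sup>2)\<^sup>2 / 2"
    and ij: "i < 3" "j < 3" "i \<noteq> j" and x: "\<bar>x\<bar> \<le> 1"
  shows "graph_fun \<kappa> i x = graph_fun \<kappa> j x \<longleftrightarrow> x = crossing_abscissa \<kappa> q i j"
proof -
  have r: "y = (1 - y\<^sup>2)\<^sup>2 / 2 \<longleftrightarrow> y = q" if "\<bar>y\<bar> \<le> 1" for y
    using quartic_root_unique[OF q _ that] q by blast
  have sq: "(\<kappa> * x)\<^sup>2 = x\<^sup>2" using \<kappa> by auto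
  have 1: "x = \<kappa> * ((1 - x\<^sup>2)\<^sup>2 / 2) \<longleftrightarrow> x = \<kappa> * q"
    using r[of "\<kappa> * x"] x \<kappa> by (auto simp: sq)
  have 2: "- x = \<kappa> * ((1 - x\<^sup>2)\<^sup>2 / 2) \<longleftrightarrow> x = - \<kappa> * q"
    using r[of "- \<kappa> * x"] x \<kappa> by (auto simp: sq)
  have "(i = 0 \<and> j = 1) \<or> (i = 1 \<and> j = 0) \<or> (i = 0 \<and> j = 2) \<or> (i = 2 \<and> j = 0) \<or> (i = 1 \<and> j = 2) \<or> (i = 2 \<and> j = 1)"
    using ij by arith
  then show ?thesis
    using 1 2 by (elim disjE) (auto simp: graph_fun_def crossing_abscissa_def)
qed

text \<open>One side of a third move. The sign \<open>\<kappa>\<close> tells the two sides apart, so that every statement below holds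
  before and after the move.\<close>

locale triangle_picture = orientation_preserving h h' + strand_system R D 3 T \<alpha> \<beta>
  for h :: "complex \<Rightarrow> complex" and h' R D T \<alpha> \<beta> +
  fixes ht :: "nat \<Rightarrow> nat" and \<kappa> q :: real
  assumes D: "virtual_diagram D" and R: "R = region h"
    and graph: "\<And>i t. i < 3 \<Longrightarrow> t \<in> T i \<Longrightarrow> Im (h (curve D t)) = graph_fun \<kappa> i (Re (h (curve D t)))"
    and ht: "inj_on ht {..<3}" "heights T ht D"
    and \<kappa>: "\<kappa> = 1 \<or> \<kappa> = -1" and q: "0 < q" "q < 1" "q = (1 - q\<^sup>2)\<^sup>2 / 2"
begin

definition abscissa :: "real \<Rightarrow> real" where "abscissa t = Re (h (curve D t))"

text \<open>The direction of the strand, read off from its starting point: \<open>1\<close> from left to right and \<open>-1\<close> from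
  right to left. Defined this way it is visibly the same before and after the move.\<close>

definition dir :: "nat \<Rightarrow> real" where "dir i = - abscissa (\<alpha> i) / half_width i"

lemma half_width_pos: "half_width i > 0"
  unfolding half_width_def by simp

lemma strand_data:
  assumes i: "i < 3"
  shows dir: "dir i = 1 \<or> dir i = -1"
    and increasing: "s \<in> strand i \<Longrightarrow> t \<in> strand i \<Longrightarrow> s < t \<Longrightarrow> dir i * abscissa s < dir i * abscissa t"
    and velocity: "t \<in> strand i \<Longrightarrow> \<exists>c>0. h' (curve D t) (vel D t) =
      Complex (c * dir i) (c * dir i * graph_slope \<kappa> i (abscissa t))"
    and covers: "x \<in> {- half_width i..half_width i} \<Longrightarrow> \<exists>t\<in>strand i. abscissa t = x"
proof -
  have ab: "\<alpha> i < \<beta> i" using lt i by auto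
  have gr: "Im (h (curve D t)) = graph_fun \<kappa> i (Re (h (curve D t)))" if "t \<in> strand i" for t
    using graph[OF i] interval_T(1)[OF i that] by blast
  have circ: "\<bar>abscissa t\<bar> = half_width i" if "t \<in> strand i" "norm (h (curve D t)) = 1" for t
  proof (rule graph_fun_circle[OF \<kappa>])
    have "(Re (h (curve D t)))\<^sup>2 + (Im (h (curve D t)))\<^sup>2 = 1"
      using that(2) by (simp add: cmod_def)
    then show "(abscissa t)\<^sup>2 + (graph_fun \<kappa> i (abscissa t))\<^sup>2 = 1"
      unfolding gr[OF that(1)] abscissa_def .
  qed
  have ends: "\<bar>abscissa (\<alpha> i)\<bar> = half_width i" "\<bar>abscissa (\<beta> i)\<bar> = half_width i"
    using circ frontier_limit[OF D i R cont] ab by auto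
  obtain e :: real where e: "e = 1 \<or> e = -1"
    "\<And>s t. s \<in> strand i \<Longrightarrow> t \<in> strand i \<Longrightarrow> s < t \<Longrightarrow> e * Re (h (curve D s)) < e * Re (h (curve D t))"
    "\<And>t. t \<in> strand i \<Longrightarrow> \<exists>c>0. h' (curve D t) (vel D t) = Complex (c * e) (c * e * graph_slope \<kappa> i (Re (h (curve D t))))"
    by (rule graph_strand[OF D ab graph_fun_deriv gr]) blast+
  have ct: "continuous_on (strand i) abscissa"
  proof -
    have "continuous_on (strand i) (curve D)"
      by (intro continuous_at_imp_continuous_on ballI has_vector_derivative_continuous[OF has_vel[OF D]])
    then have "continuous_on (strand i) (\<lambda>t. h (curve D t))"
      by (rule continuous_on_compose2[OF cont]) simp
    then show ?thesis unfolding abscissa_def[abs_def] by (intro continuous_intros)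
  qed
  have lt: "e * abscissa (\<alpha> i) < e * abscissa (\<beta> i)"
    unfolding abscissa_def using e(2) ab by simp
  note cov = graph_strand_covers[OF ab ct e(1) lt ends]
  have de: "dir i = e" unfolding dir_def cov(1) using half_width_pos[of i] by simp
  show "dir i = 1 \<or> dir i = -1" using e(1) de by simp
  show "dir i * abscissa s < dir i * abscissa t" if "s \<in> strand i" "t \<in> strand i" "s < t"
    unfolding de abscissa_def using e(2) that by blast
  show "\<exists>c>0. h' (curve D t) (vel D t) = Complex (c * dir i) (c * dir i * graph_slope \<kappa> i (abscissa t))"
    if "t \<in> strand i" unfolding de abscissa_def using e(3) that by blast
  show "\<exists>t\<in>strand i. abscissa t = x" if "x \<in> {- half_width i..half_width i}" using cov(4) that by blast
qed

definition param :: "nat \<Rightarrow> real \<Rightarrow> real" where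
  "param i x = (SOME t. t \<in> strand i \<and> abscissa t = x)"

lemma param:
  assumes "i < 3" "x \<in> {- half_width i..half_width i}"
  shows "param i x \<in> strand i" "abscissa (param i x) = x"
proof -
  have "\<exists>t. t \<in> strand i \<and> abscissa t = x" using covers[OF assms] by blast
  from someI_ex[OF this] show "param i x \<in> strand i" "abscissa (param i x) = x" unfolding param_def by auto
qed

lemma abscissa_inj:
  assumes "i < 3" "s \<in> strand i" "t \<in> strand i" "abscissa s = abscissa t"
  shows "s = t"
  using increasing[OF assms(1-3)] increasing[OF assms(1,3,2)] assms(4) by (metis less_irrefl linorder_less_linear)

lemma param_less:
  assumes i: "i < 3" and x: "x \<in> {- half_width i..half_width i}" and y: "y \<in> {- half_width i..half_width i}"
  shows "param i x < param i y \<longleftrightarrow> dir i * x < dir i * y"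
  using increasing[OF i param(1)[OF i x] param(1)[OF i y]] increasing[OF i param(1)[OF i y] param(1)[OF i x]]
    param(2)[OF i x] param(2)[OF i y] by (metis less_asym linorder_less_linear)

lemma h_curve:
  assumes "i < 3" "t \<in> strand i"
  shows "h (curve D t) = Complex (abscissa t) (graph_fun \<kappa> i (abscissa t))"
  using graph[OF assms(1) interval_T(1)[OF assms]] unfolding abscissa_def by (simp add: complex_eq_iff)

lemma curve_inj:
  assumes "i < 3" "s \<in> strand i" "t \<in> strand i" "curve D s = curve D t"
  shows "s = t"
  using abscissa_inj[OF assms(1-3)] assms(4) unfolding abscissa_def by simp

abbreviation cr :: "nat \<Rightarrow> nat \<Rightarrow> real" where "cr \<equiv> crossing_abscissa \<kappa> q"

lemma cr_commute: "cr i j = cr j i"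
  unfolding crossing_abscissa_def by (simp add: add.commute)

lemma q_half: "q \<le> 1 / 2"
proof -
  have "(1 - q\<^sup>2)\<^sup>2 \<le> 1" using q(1,2) by (simp add: power_le_one abs_square_le_1)
  then show ?thesis using q(3) by linarith
qed

text \<open>Every strand reaches beyond \<open>1/2\<close> on both sides, so it meets the other two.\<close>

lemma cr_range: "cr i j \<in> {- half_width k..half_width k}" "\<bar>cr i j\<bar> \<le> 1"
proof -
  have "\<bar>cr i j\<bar> \<le> 1 / 2" using \<kappa> q q_half unfolding crossing_abscissa_def by auto
  moreover have "1 / 2 \<le> half_width k"
  proof -
    have "1 / 2 = sqrt (1 / 4 :: real)" by (simp add: real_sqrt_divide)
    also have "\<dots> \<le> sqrt (1 / 2)" by (rule real_sqrt_le_mono) simp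
    finally show ?thesis unfolding half_width_def by auto
  qed
  ultimately show "cr i j \<in> {- half_width k..half_width k}" "\<bar>cr i j\<bar> \<le> 1" by auto
qed

text \<open>The parameter, on the strand \<open>i\<close>, of its crossing with the strand \<open>j\<close>.\<close>

definition vtx :: "nat \<Rightarrow> nat \<Rightarrow> real" where "vtx i j = param i (cr i j)"

lemma vtx_in: "i < 3 \<Longrightarrow> vtx i j \<in> strand i" "i < 3 \<Longrightarrow> abscissa (vtx i j) = cr i j"
  unfolding vtx_def using param[OF _ cr_range(1)] by auto

definition vertex :: "nat \<Rightarrow> nat \<Rightarrow> complex" where "vertex i j = curve D (vtx i j)"

lemma vertex_commute:
  assumes "i < 3" "j < 3" "i \<noteq> j"
  shows "vertex j i = vertex i j"
proof -
  have "graph_fun \<kappa> i (cr i j) = graph_fun \<kappa> j (cr i j)"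
    using graph_fun_cross[OF \<kappa> q assms cr_range(2)[of i j]] by simp
  then have "h (vertex j i) = h (vertex i j)"
    unfolding vertex_def using h_curve[OF assms(1) vtx_in(1)[OF assms(1)]] h_curve[OF assms(2) vtx_in(1)[OF assms(2)]]
      vtx_in(2) assms cr_commute[of i j] by simp
  then show ?thesis using inj_h by (simp add: inj_eq)
qed

lemma meet:
  assumes ij: "i < 3" "j < 3" "i \<noteq> j" and s: "s \<in> strand i" and t: "t \<in> strand j" and eq: "curve D s = curve D t"
  shows "s = vtx i j" "t = vtx j i"
proof -
  have ab: "abscissa s = abscissa t" unfolding abscissa_def eq ..
  have "graph_fun \<kappa> i (abscissa s) = graph_fun \<kappa> j (abscissa s)"
    using h_curve[OF ij(1) s, unfolded eq] h_curve[OF ij(2) t] unfolding ab by (metis complex.sel(2))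
  moreover have "\<bar>abscissa s\<bar> \<le> 1"
  proof -
    have "norm (h (curve D s)) \<le> 1" using interval_T(2)[OF ij(1) s] unfolding R region_def by simp
    then show ?thesis unfolding abscissa_def using abs_Re_le_cmod order_trans by blast
  qed
  ultimately have "abscissa s = cr i j" using graph_fun_cross[OF \<kappa> q ij] by blast
  then show "s = vtx i j" "t = vtx j i"
    using abscissa_inj[OF ij(1) s vtx_in(1)[OF ij(1)]] abscissa_inj[OF ij(2) t vtx_in(1)[OF ij(2)]]
      vtx_in(2)[OF ij(1)] vtx_in(2)[OF ij(2)] ab cr_commute[of i j] by auto
qed

text \<open>The heights decide which strand is above, so the signs agree before and after the move once the roles
  of the strands do.\<close>

lemma vertex_over:
  assumes ij: "i < 3" "j < 3" "i \<noteq> j"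
  shows "vtx i j \<in> over D \<longleftrightarrow> ht j < ht i"
proof -
  have c: "curve D (vtx i j) = curve D (vtx j i)" using vertex_commute[OF ij] unfolding vertex_def by simp
  have T: "vtx i j \<in> T i" "vtx j i \<in> T j" using interval_T(1) vtx_in(1) ij by blast+
  have "ht i \<noteq> ht j" using ht(1) ij by (auto simp: inj_on_def)
  then consider "ht i < ht j" | "ht j < ht i" by linarith
  then show ?thesis
    using ht(2) ij T c unfolding heights_def by cases (metis less_asym)+
qed

lemma vertex_classical:
  assumes ij: "i < 3" "j < 3" "i \<noteq> j"
  shows "vertex i j \<in> classical D" "vertex i j \<in> R"
proof -
  have "ht i \<noteq> ht j" using ht(1) ij by (auto simp: inj_on_def)
  then have "vtx i j \<in> over D \<or> vtx j i \<in> over D"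
    using vertex_over[OF ij] vertex_over[OF ij(2,1) ij(3)[symmetric]] by linarith
  then show "vertex i j \<in> classical D"
    unfolding classical_def using vertex_commute[OF ij] unfolding vertex_def by (metis imageI)
  show "vertex i j \<in> R" unfolding vertex_def using interval_T(2)[OF ij(1) vtx_in(1)[OF ij(1)]] .
qed

lemma classical_vertex:
  assumes "v \<in> classical D" "v \<in> R"
  obtains i j where "i < 3" "j < 3" "i \<noteq> j" "v = vertex i j"
proof -
  obtain i j s t where ij: "i < 3" "j < 3" "i \<noteq> j" "s \<in> strand i" "t \<in> strand j"
    "same_mod_1 s (ne_param D v)" "same_mod_1 t (nw_param D v)"
    by (rule crossing_strands[OF D assms curve_inj])
  have c: "curve D s = v" "curve D t = v"
    using same_mod_1_curve(1)[OF D ij(6)] same_mod_1_curve(1)[OF D ij(7)] curve_params[OF D assms(1)] by auto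
  then have "s = vtx i j" using meet(1)[OF ij(1-5)] by simp
  then show thesis using that[OF ij(1-3)] c unfolding vertex_def by simp
qed

lemma vertex_set: "classical D \<inter> R = {vertex 0 1, vertex 1 2, vertex 2 0}"
proof
  show "classical D \<inter> R \<subseteq> {vertex 0 1, vertex 1 2, vertex 2 0}"
  proof
    fix v assume "v \<in> classical D \<inter> R"
    then obtain i j where ij: "i < 3" "j < 3" "i \<noteq> j" "v = vertex i j" using classical_vertex by blast
    have "(i = 0 \<and> j = 1) \<or> (i = 1 \<and> j = 0) \<or> (i = 0 \<and> j = 2) \<or> (i = 2 \<and> j = 0) \<or> (i = 1 \<and> j = 2) \<or> (i = 2 \<and> j = 1)"
      using ij by arith
    then show "v \<in> {vertex 0 1, vertex 1 2, vertex 2 0}"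
      using ij(4) vertex_commute[of 0 1] vertex_commute[of 0 2] vertex_commute[of 1 2] by auto
  qed
  show "{vertex 0 1, vertex 1 2, vertex 2 0} \<subseteq> classical D \<inter> R"
    using vertex_classical by simp
qed

lemma vertex_distinct: "vertex 0 1 \<noteq> vertex 1 2" "vertex 1 2 \<noteq> vertex 2 0" "vertex 0 1 \<noteq> vertex 2 0"
proof -
  have r: "Re (h (vertex i j)) = cr i j" if "i < 3" for i j
    using vtx_in(2)[OF that] unfolding vertex_def abscissa_def .
  have "cr 0 1 \<noteq> cr 1 2" "cr 1 2 \<noteq> cr 2 0" "cr 0 1 \<noteq> cr 2 0"
    using \<kappa> q(1) unfolding crossing_abscissa_def by auto
  then show "vertex 0 1 \<noteq> vertex 1 2" "vertex 1 2 \<noteq> vertex 2 0" "vertex 0 1 \<noteq> vertex 2 0"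
    using r[of 0 1] r[of 1 2] r[of 2 0] by auto
qed

lemma vertex_sign:
  assumes ij: "i < 3" "j < 3" "i \<noteq> j"
  shows "sgn (det2 (vel D (vtx i j)) (vel D (vtx j i))) =
    sgn (dir i * dir j * (graph_slope \<kappa> j (cr i j) - graph_slope \<kappa> i (cr i j)))"
proof -
  have c: "curve D (vtx i j) = curve D (vtx j i)" using vertex_commute[OF ij] unfolding vertex_def by simp
  obtain c1 where c1: "c1 > 0" "h' (curve D (vtx i j)) (vel D (vtx i j)) =
      Complex (c1 * dir i) (c1 * dir i * graph_slope \<kappa> i (cr i j))"
    using velocity[OF ij(1) vtx_in(1)[OF ij(1)], of j] unfolding vtx_in(2)[OF ij(1)] by blast
  obtain c2 where c2: "c2 > 0" "h' (curve D (vtx j i)) (vel D (vtx j i)) =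
      Complex (c2 * dir j) (c2 * dir j * graph_slope \<kappa> j (cr j i))"
    using velocity[OF ij(2) vtx_in(1)[OF ij(2)], of i] unfolding vtx_in(2)[OF ij(2)] by blast
  show ?thesis
    using graph_crossing_sign[OF c c1 c2] unfolding cr_commute[of j i] .
qed

lemma slopes:
  "graph_slope \<kappa> 1 (cr 0 1) - graph_slope \<kappa> 0 (cr 0 1) < 0"
  "graph_slope \<kappa> 2 (cr 1 2) - graph_slope \<kappa> 1 (cr 1 2) > 0"
  "graph_slope \<kappa> 0 (cr 2 0) - graph_slope \<kappa> 2 (cr 2 0) > 0"
proof -
  have q2: "q\<^sup>2 \<le> 1" using q by (simp add: power_le_one)
  have "0 \<le> q * (1 - q\<^sup>2)" using q q2 by simp
  then show "graph_slope \<kappa> 1 (cr 0 1) - graph_slope \<kappa> 0 (cr 0 1) < 0"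
    "graph_slope \<kappa> 2 (cr 1 2) - graph_slope \<kappa> 1 (cr 1 2) > 0"
    "graph_slope \<kappa> 0 (cr 2 0) - graph_slope \<kappa> 2 (cr 2 0) > 0"
    using \<kappa> unfolding graph_slope_def crossing_abscissa_def by (auto simp: algebra_simps)
qed

text \<open>Going around the triangle from the crossing of the strands \<open>2\<close> and \<open>0\<close> to that of \<open>0\<close> and \<open>1\<close> and on to that of \<open>1\<close>
  and \<open>2\<close>, the abscissa increases on the strands \<open>0\<close> and \<open>1\<close> and decreases on the strand \<open>2\<close> if
  \<open>\<kappa> = -1\<close>. Hence the opposite sign for the strand \<open>2\<close>.\<close>

definition "E0 \<longleftrightarrow> dir 0 = 1"
definition "E1 \<longleftrightarrow> dir 1 = 1"
definition "E2 \<longleftrightarrow> dir 2 = -1"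

lemma vertex_params_aux:
  assumes ij: "i < 3" "j < 3" "i \<noteq> j"
    and s: "e \<Longrightarrow> det2 (vel D (vtx i j)) (vel D (vtx j i)) < 0"
      "\<not> e \<Longrightarrow> det2 (vel D (vtx i j)) (vel D (vtx j i)) > 0"
  shows "same_mod_1 (nw_param D (vertex i j)) (lend e (vtx i j) (vtx j i))"
    "same_mod_1 (ne_param D (vertex i j)) (rend e (vtx i j) (vtx j i))"
proof -
  have c: "curve D (vtx i j) = vertex i j" "curve D (vtx j i) = vertex i j"
    using vertex_commute[OF ij] unfolding vertex_def by simp_all
  note p = params_eqI[OF D vertex_classical(1)[OF ij]]
  show "same_mod_1 (nw_param D (vertex i j)) (lend e (vtx i j) (vtx j i))"
    "same_mod_1 (ne_param D (vertex i j)) (rend e (vtx i j) (vtx j i))"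
    using p[OF c(1,2)] p[OF c(2,1)] s unfolding lend_def rend_def by (cases e; auto simp: det2_antisym[of "vel D (vtx j i)"])+
qed

lemma vertex_params:
  "same_mod_1 (nw_param D (vertex 0 1)) (lend (E0 = E1) (vtx 0 1) (vtx 1 0))"
  "same_mod_1 (ne_param D (vertex 0 1)) (rend (E0 = E1) (vtx 0 1) (vtx 1 0))"
  "same_mod_1 (nw_param D (vertex 1 2)) (lend (E1 = E2) (vtx 1 2) (vtx 2 1))"
  "same_mod_1 (ne_param D (vertex 1 2)) (rend (E1 = E2) (vtx 1 2) (vtx 2 1))"
  "same_mod_1 (nw_param D (vertex 2 0)) (lend (E2 = E0) (vtx 2 0) (vtx 0 2))"
  "same_mod_1 (ne_param D (vertex 2 0)) (rend (E2 = E0) (vtx 2 0) (vtx 0 2))"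
proof -
  have sg: "x > 0 \<longleftrightarrow> y > 0" "x < 0 \<longleftrightarrow> y < 0" if "sgn x = sgn y" for x y :: real
    using that by (metis sgn_greater) (metis sgn_less that)
  note s01 = sg[OF vertex_sign[of 0 1, simplified]] and s12 = sg[OF vertex_sign[of 1 2, simplified]]
    and s20 = sg[OF vertex_sign[of 2 0, simplified]]
  have d: "dir 0 = 1 \<or> dir 0 = -1" "dir 1 = 1 \<or> dir 1 = -1" "dir 2 = 1 \<or> dir 2 = -1" using dir by auto
  have 01: "E0 = E1 \<Longrightarrow> det2 (vel D (vtx 0 1)) (vel D (vtx 1 0)) < 0"
    "E0 \<noteq> E1 \<Longrightarrow> det2 (vel D (vtx 0 1)) (vel D (vtx 1 0)) > 0"
    using s01 slopes(1) d unfolding E0_def E1_def by auto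
  have 12: "E1 = E2 \<Longrightarrow> det2 (vel D (vtx 1 2)) (vel D (vtx 2 1)) < 0"
    "E1 \<noteq> E2 \<Longrightarrow> det2 (vel D (vtx 1 2)) (vel D (vtx 2 1)) > 0"
    using s12 slopes(2) d unfolding E1_def E2_def by auto
  have 20: "E2 = E0 \<Longrightarrow> det2 (vel D (vtx 2 0)) (vel D (vtx 0 2)) < 0"
    "E2 \<noteq> E0 \<Longrightarrow> det2 (vel D (vtx 2 0)) (vel D (vtx 0 2)) > 0"
    using s20 slopes(3) d unfolding E2_def E0_def by auto
  show "same_mod_1 (nw_param D (vertex 0 1)) (lend (E0 = E1) (vtx 0 1) (vtx 1 0))"
    "same_mod_1 (ne_param D (vertex 0 1)) (rend (E0 = E1) (vtx 0 1) (vtx 1 0))"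
    by (rule vertex_params_aux; use 01 in simp)+
  show "same_mod_1 (nw_param D (vertex 1 2)) (lend (E1 = E2) (vtx 1 2) (vtx 2 1))"
    "same_mod_1 (ne_param D (vertex 1 2)) (rend (E1 = E2) (vtx 1 2) (vtx 2 1))"
    by (rule vertex_params_aux; use 12 in simp)+
  show "same_mod_1 (nw_param D (vertex 2 0)) (lend (E2 = E0) (vtx 2 0) (vtx 0 2))"
    "same_mod_1 (ne_param D (vertex 2 0)) (rend (E2 = E0) (vtx 2 0) (vtx 0 2))"
    by (rule vertex_params_aux; use 20 in simp)+
qed

lemma orders:
  "ordered (E0 \<longleftrightarrow> \<kappa> = -1) (vtx 0 2) (vtx 0 1)"
  "ordered (E1 \<longleftrightarrow> \<kappa> = -1) (vtx 1 0) (vtx 1 2)"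
  "ordered (E2 \<longleftrightarrow> \<kappa> = -1) (vtx 2 1) (vtx 2 0)"
proof -
  have d: "dir 0 = 1 \<or> dir 0 = -1" "dir 1 = 1 \<or> dir 1 = -1" "dir 2 = 1 \<or> dir 2 = -1" using dir by auto
  have len: "s < t + 1" if "s \<in> strand i" "t \<in> strand i" "i < 3" for i s t using lt(2)[of i] that by auto
  have l: "vtx i j < vtx i k + 1" if "i < 3" for i j k
    by (rule len[OF vtx_in(1)[OF that] vtx_in(1)[OF that] that])
  have less: "vtx i j < vtx i k \<longleftrightarrow> dir i * cr i j < dir i * cr i k" if "i < 3" for i j k
    unfolding vtx_def by (rule param_less[OF that cr_range(1) cr_range(1)])
  have "vtx 0 2 < vtx 0 1 \<longleftrightarrow> (E0 \<longleftrightarrow> \<kappa> = -1)" "vtx 0 1 < vtx 0 2 \<longleftrightarrow> \<not> (E0 \<longleftrightarrow> \<kappa> = -1)"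
    "vtx 1 0 < vtx 1 2 \<longleftrightarrow> (E1 \<longleftrightarrow> \<kappa> = -1)" "vtx 1 2 < vtx 1 0 \<longleftrightarrow> \<not> (E1 \<longleftrightarrow> \<kappa> = -1)"
    "vtx 2 1 < vtx 2 0 \<longleftrightarrow> (E2 \<longleftrightarrow> \<kappa> = -1)" "vtx 2 0 < vtx 2 1 \<longleftrightarrow> \<not> (E2 \<longleftrightarrow> \<kappa> = -1)"
    using less d \<kappa> q(1) unfolding E0_def E1_def E2_def by (auto simp: crossing_abscissa_def)
  then show "ordered (E0 \<longleftrightarrow> \<kappa> = -1) (vtx 0 2) (vtx 0 1)" "ordered (E1 \<longleftrightarrow> \<kappa> = -1) (vtx 1 0) (vtx 1 2)"
    "ordered (E2 \<longleftrightarrow> \<kappa> = -1) (vtx 2 1) (vtx 2 0)"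
    unfolding ordered_def using l[of 0] l[of 1] l[of 2] by simp_all
qed

end

section \<open>The third move\<close>

lemma outgoing_side_shift:
  assumes D: "virtual_diagram D" and s: "same_mod_1 s s'"
  shows "outgoing_side R D s \<longleftrightarrow> outgoing_side R D s'"
proof -
  have imp: "outgoing_side R D s'" if sm: "same_mod_1 s s'" and out: "outgoing_side R D s" for s s'
  proof -
    obtain k :: int where k: "s = s' + k" using sm unfolding same_mod_1_def by blast
    obtain t where t: "s < t" "curve D ` {s..t} \<subseteq> R" "curve D t \<in> classical D"
      using out unfolding outgoing_side_def by blast
    have sh: "curve D (u + of_int k) = curve D u" for u by (rule curve_shift[OF D])
    have "curve D u \<in> R" if "u \<in> {s'..t - k}" for u
    proof -
      have "u + of_int k \<in> {s..t}" using that k by auto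
      then have "curve D (u + of_int k) \<in> R" using t(2) by blast
      then show ?thesis unfolding sh .
    qed
    moreover have "curve D (t - k) = curve D t" using sh[of "t - k"] by simp
    ultimately show ?thesis unfolding outgoing_side_def using t k by (intro exI[of _ "t - k"]) auto
  qed
  show ?thesis using imp s same_mod_1_sym by blast
qed

context triangle_picture
begin

lemma classical_on_strand:
  assumes i: "i < 3" and t: "t \<in> strand i" "curve D t \<in> classical D"
  obtains m where "m < 3" "m \<noteq> i" "t = vtx i m"
proof -
  obtain a b where ab: "a < 3" "b < 3" "a \<noteq> b" "curve D t = vertex a b"
    using classical_vertex[OF t(2) interval_T(2)[OF i t(1)]] by blast
  have c: "curve D t = curve D (vtx a b)" using ab(4) unfolding vertex_def .
  show thesis
  proof (cases "i = a")
    case True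
    then have "t = vtx i b" using curve_inj[OF i t(1) _ c] vtx_in(1)[OF i] by simp
    then show thesis using that[of b] ab True by simp
  next
    case False
    then have "t = vtx i a" using meet(1)[OF i ab(1) False t(1) vtx_in(1)[OF ab(1)] c] by simp
    then show thesis using that[of a] ab False by simp
  qed
qed

text \<open>Inside the disc the curve stays on one strand, so a crossing reached later there can only be the other
  vertex on that strand.\<close>

lemma outgoing_vtx:
  assumes ijk: "i < 3" "j < 3" "k < 3" "i \<noteq> j" "i \<noteq> k" "j \<noteq> k"
  shows "outgoing_side R D (vtx i j) \<longleftrightarrow> vtx i j < vtx i k"
proof
  assume "outgoing_side R D (vtx i j)"
  then obtain t where t: "vtx i j < t" "curve D ` {vtx i j..t} \<subseteq> R" "curve D t \<in> classical D"
    unfolding outgoing_side_def by blast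
  have "curve D ` closed_segment (vtx i j) t \<subseteq> R" using t(1,2) by (simp add: closed_segment_eq_real_ivl)
  then have "t \<in> strand i" by (rule stays[OF ijk(1) vtx_in(1)[OF ijk(1)]])
  then obtain m where "m < 3" "m \<noteq> i" "t = vtx i m" using classical_on_strand[OF ijk(1) _ t(3)] by blast
  moreover from this have "m \<noteq> j" using t(1) by auto
  ultimately have "m = k" "t = vtx i m" using ijk by auto
  then show "vtx i j < vtx i k" using t(1) by simp
next
  assume less: "vtx i j < vtx i k"
  have "curve D ` {vtx i j..vtx i k} \<subseteq> R"
    using segment_in_strand[OF ijk(1) vtx_in(1)[OF ijk(1)] vtx_in(1)[OF ijk(1)], of j k] less
    by (simp add: closed_segment_eq_real_ivl)
  moreover have "curve D (vtx i k) \<in> classical D"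
    using vertex_classical(1)[OF ijk(1,3,5)] unfolding vertex_def .
  ultimately show "outgoing_side R D (vtx i j)" unfolding outgoing_side_def using less by blast
qed

lemma eps_vertex_aux:
  assumes "same_mod_1 (nw_param D v) (lend e s t)" "same_mod_1 (ne_param D v) (rend e s t)"
  shows "eps_triangle R D v = sg (outgoing_side R D s \<noteq> outgoing_side R D t)"
  unfolding eps_triangle_def outgoing_side_shift[OF D assms(1)] outgoing_side_shift[OF D assms(2)] sg_def
  by (cases e) (auto simp: lend_def rend_def)

text \<open>Outgoing sides are those where the boundary orientation and the direction of the strand agree at the
  start of the side, or disagree at its end; so exactly one of two consecutive sides is outgoing
  at their common vertex iff both strands agree or both disagree with the boundary.\<close>

lemma eps_vertex:
  "eps_triangle R D (vertex 0 1) = sg (E0 = E1)"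
  "eps_triangle R D (vertex 1 2) = sg (E1 = E2)"
  "eps_triangle R D (vertex 2 0) = sg (E2 = E0)"
proof -
  have o: "outgoing_side R D (vtx 0 1) \<longleftrightarrow> vtx 0 1 < vtx 0 2" "outgoing_side R D (vtx 0 2) \<longleftrightarrow> vtx 0 2 < vtx 0 1"
    "outgoing_side R D (vtx 1 0) \<longleftrightarrow> vtx 1 0 < vtx 1 2" "outgoing_side R D (vtx 1 2) \<longleftrightarrow> vtx 1 2 < vtx 1 0"
    "outgoing_side R D (vtx 2 0) \<longleftrightarrow> vtx 2 0 < vtx 2 1" "outgoing_side R D (vtx 2 1) \<longleftrightarrow> vtx 2 1 < vtx 2 0"
    by (rule outgoing_vtx; simp)+
  show "eps_triangle R D (vertex 0 1) = sg (E0 = E1)"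
    unfolding eps_vertex_aux[OF vertex_params(1,2)] o using orders unfolding ordered_def
    by (auto intro!: arg_cong[where f = sg] split: if_splits)
  show "eps_triangle R D (vertex 1 2) = sg (E1 = E2)"
    unfolding eps_vertex_aux[OF vertex_params(3,4)] o using orders unfolding ordered_def
    by (auto intro!: arg_cong[where f = sg] split: if_splits)
  show "eps_triangle R D (vertex 2 0) = sg (E2 = E0)"
    unfolding eps_vertex_aux[OF vertex_params(5,6)] o using orders unfolding ordered_def
    by (auto intro!: arg_cong[where f = sg] split: if_splits)
qed

lemma vertex_writhe:
  assumes ij: "i < 3" "j < 3" "i \<noteq> j" and p: "same_mod_1 (ne_param D (vertex i j)) (rend e (vtx i j) (vtx j i))"
  shows "writhe D (vertex i j) = (if rend e (real (ht j)) (real (ht i)) < lend e (real (ht j)) (real (ht i)) then 1 else - 1)"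
  unfolding writhe_iff[OF D vertex_classical(1)[OF ij]] same_mod_1_curve(3)[OF D p]
  using vertex_over[OF ij] vertex_over[OF ij(2,1) ij(3)[symmetric]]
  by (cases e) (auto simp: rend_def lend_def)

end

text \<open>Two interpretations of the same picture, with \<open>\<kappa> = -1\<close> for \<open>D\<close> and \<open>\<kappa> = 1\<close> for \<open>D'\<close>, share the strands,
  the directions and the heights, and only the orders on the strands differ.\<close>

lemma reid3_result:
  assumes D: "virtual_diagram D" and D': "virtual_diagram D'" and r: "reid3 R D D'"
  obtains g k where "keeps_crossings D D' g (arc_corr R D D')"
    "crossing_corr R D D' = {(v, g v) | v. v \<in> classical D}"
    "\<And>v. v \<in> classical D \<Longrightarrow>
      (\<Sum>u\<in>classical D \<inter> R. eps_triangle R D u * lk D u v) = k * total_lk D v"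
proof -
  obtain h T ht where h: "plane_isotopic h" "R = region h" and ag: "agree_off R D D'" and st: "strands R D 3 T"
    and T0: "\<forall>t\<in>T 0. Im (h (curve D t)) = Re (h (curve D t)) \<and> curve D' t = curve D t"
    and T1: "\<forall>t\<in>T 1. Im (h (curve D t)) = - Re (h (curve D t)) \<and> curve D' t = curve D t"
    and T2: "\<forall>t\<in>T 2. Im (h (curve D t)) = - (1 - (Re (h (curve D t)))\<^sup>2)\<^sup>2 / 2 \<and>
                  Im (h (curve D' t)) = (1 - (Re (h (curve D' t)))\<^sup>2)\<^sup>2 / 2"
    and ht: "inj_on ht {..<3}" "heights T ht D" "heights T ht D'"
    using r unfolding reid3_def by (elim exE conjE) (rule that; assumption)
  have R: "closed R" unfolding h(2) by (rule plane_isotopic_closed_region[OF h(1)])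
  obtain h' where op: "orientation_preserving h h'" using plane_isotopic_orientation[OF h(1)] .
  obtain \<alpha> \<beta> where ss: "strand_system R D 3 T \<alpha> \<beta>" by (rule strandsE[OF st])
  obtain q :: real where q: "0 < q" "q < 1" "q = (1 - q\<^sup>2)\<^sup>2 / 2" by (rule quartic_root)
  have three: "i = 0 \<or> i = 1 \<or> i = 2" if "i < 3" for i :: nat using that by arith
  have inside': "curve D' t \<in> R \<longleftrightarrow> curve D t \<in> R" for t using ag unfolding agree_off_def by blast
  have ss': "strand_system R D' 3 T \<alpha> \<beta>"
    using ss unfolding strand_system_def inside' .
  interpret A: triangle_picture h h' R D T \<alpha> \<beta> ht "-1" q
  proof (intro triangle_picture.intro op ss, unfold_locales)
    show "Im (h (curve D t)) = graph_fun (- 1) i (Re (h (curve D t)))" if "i < 3" "t \<in> T i" for i t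
      using three[OF that(1)] that(2) T0 T1 T2 unfolding graph_fun_def by auto
  qed (use D h ht q in auto)
  interpret B: triangle_picture h h' R D' T \<alpha> \<beta> ht 1 q
  proof (intro triangle_picture.intro op ss', unfold_locales)
    show "Im (h (curve D' t)) = graph_fun 1 i (Re (h (curve D' t)))" if "i < 3" "t \<in> T i" for i t
      using three[OF that(1)] that(2) T0 T1 T2 unfolding graph_fun_def by auto
  qed (use D' h ht q in auto)
  \<comment> \<open>the directions agree because the curves agree at the ends of the strands\<close>
  have dir: "B.dir i = A.dir i" if "i < 3" for i
    unfolding A.dir_def B.dir_def A.abscissa_def B.abscissa_def A.agree_at_ends(1)[OF D D' that ag] ..
  have E: "B.E0 = A.E0" "B.E1 = A.E1" "B.E2 = A.E2"
    unfolding A.E0_def A.E1_def A.E2_def B.E0_def B.E1_def B.E2_def using dir by simp_all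
  define X where "X = A.vertex 0 1"
  define Y where "Y = A.vertex 1 2"
  define Z where "Z = A.vertex 2 0"
  define X' where "X' = B.vertex 0 1"
  define Y' where "Y' = B.vertex 1 2"
  define Z' where "Z' = B.vertex 2 0"
  note vA = A.vertex_set[folded X_def Y_def Z_def] and vB = B.vertex_set[folded X'_def Y'_def Z'_def]
  define V where "V = classical D - R"
  have ch: "classical D = insert X (insert Y (insert Z V))" unfolding V_def using vA by blast
  have clV: "classical D' - R = V" unfolding V_def using classical_outside[OF D D' R ag] by blast
  have ch': "classical D' = insert X' (insert Y' (insert Z' V))" unfolding clV[symmetric] using vB by blast
  have inR: "X \<in> R" "Y \<in> R" "Z \<in> R" "X' \<in> R" "Y' \<in> R" "Z' \<in> R"
    using vA vB by blast+
  define g where "g v = (if v = X then X' else if v = Y then Y' else if v = Z then Z' else v)" for v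
  note dA = A.vertex_distinct[folded X_def Y_def Z_def] and dB = B.vertex_distinct[folded X'_def Y'_def Z'_def]
  have gV: "g v = v" if "v \<in> V" for v using that inR unfolding g_def V_def by auto
  have gX: "g X = X'" "g Y = Y'" "g Z = Z'" unfolding g_def using dA by auto
  have notV: "X \<notin> V" "Y \<notin> V" "Z \<notin> V" "X' \<notin> V" "Y' \<notin> V" "Z' \<notin> V" unfolding V_def using inR by auto
  have im: "g ` classical D = classical D'" unfolding ch ch' using gX gV by (auto simp: image_iff)
  have inj: "inj_on g (classical D)"
    unfolding ch using gV notV dB dA by (auto simp: inj_on_def gX)
  \<comment> \<open>chord diagrams with lifts in the strands at the three vertices\<close>
  define G where "G = (gauss D)\<lparr>
    lpar := (nw_param D)(X := lend (A.E0 = A.E1) (A.vtx 0 1) (A.vtx 1 0),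
      Y := lend (A.E1 = A.E2) (A.vtx 1 2) (A.vtx 2 1), Z := lend (A.E2 = A.E0) (A.vtx 2 0) (A.vtx 0 2)),
    rpar := (ne_param D)(X := rend (A.E0 = A.E1) (A.vtx 0 1) (A.vtx 1 0),
      Y := rend (A.E1 = A.E2) (A.vtx 1 2) (A.vtx 2 1), Z := rend (A.E2 = A.E0) (A.vtx 2 0) (A.vtx 0 2))\<rparr>"
  define G' where "G' = (gauss D')\<lparr>
    lpar := (nw_param D')(X' := lend (A.E0 = A.E1) (B.vtx 0 1) (B.vtx 1 0),
      Y' := lend (A.E1 = A.E2) (B.vtx 1 2) (B.vtx 2 1), Z' := lend (A.E2 = A.E0) (B.vtx 2 0) (B.vtx 0 2)),
    rpar := (ne_param D')(X' := rend (A.E0 = A.E1) (B.vtx 0 1) (B.vtx 1 0),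
      Y' := rend (A.E1 = A.E2) (B.vtx 1 2) (B.vtx 2 1), Z' := rend (A.E2 = A.E0) (B.vtx 2 0) (B.vtx 0 2))\<rparr>"
  note pA = A.vertex_params[folded X_def Y_def Z_def] and pB = B.vertex_params[unfolded E, folded X'_def Y'_def Z'_def]
  have smG: "same_mod_1 (lpar G w) (nw_param D w)" "same_mod_1 (rpar G w) (ne_param D w)" for w
    unfolding G_def using pA[THEN same_mod_1_sym] by auto
  have smG': "same_mod_1 (lpar G' w) (nw_param D' w)" "same_mod_1 (rpar G' w) (ne_param D' w)" for w
    unfolding G'_def using pB[THEN same_mod_1_sym] by auto
  have GG: "(gauss D)\<lparr>lpar := lpar G, rpar := rpar G\<rparr> = G" "(gauss D')\<lparr>lpar := lpar G', rpar := rpar G'\<rparr> = G'"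
    unfolding G_def G'_def by simp_all
  note linkG = choose_lifts[OF smG, unfolded GG] and linkG' = choose_lifts[OF smG', unfolded GG]
  have wr: "writhe D' X' = writhe D X" "writhe D' Y' = writhe D Y" "writhe D' Z' = writhe D Z"
    using A.vertex_writhe[OF _ _ _ A.vertex_params(2)] B.vertex_writhe[OF _ _ _ B.vertex_params(2)]
      A.vertex_writhe[OF _ _ _ A.vertex_params(4)] B.vertex_writhe[OF _ _ _ B.vertex_params(4)]
      A.vertex_writhe[OF _ _ _ A.vertex_params(6)] B.vertex_writhe[OF _ _ _ B.vertex_params(6)]
    unfolding E X_def Y_def Z_def X'_def Y'_def Z'_def by simp_all
  have farV: "ne_param D' w = ne_param D w \<and> nw_param D' w = nw_param D w \<and> writhe D' w = writhe D w" if "w \<in> V" for w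
    using params_outside[OF D D' R ag] that unfolding V_def by blast
  have ab: "\<alpha> i < \<beta> i" if "i < 3" for i using A.lt that by blast
  have gap: "\<exists>n. \<forall>x\<in>A.strand i. \<forall>y\<in>A.strand j. gap n y x" if "i < 3" "j < 3" "i \<noteq> j" for i j
  proof (rule off_gap[of "\<alpha> i" "\<beta> i" "\<alpha> j" "\<beta> j"])
    show "off (\<alpha> j) (\<beta> j) x" if "x \<in> A.strand i" for x using A.other_off \<open>i < 3\<close> \<open>j < 3\<close> \<open>i \<noteq> j\<close> that by blast
    show "off (\<alpha> i) (\<beta> i) y" if "y \<in> A.strand j" for y using A.other_off \<open>i < 3\<close> \<open>j < 3\<close> \<open>i \<noteq> j\<close> that by metis
    show "\<alpha> i \<le> \<beta> i" "\<alpha> j \<le> \<beta> j" using ab that by (simp_all add: less_imp_le)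
  qed blast
  have "\<exists>n. \<forall>x\<in>A.strand 0. \<forall>y\<in>A.strand 1. gap n y x" by (rule gap) simp_all
  then obtain n01 where n01: "\<And>x y. x \<in> A.strand 0 \<Longrightarrow> y \<in> A.strand 1 \<Longrightarrow> gap n01 y x" by blast
  have "\<exists>n. \<forall>x\<in>A.strand 1. \<forall>y\<in>A.strand 2. gap n y x" by (rule gap) simp_all
  then obtain n12 where n12: "\<And>x y. x \<in> A.strand 1 \<Longrightarrow> y \<in> A.strand 2 \<Longrightarrow> gap n12 y x" by blast
  have "\<exists>n. \<forall>x\<in>A.strand 2. \<forall>y\<in>A.strand 0. gap n y x" by (rule gap) simp_all
  then obtain n20 where n20: "\<And>x y. x \<in> A.strand 2 \<Longrightarrow> y \<in> A.strand 0 \<Longrightarrow> gap n20 y x" by blast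
  have inA: "A.vtx 0 j \<in> A.strand 0" "A.vtx 1 j \<in> A.strand 1" "A.vtx 2 j \<in> A.strand 2" for j
    by (rule A.vtx_in(1); simp)+
  have inB: "B.vtx 0 j \<in> A.strand 0" "B.vtx 1 j \<in> A.strand 1" "B.vtx 2 j \<in> A.strand 2" for j
    by (rule B.vtx_in(1); simp)+
  interpret M: third_move G G' g V X Y Z A.E0 A.E1 A.E2 n01 n12 n20
    "\<alpha> 0" "\<beta> 0" "\<alpha> 1" "\<beta> 1" "\<alpha> 2" "\<beta> 2"
    "A.vtx 0 1" "A.vtx 0 2" "A.vtx 1 0" "A.vtx 1 2" "A.vtx 2 1" "A.vtx 2 0"
    "B.vtx 0 1" "B.vtx 0 2" "B.vtx 1 0" "B.vtx 1 2" "B.vtx 2 1" "B.vtx 2 0"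
  proof
    show "chords G = insert X (insert Y (insert Z V))" unfolding G_def using ch by simp
    show "chords G' = g ` chords G" unfolding G_def G'_def using im by simp
    show "inj_on g (chords G)" unfolding G_def using inj by simp
    show "finite V" unfolding V_def using finite_classical[OF D] by simp
    show "X \<noteq> Y" "Y \<noteq> Z" "X \<noteq> Z" by (rule dA)+
    show "X \<notin> V" "Y \<notin> V" "Z \<notin> V" by (rule notV)+
    show "lpar G' (g w) = lpar G w \<and> rpar G' (g w) = rpar G w" if "w \<in> V" for w
    proof -
      have "w \<noteq> X" "w \<noteq> Y" "w \<noteq> Z" "w \<noteq> X'" "w \<noteq> Y'" "w \<noteq> Z'" using that notV by blast+
      then show ?thesis unfolding gV[OF that] G_def G'_def using farV[OF that] by simp
    qed
    show "pos G' (g w) = pos G w" if "w \<in> chords G" for w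
    proof -
      have "w \<in> classical D" using that unfolding G_def by simp
      then have "writhe D' (g w) = writhe D w" unfolding ch using gX gV farV wr by auto
      then show ?thesis unfolding G_def G'_def by simp
    qed
    show "off (\<alpha> 0) (\<beta> 0) t \<and> off (\<alpha> 1) (\<beta> 1) t \<and> off (\<alpha> 2) (\<beta> 2) t" if "w \<in> V" "t = lpar G w \<or> t = rpar G w" for w t
    proof -
      have "w \<noteq> X" "w \<noteq> Y" "w \<noteq> Z" using that notV by blast+
      then have "t = nw_param D w \<or> t = ne_param D w" using that(2) unfolding G_def by simp
      then show ?thesis using A.param_off[OF D, of w] that(1) unfolding V_def by auto
    qed
    show "{A.vtx 0 1, A.vtx 0 2, B.vtx 0 1, B.vtx 0 2} \<subseteq> A.strand 0" using inA inB by blast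
    show "{A.vtx 1 0, A.vtx 1 2, B.vtx 1 0, B.vtx 1 2} \<subseteq> A.strand 1" using inA inB by blast
    show "{A.vtx 2 1, A.vtx 2 0, B.vtx 2 1, B.vtx 2 0} \<subseteq> A.strand 2" using inA inB by blast
    show "triangle n01 n12 n20 A.E0 A.E1 A.E2 (A.vtx 0 1) (A.vtx 0 2) (A.vtx 1 0) (A.vtx 1 2) (A.vtx 2 1) (A.vtx 2 0)"
      unfolding triangle_def gaps_def using n01 n12 n20 inA A.orders by simp
    show "triangle n01 n12 n20 (\<not> A.E0) (\<not> A.E1) (\<not> A.E2) (B.vtx 0 1) (B.vtx 0 2) (B.vtx 1 0) (B.vtx 1 2) (B.vtx 2 1) (B.vtx 2 0)"
      unfolding triangle_def gaps_def using n01 n12 n20 inB B.orders[unfolded E] by simp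
  qed (use dA dB gX in \<open>auto simp: G_def G'_def\<close>)
  have chG: "chords G = classical D" unfolding G_def by simp
  have keeps: "keeps_crossings D D' g (arc_corr R D D')"
    unfolding keeps_crossings_def
  proof (intro conjI ballI)
    show "bij_betw g (classical D) (classical D')" unfolding bij_betw_def using inj im by simp
    have gD: "g v \<in> classical D'" if "v \<in> classical D" for v using im that by blast
    show "lk D' (g u) (g v) = lk D u v" if "u \<in> classical D" "v \<in> classical D" for u v
      unfolding linkG(1)[OF that] linkG'(1)[OF gD[OF that(1)] gD[OF that(2)]]
      by (rule M.third_move_linking) (use that chG in auto)
    show "total_lk D' (g v) = total_lk D v" if "v \<in> classical D" for v
      unfolding linkG(2)[OF that] linkG'(2)[OF gD[OF that]]
      by (rule M.third_move_total) (use that chG in auto)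
    fix p assume "p \<in> arc_corr R D D'"
    then obtain a a' where p: "p = (a, a')" "(a, a') \<in> arc_corr R D D'" by (cases p) auto
    have "signed_half D' (g v) a' = signed_half D v a" if v: "v \<in> classical D" for v
    proof (rule arc_corr_half[OF D D' p(2)])
      fix t assume t: "curve D t \<notin> R"
        and hD: "\<And>v. v \<in> classical D \<Longrightarrow> signed_half D v a = after (gauss D) v t"
        and hD': "\<And>v. v \<in> classical D' \<Longrightarrow> signed_half D' v a' = after (gauss D') v t"
      have o: "off (\<alpha> 0) (\<beta> 0) t" "off (\<alpha> 1) (\<beta> 1) t" "off (\<alpha> 2) (\<beta> 2) t" using t A.outside_off[of t] by auto
      show ?thesis unfolding hD[OF v] hD'[OF gD[OF v]] linkG(3) linkG'(3)
        by (rule M.far_functions(3)[OF _ o]) (use v chG in auto)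
    qed
    then show "case p of (a, a') \<Rightarrow> \<forall>v\<in>classical D.
      signed_half D' (g v) a' = signed_half D v a" unfolding p(1) by simp
  qed
  \<comment> \<open>a pair of corresponding crossings lies on the same two strands, which determines it\<close>
  have gij: "g (A.vertex i j) = B.vertex i j" if ij: "i < 3" "j < 3" "i \<noteq> j" for i j
  proof -
    have "(i = 0 \<and> j = 1) \<or> (i = 1 \<and> j = 0) \<or> (i = 0 \<and> j = 2) \<or> (i = 2 \<and> j = 0) \<or> (i = 1 \<and> j = 2) \<or> (i = 2 \<and> j = 1)"
      using ij by arith
    then show ?thesis
      using gX[unfolded X_def Y_def Z_def X'_def Y'_def Z'_def] A.vertex_commute[of 0 1] A.vertex_commute[of 2 0] A.vertex_commute[of 1 2]
        B.vertex_commute[of 0 1] B.vertex_commute[of 2 0] B.vertex_commute[of 1 2] by auto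
  qed
  have corr: "crossing_corr R D D' = {(v, g v) | v. v \<in> classical D}"
  proof (intro equalityI subsetI)
    fix p assume "p \<in> crossing_corr R D D'"
    then consider "p \<in> Id_on V" | v v' s t s' t' where "p = (v, v')" "v \<in> classical D" "v \<in> R"
      "s - t \<notin> \<int>" "curve D s = v" "curve D t = v" "curve D' s' = v'" "curve D' t' = v'"
      "curve D ` closed_segment s s' \<subseteq> R" "curve D ` closed_segment t t' \<subseteq> R"
      unfolding crossing_corr_def V_def by blast
    then show "p \<in> {(v, g v) | v. v \<in> classical D}"
    proof cases
      case 1
      then show ?thesis using gV ch by auto
    next
      case 2
      have lift: "\<exists>i k. i < 3 \<and> s + of_int k \<in> A.strand i \<and> s' + of_int k \<in> A.strand i"
        if sR: "curve D s \<in> R" and seg: "curve D ` closed_segment s s' \<subseteq> R" for s s'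
      proof -
        obtain i where i: "i < 3" "s \<in> T i" using A.inside[of s] sR by auto
        then obtain k :: int where k: "s + of_int k \<in> A.strand i" using A.T[of i s] unfolding off_def by blast
        have "curve D ` closed_segment (s + of_int k) (s' + of_int k) \<subseteq> R"
          unfolding closed_segment_shift using seg curve_shift[OF D] by auto
        then have "s' + of_int k \<in> A.strand i" by (rule A.stays[OF i(1) k])
        then show ?thesis using i k by blast
      qed
      obtain i k where i: "i < 3" "s + of_int k \<in> A.strand i" "s' + of_int k \<in> A.strand i"
        using lift[of s s'] 2 by auto
      obtain j m where j: "j < 3" "t + of_int m \<in> A.strand j" "t' + of_int m \<in> A.strand j"
        using lift[of t t'] 2 by auto
      have eq: "curve D (s + of_int k) = curve D (t + of_int m)" "curve D' (s' + of_int k) = curve D' (t' + of_int m)"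
        unfolding curve_shift[OF D] curve_shift[OF D'] using 2 by auto
      have ne: "i \<noteq> j"
      proof
        assume "i = j"
        then have "s + of_int k = t + of_int m" using A.curve_inj[OF i(1,2)] j(2) eq(1) by blast
        then have "s - t = of_int (m - k)" by simp
        then show False using 2(4) by (metis Ints_of_int)
      qed
      have "v = A.vertex i j"
        using A.meet(1)[OF i(1) j(1) ne i(2) j(2) eq(1)] 2(5) curve_shift[OF D, of s k] unfolding A.vertex_def by simp
      moreover have "v' = B.vertex i j"
        using B.meet(1)[OF i(1) j(1) ne i(3) j(3) eq(2)] 2(7) curve_shift[OF D', of s' k] unfolding B.vertex_def by simp
      ultimately show ?thesis using gij[OF i(1) j(1) ne] 2(1,2) by auto
    qed
  next
    fix p assume "p \<in> {(v, g v) | v. v \<in> classical D}"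
    then obtain v where v: "p = (v, g v)" "v \<in> classical D" by blast
    show "p \<in> crossing_corr R D D'"
    proof (cases "v \<in> R")
      case False
      then have "v \<in> V" using v unfolding V_def by simp
      then show ?thesis using v gV unfolding crossing_corr_def V_def by auto
    next
      case True
      obtain i j where ij: "i < 3" "j < 3" "i \<noteq> j" "v = A.vertex i j" by (rule A.classical_vertex[OF v(2) True])
      have c: "curve D (A.vtx i j) = v" "curve D (A.vtx j i) = v" "curve D' (B.vtx i j) = g v" "curve D' (B.vtx j i) = g v"
        using ij(4) A.vertex_commute[OF ij(1-3)] B.vertex_commute[OF ij(1-3)] gij[OF ij(1-3)]
        unfolding A.vertex_def B.vertex_def by auto
      have i: "A.vtx i j \<in> A.strand i" "A.vtx j i \<in> A.strand j" "B.vtx i j \<in> A.strand i" "B.vtx j i \<in> A.strand j"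
        using A.vtx_in(1) B.vtx_in(1) ij by blast+
      have nZ: "s - t \<notin> \<int>" if st: "s \<in> A.strand i" "t \<in> A.strand j" for s t
      proof
        assume "s - t \<in> \<int>"
        then have "same_mod_1 s t" unfolding same_mod_1_Ints .
        then have "off (\<alpha> j) (\<beta> j) t" using A.other_off[OF ij(1-3) st(1)] off_same_mod_1 by blast
        then show False using A.interval_T(1)[OF ij(2) st(2)] A.T[OF ij(2)] by blast
      qed
      have gR: "g v \<in> classical D' \<inter> R"
        using B.vertex_classical[OF ij(1-3)] gij[OF ij(1-3)] ij(4) by simp
      have "(v, g v) \<in> {(v, v'). v \<in> classical D \<inter> R \<and> v' \<in> classical D' \<inter> R \<and>
        (\<exists>s t s' t'. s - t \<notin> \<int> \<and> curve D s = v \<and> curve D t = v \<and>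
           curve D' s' = v' \<and> curve D' t' = v' \<and> s' - t' \<notin> \<int> \<and>
           curve D ` closed_segment s s' \<subseteq> R \<and> curve D ` closed_segment t t' \<subseteq> R)}"
        using v(2) True gR c nZ[OF i(1,2)] nZ[OF i(3,4)] A.segment_in_strand[OF ij(1) i(1,3)] A.segment_in_strand[OF ij(2) i(2,4)]
        by blast
      then show ?thesis unfolding v(1) crossing_corr_def by blast
    qed
  qed
  obtain k where k: "\<And>v. v \<in> chords G \<Longrightarrow> sg (A.E0 = A.E1) * linking G X v + sg (A.E1 = A.E2) * linking G Y v +
    sg (A.E2 = A.E0) * linking G Z v = k * total_linking G v"
    by (rule M.third_move_whole) blast
  have "(\<Sum>u\<in>classical D \<inter> R. eps_triangle R D u * lk D u v) = k * total_lk D v"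
    if v: "v \<in> classical D" for v
  proof -
    have X: "X \<in> classical D" "Y \<in> classical D" "Z \<in> classical D" using ch by auto
    show ?thesis
      unfolding vA using dA k[of v] v chG
      by (simp add: A.eps_vertex[folded X_def Y_def Z_def] linkG(1)[OF X(1) v] linkG(1)[OF X(2) v] linkG(1)[OF X(3) v] linkG(2)[OF v])
  qed
  then show thesis using that keeps corr by blast
qed

section \<open>Products of powers of the indices\<close>

text \<open>The values of the index cycle, the parity and the signature all have this form, with exponents that are
  integers read off from the diagram.\<close>

definition power_prod :: "('a, 'm) monoid_scheme \<Rightarrow> 'b set \<Rightarrow> ('b \<Rightarrow> 'a) \<Rightarrow> ('b \<Rightarrow> int) \<Rightarrow> 'a" where
  "power_prod A V p n = (\<Otimes>\<^bsub>A\<^esub>v\<in>V. p v [^]\<^bsub>A\<^esub> n v)"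

context comm_group
begin

lemma power_prod_closed: "p \<in> V \<rightarrow> carrier G \<Longrightarrow> power_prod G V p n \<in> carrier G"
  unfolding power_prod_def by (intro finprod_closed) auto

lemma power_prod_cong:
  assumes "p \<in> V \<rightarrow> carrier G" "\<And>v. v \<in> V \<Longrightarrow> n v = m v"
  shows "power_prod G V p n = power_prod G V p m"
  unfolding power_prod_def using assms by (intro finprod_cong') auto

lemma power_prod_zero:
  assumes "p \<in> V \<rightarrow> carrier G"
  shows "power_prod G V p (\<lambda>_. 0) = \<one>"
  unfolding power_prod_def using assms by (simp add: finprod_one_eqI)

lemma power_prod_mult:
  assumes "p \<in> V \<rightarrow> carrier G"
  shows "power_prod G V p n \<otimes> power_prod G V p m = power_prod G V p (\<lambda>v. n v + m v)"
proof -
  have "power_prod G V p (\<lambda>v. n v + m v) = (\<Otimes>v\<in>V. p v [^] n v \<otimes> p v [^] m v)"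
    unfolding power_prod_def using assms by (intro finprod_cong') (auto simp: int_pow_mult Pi_iff)
  also have "\<dots> = power_prod G V p n \<otimes> power_prod G V p m"
    unfolding power_prod_def using assms by (intro finprod_multf) auto
  finally show ?thesis by simp
qed

lemma power_prod_uminus:
  assumes "p \<in> V \<rightarrow> carrier G"
  shows "power_prod G V p (\<lambda>v. - n v) = inv (power_prod G V p n)"
proof -
  have "power_prod G V p (\<lambda>v. - n v) \<otimes> power_prod G V p n = \<one>"
    using power_prod_mult[OF assms] power_prod_zero[OF assms] by simp
  then show ?thesis using inv_equality power_prod_closed[OF assms] by metis
qed

lemma power_prod_insert:
  assumes "finite V" "u \<notin> V" "p \<in> insert u V \<rightarrow> carrier G"
  shows "power_prod G (insert u V) p n = p u [^] n u \<otimes> power_prod G V p n"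
  unfolding power_prod_def using assms by (intro finprod_insert) auto

lemma power_prod_int_pow:
  assumes "finite V" "p \<in> V \<rightarrow> carrier G"
  shows "power_prod G V p n [^] (k::int) = power_prod G V p (\<lambda>v. k * n v)"
  using assms
proof (induction V rule: finite_induct)
  case empty
  then show ?case by (simp add: power_prod_def)
next
  case (insert u V)
  have "p u \<in> carrier G" "p \<in> V \<rightarrow> carrier G" using insert.prems by auto
  then show ?case
    unfolding power_prod_insert[OF insert.hyps insert.prems]
    using insert.IH by (simp add: int_pow_distrib power_prod_closed int_pow_pow mult.commute)
qed

lemma power_prod_family:
  assumes "finite U" "p \<in> V \<rightarrow> carrier G"
  shows "(\<Otimes>u\<in>U. power_prod G V p (L u)) = power_prod G V p (\<lambda>v. \<Sum>u\<in>U. L u v)"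
  using assms(1)
proof (induction U rule: finite_induct)
  case empty
  then show ?case using power_prod_zero[OF assms(2)] by simp
next
  case (insert u U)
  then show ?case
    using power_prod_closed[OF assms(2)] power_prod_mult[OF assms(2)] by (simp add: Pi_iff)
qed

lemma power_prod_reindex:
  assumes g: "bij_betw g V V'" and p: "p' \<in> V' \<rightarrow> carrier G"
    and eq: "\<And>v. v \<in> V \<Longrightarrow> p v = p' (g v)" "\<And>v. v \<in> V \<Longrightarrow> n v = n' (g v)"
  shows "power_prod G V p n = power_prod G V' p' n'"
proof -
  have V': "V' = g ` V" and inj: "inj_on g V" using g unfolding bij_betw_def by auto
  have "power_prod G V' p' n' = (\<Otimes>v\<in>V. p' (g v) [^] n' (g v))"
    unfolding power_prod_def V' using p V' by (intro finprod_reindex[OF _ inj]) auto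
  also have "\<dots> = power_prod G V p n"
    unfolding power_prod_def using p V' eq by (intro finprod_cong') (auto simp: Pi_iff)
  finally show ?thesis by simp
qed

lemma finprod_coset:
  assumes H: "subgroup H G" and f: "f \<in> U \<rightarrow> carrier G"
  shows "(\<Otimes>\<^bsub>G Mod H\<^esub>u\<in>U. (H #> f u) [^]\<^bsub>G Mod H\<^esub> (e u :: int)) = H #> (\<Otimes>u\<in>U. f u [^] e u)"
proof -
  interpret N: normal H G using subgroup_imp_normal[OF H] .
  interpret Q: comm_group "G Mod H" by (rule abelian_FactGroup[OF H])
  interpret hom: group_hom G "G Mod H" "\<lambda>a. H #> a"
    by (intro group_hom.intro group_hom_axioms.intro N.r_coset_hom_Mod is_group Q.is_group)
  show ?thesis using f
  proof (induction U rule: infinite_finite_induct)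
    case (infinite U)
    then show ?case using hom.hom_one by simp
  next
    case empty
    then show ?case using hom.hom_one by simp
  next
    case (insert u U)
    have c: "f u \<in> carrier G" "f \<in> U \<rightarrow> carrier G" using insert.prems by auto
    have "(\<lambda>u. (H #> f u) [^]\<^bsub>G Mod H\<^esub> e u) \<in> U \<rightarrow> carrier (G Mod H)"
      using c(2) hom.hom_closed by (auto simp: Pi_iff)
    moreover have "(H #> f u) [^]\<^bsub>G Mod H\<^esub> e u \<in> carrier (G Mod H)" using hom.hom_closed c(1) by blast
    ultimately have "(\<Otimes>\<^bsub>G Mod H\<^esub>u\<in>insert u U. (H #> f u) [^]\<^bsub>G Mod H\<^esub> e u) =
        (H #> (f u [^] e u)) \<otimes>\<^bsub>G Mod H\<^esub> (H #> (\<Otimes>u\<in>U. f u [^] e u))"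
      using insert.hyps insert.IH[OF c(2)] hom.hom_int_pow[OF c(1)] Q.finprod_insert by simp
    also have "\<dots> = H #> (f u [^] e u \<otimes> (\<Otimes>u\<in>U. f u [^] e u))"
      using c by (intro hom.hom_mult[symmetric] finprod_closed) (auto simp: Pi_iff)
    also have "f u [^] e u \<otimes> (\<Otimes>u\<in>U. f u [^] e u) = (\<Otimes>u\<in>insert u U. f u [^] e u)"
      using insert.hyps c by (intro finprod_insert[symmetric]) (auto simp: Pi_iff)
    finally show ?case .
  qed
qed

end

section \<open>The index cycle and its parity\<close>

lemma virtual_knot_diagram:
  assumes "K \<in> virtual_knots" "D \<in> K"
  shows "virtual_diagram D"
proof -
  obtain D0 where D0: "virtual_diagram D0" "(D0, D) \<in> (move_rel \<union> move_rel\<inverse>)\<^sup>*"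
    using assms unfolding virtual_knots_def quotient_def by auto
  show ?thesis using D0(2,1)
  proof (induction rule: rtrancl_induct)
    case (step D1 D2)
    then show ?case unfolding move_rel_def move_def by auto
  qed
qed

text \<open>All diagrams along a sequence of moves belong to the knot, so the hypothesis applies to every step.\<close>

lemma virtual_knot_connected:
  assumes K: "K \<in> virtual_knots" and step: "\<And>D D' f c. D \<in> K \<Longrightarrow> D' \<in> K \<Longrightarrow> move D f c D' \<Longrightarrow> F D = F D'"
  obtains D0 where "D0 \<in> K" "\<And>D. D \<in> K \<Longrightarrow> F D = F D0"
proof -
  obtain D0 where D0: "virtual_diagram D0" and KD: "K = {D. (D0, D) \<in> (move_rel \<union> move_rel\<inverse>)\<^sup>*}"
    using K unfolding virtual_knots_def quotient_def by auto
  have F: "F D = F D0" if "(D0, D) \<in> (move_rel \<union> move_rel\<inverse>)\<^sup>*" for D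
    using that
  proof (induction rule: rtrancl_induct)
    case (step D1 D2)
    have "D1 \<in> K" "D2 \<in> K" unfolding KD using step.hyps by (auto intro: rtrancl_into_rtrancl)
    moreover from step.hyps(2) consider f c where "move D1 f c D2" | f c where "move D2 f c D1"
      unfolding move_rel_def by blast
    ultimately have "F D1 = F D2" using assms(2) by cases (blast, metis)
    then show ?case using step.IH by simp
  qed simp
  show thesis
  proof (rule that)
    show "D0 \<in> K" unfolding KD by simp
    show "F D = F D0" if "D \<in> K" for D using that unfolding KD by (intro F) simp
  qed
qed

lemma moves_cases:
  assumes "move D f c D'"
  obtains (keeps) g where "keeps_crossings D D' g c" "f = {(v, g v) | v. v \<in> classical D}"
  | (first) R where "reid1 R D D'" "f = crossing_corr R D D'" "c = arc_corr R D D'"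
  | (second) R where "reid2 R D D'" "f = crossing_corr R D D'" "c = arc_corr R D D'"
proof -
  have D: "virtual_diagram D" "virtual_diagram D'" using assms unfolding move_def by auto
  from assms consider "isotopy_move D f c D'" | "detour_move D f c D'"
    | R where "reid1 R D D'" "f = crossing_corr R D D'" "c = arc_corr R D D'"
    | R where "reid2 R D D'" "f = crossing_corr R D D'" "c = arc_corr R D D'"
    | R where "reid3 R D D'" "f = crossing_corr R D D'" "c = arc_corr R D D'"
    unfolding move_def by blast
  then show thesis
  proof cases
    case 1
    show thesis by (rule isotopy_move_keeps[OF D 1]) (rule keeps)
  next
    case 2
    show thesis by (rule keeps[OF detour_move_keeps[OF D 2]])
  next
    case 3
    then show thesis by (rule first)
  next
    case 4
    then show thesis by (rule second)
  next
    case 5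
    show thesis
    proof (rule reid3_result[OF D 5(1)])
      fix g
      assume "keeps_crossings D D' g (arc_corr R D D')" "crossing_corr R D D' = {(v, g v) | v. v \<in> classical D}"
      then show thesis unfolding 5(2,3)[symmetric] by (rule keeps)
    qed
  qed
qed

locale reduced_index = comm_group A
  for A :: "('a, 'm) monoid_scheme" (structure) +
  fixes K :: "vdiagram set" and \<pi> :: "vdiagram \<Rightarrow> complex \<Rightarrow> 'a"
  assumes knot: "K \<in> virtual_knots"
    and index: "crossing_index K A \<pi>"
    and reduced: "l_plus_reduced K A \<pi>"
begin

lemma diagram: "D \<in> K \<Longrightarrow> virtual_diagram D"
  by (rule virtual_knot_diagram[OF knot])

lemma index_closed: "D \<in> K \<Longrightarrow> \<pi> D \<in> classical D \<rightarrow> carrier A"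
  using index unfolding crossing_index_def by blast

lemma index_move: "D \<in> K \<Longrightarrow> D' \<in> K \<Longrightarrow> move D f c D' \<Longrightarrow> (v, v') \<in> f \<Longrightarrow> \<pi> D v = \<pi> D' v'"
  using index unfolding crossing_index_def by blast

lemma index_second: "D \<in> K \<Longrightarrow> D' \<in> K \<Longrightarrow> reid2 R D D' \<Longrightarrow> v1 \<in> classical D \<inter> R \<Longrightarrow> v2 \<in> classical D \<inter> R \<Longrightarrow>
    \<pi> D v1 = \<pi> D v2"
  using index unfolding crossing_index_def by blast

lemma index_cycle_power: "index_cycle A \<pi> D a = power_prod A (classical D) (\<pi> D) (\<lambda>v. signed_half D v a)"
  unfolding index_cycle_def power_prod_def ..

lemma parity_rep_power:
  assumes D: "D \<in> K" and v: "v \<in> classical D"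
  shows "parity_rep A \<pi> D v = power_prod A (classical D) (\<pi> D) (lk D v)"
  unfolding parity_rep_def power_prod_def
  using intersection_linking[OF diagram[OF D] v] index_closed[OF D] by (intro finprod_cong') auto

lemma signature_power:
  assumes D: "D \<in> K"
  shows "signature A \<pi> D = power_prod A (classical D) (\<pi> D) (total_lk D)"
proof -
  have "(\<Otimes>v\<in>classical D. \<pi> D v [^] ip D v) = power_prod A (classical D) (\<pi> D) (\<lambda>v. - total_lk D v)"
    unfolding power_prod_def using ip_total_linking[OF diagram[OF D]] index_closed[OF D]
    by (intro finprod_cong') auto
  then show ?thesis
    unfolding signature_def power_prod_uminus[OF index_closed[OF D]]
    using power_prod_closed[OF index_closed[OF D]] by simp
qed

text \<open>Equal indices at the two crossings of a bigon merge their powers.\<close>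

lemma bigon_split:
  assumes K: "D \<in> K" "D' \<in> K" and r: "reid2 R D D'" and b: "bigon_removal R D D' v1 v2"
  shows "power_prod A (classical D) (\<pi> D) n = \<pi> D v1 [^] (n v1 + n v2) \<otimes> power_prod A (classical D') (\<pi> D) n"
proof -
  interpret M: bigon_removal R D D' v1 v2 by (rule b)
  have p12: "\<pi> D v1 = \<pi> D v2" using index_second[OF K r] M.vertices by blast
  have c: "\<pi> D \<in> insert v2 (classical D') \<rightarrow> carrier A" "\<pi> D \<in> insert v1 (insert v2 (classical D')) \<rightarrow> carrier A"
    "\<pi> D \<in> classical D' \<rightarrow> carrier A" "\<pi> D v1 \<in> carrier A"
    using index_closed[OF K(1)] M.crossings by auto
  have fin: "finite (classical D')" by (rule finite_classical[OF diagram[OF K(2)]])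
  have fin2: "finite (insert v2 (classical D'))" "v1 \<notin> insert v2 (classical D')" using fin M.removed M.distinct by auto
  have "power_prod A (classical D) (\<pi> D) n = \<pi> D v1 [^] n v1 \<otimes> (\<pi> D v1 [^] n v2 \<otimes> power_prod A (classical D') (\<pi> D) n)"
    unfolding M.crossings power_prod_insert[OF fin2 c(2)] power_prod_insert[OF fin M.removed(2) c(1)] p12 ..
  then show ?thesis using c(4) power_prod_closed[OF c(3), of n] by (simp add: int_pow_mult m_assoc)
qed

text \<open>For a move that keeps the crossings this is a change of variables. In a first or a second move the
  powers belonging to the removed crossings drop out, and the exponents of the others stay.\<close>

lemma moves:
  assumes K: "D \<in> K" "D' \<in> K" and m: "move D f c D'"
  shows chain_move: "(a, a') \<in> c \<Longrightarrow> index_cycle A \<pi> D a = index_cycle A \<pi> D' a'"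
    and parity_move: "(v, v') \<in> f \<Longrightarrow> parity_rep A \<pi> D v = parity_rep A \<pi> D' v'"
    and signature_move: "signature A \<pi> D = signature A \<pi> D'"
proof -
  note V = diagram[OF K(1)] and V' = diagram[OF K(2)]
  note cl = index_closed[OF K(1)] and cl' = index_closed[OF K(2)]
  have "((a, a') \<in> c \<longrightarrow> index_cycle A \<pi> D a = index_cycle A \<pi> D' a') \<and>
    ((v, v') \<in> f \<longrightarrow> parity_rep A \<pi> D v = parity_rep A \<pi> D' v') \<and> signature A \<pi> D = signature A \<pi> D'"
    using m
  proof (cases rule: moves_cases)
    case (keeps g)
    have bij: "bij_betw g (classical D) (classical D')"
      and link: "\<And>u v. u \<in> classical D \<Longrightarrow> v \<in> classical D \<Longrightarrow> lk D u v = lk D' (g u) (g v)"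
      and tot: "\<And>v. v \<in> classical D \<Longrightarrow> total_lk D v = total_lk D' (g v)"
      and half: "\<And>a a' v. (a, a') \<in> c \<Longrightarrow> v \<in> classical D \<Longrightarrow>
        signed_half D v a = signed_half D' (g v) a'"
      using keeps(1) unfolding keeps_crossings_def by fastforce+
    have pg: "\<pi> D v = \<pi> D' (g v)" if "v \<in> classical D" for v
      using index_move[OF K m, of v "g v"] that unfolding keeps(2) by blast
    have gD: "g v \<in> classical D'" if "v \<in> classical D" for v using bij that bij_betwE by blast
    show ?thesis
    proof (intro conjI impI)
      show "index_cycle A \<pi> D a = index_cycle A \<pi> D' a'" if "(a, a') \<in> c"
        unfolding index_cycle_power by (rule power_prod_reindex[OF bij cl']) (erule pg, erule half[OF that])
      show "signature A \<pi> D = signature A \<pi> D'"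
        unfolding signature_power[OF K(1)] signature_power[OF K(2)] by (rule power_prod_reindex[OF bij cl']) (erule pg, erule tot)
      assume "(v, v') \<in> f"
      then have v: "v \<in> classical D" "v' = g v" unfolding keeps(2) by auto
      show "parity_rep A \<pi> D v = parity_rep A \<pi> D' v'"
        unfolding parity_rep_power[OF K(1) v(1)] v(2) parity_rep_power[OF K(2) gD[OF v(1)]]
        by (rule power_prod_reindex[OF bij cl']) (erule pg, erule link[OF v(1)])
    qed
  next
    case (first R)
    obtain v0 where "loop_removal R D D' v0" by (rule reid1_loop_removal[OF V V' first(1)])
    then interpret M: loop_removal R D D' v0 .
    have f: "f = Id_on (classical D')" using first(2) M.correspondence by simp
    have pg: "\<pi> D v = \<pi> D' v" if "v \<in> classical D'" for v
      using index_move[OF K m, of v v] that unfolding f by auto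
    have one: "\<pi> D v0 [^] n = \<one>" if "curve D ` left_half_params D v0 \<subseteq> R \<and> writhe D v0 = 1 \<or>
         curve D ` right_half_params D v0 \<subseteq> R \<and> writhe D v0 = -1" for n :: int
    proof -
      have "\<pi> D v0 = \<one>" using reduced K first(1) M.vertices that unfolding l_plus_reduced_def by blast
      then show ?thesis by (simp add: int_pow_one)
    qed
    have fin: "finite (classical D')" by (rule finite_classical[OF V'])
    have drop: "power_prod A (classical D) (\<pi> D) n = power_prod A (classical D') (\<pi> D') n'"
      if "\<pi> D v0 [^] n v0 = \<one>" "\<And>v. v \<in> classical D' \<Longrightarrow> n v = n' v" for n n'
    proof -
      have "power_prod A (classical D') (\<pi> D) n = power_prod A (classical D') (\<pi> D') n'"
        by (rule power_prod_reindex[of id]) (use cl' pg that in auto)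
      then show ?thesis
        unfolding M.crossings using power_prod_insert[OF fin M.removed, of "\<pi> D" n] cl[unfolded M.crossings] that(1)
          power_prod_closed[OF cl', of n'] by simp
    qed
    show ?thesis
    proof (intro conjI impI)
      show "index_cycle A \<pi> D a = index_cycle A \<pi> D' a'" if c: "(a, a') \<in> c"
      proof -
        have c': "(a, a') \<in> arc_corr R D D'" using c first(3) by simp
        have "\<pi> D v0 [^] (signed_half D v0 a) = \<one>"
          using M.invisible one[of "signed_half D v0 a"] c' by fastforce
        then show ?thesis unfolding index_cycle_power using M.half_survives[OF c'] by (intro drop) auto
      qed
      show "signature A \<pi> D = signature A \<pi> D'"
        unfolding signature_power[OF K(1)] signature_power[OF K(2)] using M.total_loop M.total_survives by (intro drop) auto
      assume "(v, v') \<in> f"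
      then have v: "v \<in> classical D'" "v' = v" "v \<in> classical D" unfolding f M.crossings by auto
      have "\<pi> D v0 [^] lk D v v0 = \<one>"
        using M.invisible one[of "lk D v v0"] v(1) by (metis int_pow_0)
      then show "parity_rep A \<pi> D v = parity_rep A \<pi> D' v'"
        unfolding v(2) parity_rep_power[OF K(1) v(3)] parity_rep_power[OF K(2) v(1)]
        using M.linking_survives[OF v(1)] by (intro drop) auto
    qed
  next
    case (second R)
    obtain v1 v2 where "bigon_removal R D D' v1 v2" by (rule reid2_bigon_removal[OF V V' second(1)])
    note bigon = this
    interpret M: bigon_removal R D D' v1 v2 by (rule bigon)
    have f: "f = Id_on (classical D')" using second(2) M.correspondence by simp
    have pg: "\<pi> D v = \<pi> D' v" if "v \<in> classical D'" for v
      using index_move[OF K m, of v v] that unfolding f by auto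
    have drop: "power_prod A (classical D) (\<pi> D) n = power_prod A (classical D') (\<pi> D') n'"
      if n0: "n v1 + n v2 = 0" and n': "\<And>v. v \<in> classical D' \<Longrightarrow> n v = n' v" for n n'
    proof -
      have "power_prod A (classical D') (\<pi> D) n = power_prod A (classical D') (\<pi> D') n'"
        by (rule power_prod_reindex[of id]) (use cl' pg n' in auto)
      then show ?thesis
        unfolding bigon_split[OF K second(1) bigon] n0
        using power_prod_closed[OF cl', of n'] by simp
    qed
    show ?thesis
    proof (intro conjI impI)
      show "index_cycle A \<pi> D a = index_cycle A \<pi> D' a'" if c: "(a, a') \<in> c"
      proof -
        have c': "(a, a') \<in> arc_corr R D D'" using c second(3) by simp
        show ?thesis unfolding index_cycle_power using M.half_survives[OF c'] M.half_cancels[OF c'] by (intro drop) auto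
      qed
      show "signature A \<pi> D = signature A \<pi> D'"
        unfolding signature_power[OF K(1)] signature_power[OF K(2)] using M.total_cancels M.total_survives by (intro drop) auto
      assume "(v, v') \<in> f"
      then have v: "v \<in> classical D'" "v' = v" "v \<in> classical D" unfolding f M.crossings by auto
      show "parity_rep A \<pi> D v = parity_rep A \<pi> D' v'"
        unfolding v(2) parity_rep_power[OF K(1) v(3)] parity_rep_power[OF K(2) v(1)]
        using M.linking_survives[OF v(1)] M.linking_cancels[OF v(1)] by (intro drop) auto
    qed
  qed
  then show "(a, a') \<in> c \<Longrightarrow> index_cycle A \<pi> D a = index_cycle A \<pi> D' a'"
    "(v, v') \<in> f \<Longrightarrow> parity_rep A \<pi> D v = parity_rep A \<pi> D' v'"
    "signature A \<pi> D = signature A \<pi> D'" by auto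
qed

lemma index_cycle_H1:
  assumes D: "D \<in> K"
  shows "index_cycle A \<pi> D \<in> H1 D A"
proof -
  note V = diagram[OF D] and cl = index_closed[OF D]
  have "index_cycle A \<pi> D (SW D w) \<otimes> index_cycle A \<pi> D (SE D w) = index_cycle A \<pi> D (NW D w) \<otimes> index_cycle A \<pi> D (NE D w)"
    if w: "w \<in> classical D" for w
    unfolding index_cycle_power power_prod_mult[OF cl]
    by (rule power_prod_cong[OF cl])
      (simp only: SW_def SE_def NW_def NE_def signed_half_in_out[OF V] signed_half_cycle[OF V _ w])
  moreover have "index_cycle A \<pi> D \<in> C1 D A"
    unfolding C1_def index_cycle_power using power_prod_closed[OF cl] by auto
  ultimately show ?thesis unfolding H1_def by blast
qed

lemma parity_first:
  assumes K: "D \<in> K" "D' \<in> K" and r: "reid1 R D D'" and v: "v \<in> classical D \<inter> R"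
  shows "parity_rep A \<pi> D v = \<one> \<or> parity_rep A \<pi> D v = signature A \<pi> D"
proof -
  obtain v0 where "loop_removal R D D' v0" by (rule reid1_loop_removal[OF diagram[OF K(1)] diagram[OF K(2)] r])
  then interpret M: loop_removal R D D' v0 .
  have v0: "v0 \<in> classical D" "v = v0" using v M.vertices by auto
  note cl = index_closed[OF K(1)] and p = parity_rep_power[OF K(1) v0(1)]
  from M.path show ?thesis
  proof
    assume "\<forall>v\<in>classical D. lk D v0 v = 0"
    then have "parity_rep A \<pi> D v0 = power_prod A (classical D) (\<pi> D) (\<lambda>_. 0)"
      unfolding p by (intro power_prod_cong[OF cl]) auto
    then show ?thesis unfolding v0(2) using power_prod_zero[OF cl] by simp
  next
    assume "\<forall>v\<in>classical D. lk D v0 v = total_lk D v"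
    then have "parity_rep A \<pi> D v0 = signature A \<pi> D"
      unfolding p signature_power[OF K(1)] by (intro power_prod_cong[OF cl]) auto
    then show ?thesis unfolding v0(2) ..
  qed
qed

lemma parity_second:
  assumes K: "D \<in> K" "D' \<in> K" and r: "reid2 R D D'"
    and v: "v \<in> classical D \<inter> R" "w \<in> classical D \<inter> R" "v \<noteq> w"
  shows "parity_rep A \<pi> D v \<otimes> parity_rep A \<pi> D w = signature A \<pi> D"
proof -
  obtain v1 v2 where bigon: "bigon_removal R D D' v1 v2"
    by (rule reid2_bigon_removal[OF diagram[OF K(1)] diagram[OF K(2)] r])
  interpret M: bigon_removal R D D' v1 v2 by (rule bigon)
  note cl = index_closed[OF K(1)] and bs = bigon_split[OF K r bigon]
  have in1: "v1 \<in> classical D" "v2 \<in> classical D" and cl': "\<pi> D \<in> classical D' \<rightarrow> carrier A"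
    using cl M.crossings by auto
  note p = parity_rep_power[OF K(1) in1(1)] parity_rep_power[OF K(1) in1(2)]
  have "parity_rep A \<pi> D v1 \<otimes> parity_rep A \<pi> D v2 =
      power_prod A (classical D) (\<pi> D) (\<lambda>v. lk D v1 v + lk D v2 v)"
    unfolding p power_prod_mult[OF cl] ..
  also have "\<dots> = signature A \<pi> D"
    unfolding signature_power[OF K(1)] bs M.total_cancels M.self_linking
    using M.paths_whole by (intro arg_cong2[where f = "(\<otimes>)"] refl power_prod_cong[OF cl'])
  finally have prod: "parity_rep A \<pi> D v1 \<otimes> parity_rep A \<pi> D v2 = signature A \<pi> D" .
  have cp: "parity_rep A \<pi> D v1 \<in> carrier A" "parity_rep A \<pi> D v2 \<in> carrier A"
    unfolding p using power_prod_closed[OF cl] by auto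
  have "(v = v1 \<and> w = v2) \<or> (v = v2 \<and> w = v1)" using v M.vertices by auto
  then show ?thesis using prod m_comm[OF cp] by auto
qed

lemma parity_third:
  assumes K: "D \<in> K" "D' \<in> K" and r: "reid3 R D D'"
  obtains k :: int where "(\<Otimes>v\<in>classical D \<inter> R. parity_rep A \<pi> D v [^] eps_triangle R D v) = signature A \<pi> D [^] k"
proof (rule reid3_result[OF diagram[OF K(1)] diagram[OF K(2)] r])
  fix g k
  assume k: "\<And>v. v \<in> classical D \<Longrightarrow>
      (\<Sum>u\<in>classical D \<inter> R. eps_triangle R D u * lk D u v) = k * total_lk D v"
  note cl = index_closed[OF K(1)] and fin = finite_classical[OF diagram[OF K(1)]]
  have "(\<Otimes>v\<in>classical D \<inter> R. parity_rep A \<pi> D v [^] eps_triangle R D v) =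
      (\<Otimes>u\<in>classical D \<inter> R. power_prod A (classical D) (\<pi> D) (\<lambda>v. eps_triangle R D u * lk D u v))"
    using parity_rep_power[OF K(1)] power_prod_int_pow[OF fin cl] power_prod_closed[OF cl]
    by (intro finprod_cong') auto
  also have "\<dots> = power_prod A (classical D) (\<pi> D)
      (\<lambda>v. \<Sum>u\<in>classical D \<inter> R. eps_triangle R D u * lk D u v)"
    by (rule power_prod_family[OF _ cl]) (use fin in simp)
  also have "\<dots> = power_prod A (classical D) (\<pi> D) (\<lambda>v. k * total_lk D v)"
    by (rule power_prod_cong[OF cl]) (rule k)
  also have "\<dots> = signature A \<pi> D [^] k"
    unfolding signature_power[OF K(1)] power_prod_int_pow[OF fin cl] ..
  finally show thesis by (rule that)
qed

text \<open>The axioms for the three Reidemeister moves say that certain products of values of the parity are powers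
  of the signature: the power \<open>0\<close> or \<open>1\<close> for a first move, \<open>1\<close> for a second and \<open>k\<close> for a third.\<close>

theorem cycle_and_parity:
  "invariant_cycle K A (index_cycle A \<pi>) \<and>
    (\<exists>\<sigma>\<in>carrier A.
       (\<forall>D\<in>K. signature A \<pi> D = \<sigma>) \<and>
       oriented_parity K (A Mod generate A {\<sigma>})
         (\<lambda>D v. generate A {\<sigma>} #>\<^bsub>A\<^esub> parity_rep A \<pi> D v))"
proof
  show "invariant_cycle K A (index_cycle A \<pi>)"
    unfolding invariant_cycle_def invariant_chain_def
    using index_cycle_H1 chain_move unfolding H1_def by fast
  obtain D0 where D0: "D0 \<in> K" "\<And>D. D \<in> K \<Longrightarrow> signature A \<pi> D = signature A \<pi> D0"
    by (rule virtual_knot_connected[OF knot, of "signature A \<pi>"]) (use signature_move in blast)+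
  define \<sigma> where "\<sigma> = signature A \<pi> D0"
  have \<sigma>: "\<sigma> \<in> carrier A"
    unfolding \<sigma>_def signature_power[OF D0(1)] by (rule power_prod_closed[OF index_closed[OF D0(1)]])
  have sig: "signature A \<pi> D = \<sigma>" if "D \<in> K" for D using D0(2)[OF that] unfolding \<sigma>_def .
  define H where "H = generate A {\<sigma>}"
  have H: "subgroup H A" unfolding H_def by (rule generate_is_subgroup) (use \<sigma> in simp)
  have \<sigma>H: "\<sigma> \<in> H" unfolding H_def by (rule generate.incl) simp
  interpret N: normal H A using subgroup_imp_normal[OF H] .
  have trivial: "H #> x = \<one>\<^bsub>A Mod H\<^esub>" if "x \<in> H" for x
    using coset_join2[OF subgroup.mem_carrier[OF H that] H that] by simp
  have closed: "parity_rep A \<pi> D v \<in> carrier A" if "D \<in> K" "v \<in> classical D" for D v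
    unfolding parity_rep_power[OF that] by (rule power_prod_closed[OF index_closed[OF that(1)]])
  have "oriented_parity K (A Mod H) (\<lambda>D v. H #> parity_rep A \<pi> D v)"
    unfolding oriented_parity_def
  proof (intro conjI ballI allI impI)
    show "comm_group (A Mod H)" by (rule abelian_FactGroup[OF H])
    show "(\<lambda>v. H #> parity_rep A \<pi> D v) \<in> classical D \<rightarrow> carrier (A Mod H)" if "D \<in> K" for D
      using closed[OF that] by (auto simp: FactGroup_def RCOSETS_def)
    show "case p of (v, v') \<Rightarrow> H #> parity_rep A \<pi> D v = H #> parity_rep A \<pi> D' v'"
      if "D \<in> K" "D' \<in> K" "move D f c D'" "p \<in> f" for D D' f c p
      using parity_move[OF that(1-3)] that(4) by (cases p) simp
    show "H #> parity_rep A \<pi> D v = \<one>\<^bsub>A Mod H\<^esub>"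
      if "D \<in> K" "D' \<in> K" "reid1 R D D'" "v \<in> classical D \<inter> R" for D D' R v
      using parity_first[OF that] sig[OF that(1)] \<sigma>H subgroup.one_closed[OF H] by (intro trivial) auto
    show "(H #> parity_rep A \<pi> D v1) \<otimes>\<^bsub>A Mod H\<^esub> (H #> parity_rep A \<pi> D v2) = \<one>\<^bsub>A Mod H\<^esub>"
      if "D \<in> K" "D' \<in> K" "reid2 R D D'" "v1 \<in> classical D \<inter> R" "v2 \<in> classical D \<inter> R" "v1 \<noteq> v2" for D D' R v1 v2
    proof -
      have "(H #> parity_rep A \<pi> D v1) \<otimes>\<^bsub>A Mod H\<^esub> (H #> parity_rep A \<pi> D v2) = H #> \<sigma>"
        using parity_second[OF that] sig[OF that(1)] N.rcos_sum closed[OF that(1)] that by simp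
      then show ?thesis using trivial[OF \<sigma>H] by simp
    qed
    show "(\<Otimes>\<^bsub>A Mod H\<^esub>v\<in>classical D \<inter> R. (H #> parity_rep A \<pi> D v) [^]\<^bsub>A Mod H\<^esub> eps_triangle R D v) = \<one>\<^bsub>A Mod H\<^esub>"
      if "D \<in> K" "D' \<in> K" "reid3 R D D'" for D D' R
    proof -
      note third = that
      obtain k :: int where k: "(\<Otimes>v\<in>classical D \<inter> R. parity_rep A \<pi> D v [^] eps_triangle R D v) = \<sigma> [^] k"
        using parity_third[OF third] unfolding sig[OF third(1)] by blast
      have "(\<Otimes>\<^bsub>A Mod H\<^esub>v\<in>classical D \<inter> R. (H #> parity_rep A \<pi> D v) [^]\<^bsub>A Mod H\<^esub> eps_triangle R D v) = H #> (\<sigma> [^] k)"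
        using finprod_coset[OF H, of "parity_rep A \<pi> D" "classical D \<inter> R" "eps_triangle R D"] closed[OF that(1)]
        unfolding k by auto
      then show ?thesis using trivial[OF subgroup_int_pow_closed[OF H \<sigma>H]] by simp
    qed
  qed
  then show "\<exists>\<sigma>\<in>carrier A.
       (\<forall>D\<in>K. signature A \<pi> D = \<sigma>) \<and>
       oriented_parity K (A Mod generate A {\<sigma>})
         (\<lambda>D v. generate A {\<sigma>} #>\<^bsub>A\<^esub> parity_rep A \<pi> D v)"
    using \<sigma> sig unfolding H_def by blast
qed

end

theorem theorem5:
  fixes A :: "('a, 'm) monoid_scheme"
    and K :: "vdiagram set"
    and \<pi> :: "vdiagram \<Rightarrow> complex \<Rightarrow> 'a"
  assumes "comm_group A"
    and "K \<in> virtual_knots"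
    and "crossing_index K A \<pi>"
    and "l_plus_reduced K A \<pi>"
  shows "invariant_cycle K A (index_cycle A \<pi>) \<and>
    (\<exists>\<sigma>\<in>carrier A.
       (\<forall>D\<in>K. signature A \<pi> D = \<sigma>) \<and>
       oriented_parity K (A Mod generate A {\<sigma>})
         (\<lambda>D v. generate A {\<sigma>} #>\<^bsub>A\<^esub> parity_rep A \<pi> D v))"
  using assms by (intro reduced_index.cycle_and_parity reduced_index.intro reduced_index_axioms.intro)

end
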